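(* Let $\mathbb{C}(\tilde E_7)=\{t\in\mathbb{C}:t^2\ne4\}$, and let the groupoids $\mathrm{Grp}^k(\tilde E_7)$, the matrices $B_{\alpha,\beta}$, $\tilde B_{\alpha,\beta,\gamma}$ and the map $\pi'$ be as defined in the context. (1) For $k=0,1$, the groupoid $\mathrm{Grp}^k(\tilde E_7)$ restricted to $\mathbb{C}(\tilde E_7)\setminus\{0,\pm6\}$ is identical to the action groupoid $$\mathrm{Grp}^{\mathrm{ac}}\big(\mathbb{C}(\tilde E_7)\setminus\{0,\pm6\}\ \big|\ \{\tilde B_{\alpha,\beta,\gamma},\ \gamma\in\mathbb{C}^*\}\big).$$ Here $\alpha$ and $\beta$ take values in $\{0,\pm1,\pm i\}$ and are not simultaneously zero, and the matrices $\tilde B_{\alpha,\beta,\gamma}$ act on the points of $\mathbb{C}(\tilde E_7)$ through $\pi'$, restricting to the $(x,y)$ coordinates (that is, through $\pi'(B_{\alpha,\beta})$). (2) If $k\geqslant2$ or $k=\infty$, then, with $\alpha,\beta\in\{\pm1,\pm i\}$, $$\mathrm{Grp}^k(\tilde E_7)(t,s)=\begin{cases}\{\mathrm{Id},\ \tilde B_{-1,0,1},\ \tilde B_{0,1,1},\ \tilde B_{0,-1,1}\} & \text{when } s=t;\\ \{\tilde B_{\alpha,0,1},\ \tilde B_{0,\alpha,1}\} & \text{when } s=\alpha^2t;\\ \{\tilde B_{\alpha,\beta,\pm\sqrt{2+\alpha^2t}}\} & \text{when } s=\dfrac{\beta^2(12-2\alpha^2t)}{2+\alpha^2t}.\end{cases}$$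 (3) (Torelli-type theorem) For $t\in\mathbb{C}(\tilde E_7)\setminus\{0,\pm6\}$, the first Yau algebra $L^1(\tilde E_7;t)$ determines the isomorphism class of the $\tilde E_7$-family.
   Context: Let $\mathcal O=\mathbb{C}[[x,y,z]]$ with maximal ideal $m$ and weights $\mathbf w=(1,1,2)$ for $(x,y,z)$. The $\tilde E_7$-family consists of the isolated singularities $f_t=0$ with $f_t=x^4+y^4+z^2+t\,x^2y^2$, $t\in\mathbb{C}(\tilde E_7)$. Put $J(f_t)=\langle\partial_xf_t,\partial_yf_t,\partial_zf_t\rangle$, $I_k(t)=\langle f_t,m^kJ(f_t)\rangle$ for integers $k\ge0$, $I_\infty(t)=\langle f_t\rangle$, and $\mathcal A^k(\tilde E_7;t)=\mathcal O/I_k(t)$. The first Yau algebra is the derivation Lie algebra $L^1(\tilde E_7;t)=\mathrm{Der}(\mathcal A^1(\tilde E_7;t),\mathcal A^1(\tilde E_7;t))$. Isomorphism of two singularities $f_t=0$ and $f_s=0$ means contact equivalence: $\phi(f_t)=u f_s$ for some automorphism $\phi$ of $\mathcal O$ and some unit $u\in\mathcal O^*$. The groupoid $\mathrm{Grp}^k(\tilde E_7)$, $k\in\mathbb{Z}_{\ge0}\cup\{\infty\}$, has as objects the parameters $t\in\mathbb{C}(\tilde E_7)$; the set $\mathrm{Grp}^k(\tilde E_7)(t,s)$ of morphisms from $t$ to $s$ consists of the homogeneous (weight-preserving) isomorphisms $\mathcal A^k(\tilde E_7;t)\to\mathcal A^k(\tilde E_7;s)$ modulo scalars in $\mathbb{C}^*$.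 Such a morphism is expressed as a homogeneous automorphism $\phi$ of $\mathcal O$ with $\phi(I_k(t))=I_k(s)$, taken modulo the $\mathbb{C}^*$-action $(x,y,z)\mapsto(\lambda x,\lambda y,\lambda^2z)$. A $3\times3$ matrix $M$ represents the substitution $(x,y,z)^T=M(x',y',z')^T$, where $x,y,z$ are the coordinates at $t$ and $x',y',z'$ those at $s$. For $\alpha,\beta\in\{\pm1,\pm i\}$ let $$B_{\alpha,0}=\begin{pmatrix}1&0\\0&\alpha\end{pmatrix},\quad B_{0,\beta}=\begin{pmatrix}0&\beta\\1&0\end{pmatrix},\quad B_{\alpha,\beta}=\begin{pmatrix}1&\beta\\\alpha&-\alpha\beta\end{pmatrix},$$ and for $\gamma\in\mathbb{C}^*$ let $\tilde B_{\alpha,\beta,\gamma}=\begin{pmatrix}B_{\alpha,\beta}&0\\0&\gamma\end{pmatrix}$, where one (but not both) of $\alpha,\beta$ may be $0$. The classes modulo scalars of the 24 matrices $B_{\alpha,\beta}$ form a group $G'$ isomorphic to the symmetric group on four letters. The map $\pi'$ from $G'$ to the group of the six fractional linear transformations $t\mapsto\pm t$, $t\mapsto\pm\frac{12-2t}{2+t}$, $t\mapsto\pm\frac{12+2t}{2-t}$ sends $B_{\alpha,\beta}$ (with $\alpha,\beta\in\{\pm1,\pm i\}$) to $t\mapsto\frac{\beta^2(12-2\alpha^2t)}{2+t\alpha^2}$, and sends $B_{\alpha,0}$ and $B_{0,\alpha}$ to $t\mapsto\alpha^2t$. For a group $G$ acting on a set $X$, the action groupoid $\mathrm{Grp}^{\mathrm{ac}}(X|G)$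 has as objects the elements of $X$, as morphisms $x\to y$ the elements $g\in G$ with $gx=y$, and composition given by the binary operation of $G$.
   Formalization: In (2), the first two lines of the display are corrected to allow last index γ = ±1 instead of only γ = 1, since z ↦ −z fixes every f_t and is a morphism not listed; overlapping cases are read as a union, and the set is empty if no case applies. *)

theory Defs
  imports
    "HOL-Analysis.Analysis"
    "HOL-Algebra.Algebra"
    "HOL-Algebra.Algebraic_Closure_Type"
    "HOL-Computational_Algebra.Formal_Power_Series"
    "HOL-Library.Extended_Nat"
begin

section \<open>The ring of formal power series in three variables\<close>

text \<open>
  The ring $\mathbb{C}[[x,y,z]]$ is taken as the iterated ring
  $\mathbb{C}[[x]][[y]][[z]]$; \<open>coeff3 f i j k\<close> is the coefficient of $x^i y^j z^k$.
\<close>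

type_synonym cps = "complex fps fps fps"

definition coeff3 :: "cps \<Rightarrow> nat \<Rightarrow> nat \<Rightarrow> nat \<Rightarrow> complex" where
  "coeff3 f i j k = fps_nth (fps_nth (fps_nth f k) j) i"

definition Abs3 :: "(nat \<Rightarrow> nat \<Rightarrow> nat \<Rightarrow> complex) \<Rightarrow> cps" where
  "Abs3 c = Abs_fps (\<lambda>k. Abs_fps (\<lambda>j. Abs_fps (\<lambda>i. c i j k)))"

definition cst :: "complex \<Rightarrow> cps" where
  "cst c = fps_const (fps_const (fps_const c))"

definition varX :: cps where "varX = fps_const (fps_const fps_X)"
definition varY :: cps where "varY = fps_const fps_X"
definition varZ :: cps where "varZ = fps_X"

definition dx :: "cps \<Rightarrow> cps" where
  "dx f = Abs3 (\<lambda>i j k. of_nat (Suc i) * coeff3 f (Suc i) j k)"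
definition dy :: "cps \<Rightarrow> cps" where
  "dy f = Abs3 (\<lambda>i j k. of_nat (Suc j) * coeff3 f i (Suc j) k)"
definition dz :: "cps \<Rightarrow> cps" where
  "dz f = Abs3 (\<lambda>i j k. of_nat (Suc k) * coeff3 f i j (Suc k))"

abbreviation \<O> :: "cps ring" where
  "\<O> \<equiv> ring_of_type_algebra"

definition max_ideal :: "cps set" where
  "max_ideal = Idl\<^bsub>\<O>\<^esub> {varX, varY, varZ}"

primrec max_ideal_pow :: "nat \<Rightarrow> cps set" where
  "max_ideal_pow 0 = carrier \<O>"
| "max_ideal_pow (Suc n) = max_ideal \<cdot>\<^bsub>\<O>\<^esub> max_ideal_pow n"

text \<open>Automorphisms of $\mathbb{C}[[x,y,z]]$ are those of $\mathbb{C}$-algebras.\<close>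

definition alg_auts :: "(cps \<Rightarrow> cps) set" where
  "alg_auts = {\<phi> \<in> ring_iso \<O> \<O>. \<forall>c. \<phi> (cst c) = cst c}"

definition contact_equivalent :: "cps \<Rightarrow> cps \<Rightarrow> bool" where
  "contact_equivalent f g \<longleftrightarrow> (\<exists>\<phi> \<in> alg_auts. \<exists>u \<in> Units \<O>. \<phi> f = u * g)"

text \<open>Homogeneity refers to the weights $(1,1,2)$ of $(x,y,z)$.\<close>

definition whomogeneous :: "nat \<Rightarrow> cps \<Rightarrow> bool" where
  "whomogeneous d f \<longleftrightarrow> (\<forall>i j k. coeff3 f i j k \<noteq> 0 \<longrightarrow> i + j + 2 * k = d)"

definition homog_auts :: "(cps \<Rightarrow> cps) set" where
  "homog_auts = {\<phi> \<in> alg_auts. \<forall>d f. whomogeneous d f \<longrightarrow> whomogeneous d (\<phi> f)}"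

definition homog_aut_group :: "(cps \<Rightarrow> cps) monoid" where
  "homog_aut_group = \<lparr>carrier = homog_auts, monoid.mult = (\<circ>), one = id\<rparr>"

text \<open>
  \<open>lin M r\<close> is the \<open>r\<close>-th entry of $M (x,y,z)^T$, and \<open>lin_subst M\<close> substitutes these linear
  forms for $x,y,z$. As they are linear, only the monomials $x^a y^b z^c$ of \<open>f\<close> with
  $a+b+c = i+j+k$ contribute to the coefficient of $x^i y^j z^k$ in the result.
\<close>

definition lin :: "complex^3^3 \<Rightarrow> 3 \<Rightarrow> cps" where
  "lin M r = cst (M $ r $ 1) * varX + cst (M $ r $ 2) * varY + cst (M $ r $ 3) * varZ"

definition lin_subst :: "complex^3^3 \<Rightarrow> cps \<Rightarrow> cps" where
  "lin_subst M f = Abs3 (\<lambda>i j k.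
     \<Sum>(a, b, c) \<in> {(a, b, c). a + b + c = i + j + k}.
       coeff3 f a b c * coeff3 (lin M 1 ^ a * lin M 2 ^ b * lin M 3 ^ c) i j k)"

definition scaling :: "complex \<Rightarrow> cps \<Rightarrow> cps" where
  "scaling c = lin_subst (vector [vector [c, 0, 0], vector [0, c, 0], vector [0, 0, c\<^sup>2]])"

definition scalars :: "(cps \<Rightarrow> cps) set" where
  "scalars = {scaling c | c. c \<noteq> 0}"

definition scalar_class :: "(cps \<Rightarrow> cps) \<Rightarrow> (cps \<Rightarrow> cps) set" where
  "scalar_class \<phi> = scalars #>\<^bsub>homog_aut_group\<^esub> \<phi>"


section \<open>Groupoids\<close>

text \<open>\<open>Comp G g f\<close> is the composite \<open>f\<close> followed by \<open>g\<close>.\<close>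

record ('o, 'm) groupoid =
  Obj :: "'o set"
  Mor :: "'o \<Rightarrow> 'o \<Rightarrow> 'm set"
  Comp :: "'m \<Rightarrow> 'm \<Rightarrow> 'm"

definition restrict_groupoid :: "('o, 'm) groupoid \<Rightarrow> 'o set \<Rightarrow> ('o, 'm) groupoid" where
  "restrict_groupoid G U =
     \<lparr>Obj = Obj G \<inter> U,
      Mor = (\<lambda>x y. if x \<in> U \<and> y \<in> U then Mor G x y else {}),
      Comp = Comp G\<rparr>"

definition action_groupoid ::
    "('g, 'b) monoid_scheme \<Rightarrow> 'x set \<Rightarrow> ('g \<Rightarrow> 'x \<Rightarrow> 'x) \<Rightarrow> ('x, 'g) groupoid" where
  "action_groupoid G S act =
     \<lparr>Obj = S,
      Mor = (\<lambda>x y. {g \<in> carrier G. x \<in> S \<and> y \<in> S \<and> act g x = y}),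
      Comp = monoid.mult G\<rparr>"


section \<open>Derivation Lie algebras\<close>

record 'a lie_alg =
  lie_carrier :: "'a set"
  lie_add :: "'a \<Rightarrow> 'a \<Rightarrow> 'a"
  lie_smult :: "complex \<Rightarrow> 'a \<Rightarrow> 'a"
  lie_bracket :: "'a \<Rightarrow> 'a \<Rightarrow> 'a"

definition lie_isomorphic :: "'a lie_alg \<Rightarrow> 'b lie_alg \<Rightarrow> bool" where
  "lie_isomorphic L M \<longleftrightarrow>
     (\<exists>F. bij_betw F (lie_carrier L) (lie_carrier M) \<and>
       (\<forall>D \<in> lie_carrier L. \<forall>E \<in> lie_carrier L.
          F (lie_add L D E) = lie_add M (F D) (F E) \<and>
          F (lie_bracket L D E) = lie_bracket M (F D) (F E)) \<and>
       (\<forall>c. \<forall>D \<in> lie_carrier L. F (lie_smult L c D) = lie_smult M c (F D)))"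

text \<open>
  \<open>A\<close> is a commutative $\mathbb{C}$-algebra with structure map \<open>\<iota>\<close>; derivations are
  $\mathbb{C}$-linear and are represented by functions that are undefined off the carrier.
\<close>

definition derivations :: "('a, 'm) ring_scheme \<Rightarrow> (complex \<Rightarrow> 'a) \<Rightarrow> ('a \<Rightarrow> 'a) set" where
  "derivations A \<iota> =
     {D \<in> carrier A \<rightarrow>\<^sub>E carrier A.
       (\<forall>a \<in> carrier A. \<forall>b \<in> carrier A.
          D (a \<oplus>\<^bsub>A\<^esub> b) = D a \<oplus>\<^bsub>A\<^esub> D b \<and>
          D (a \<otimes>\<^bsub>A\<^esub> b) = (D a \<otimes>\<^bsub>A\<^esub> b) \<oplus>\<^bsub>A\<^esub> (a \<otimes>\<^bsub>A\<^esub> D b)) \<and>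
       (\<forall>c. \<forall>a \<in> carrier A. D (\<iota> c \<otimes>\<^bsub>A\<^esub> a) = \<iota> c \<otimes>\<^bsub>A\<^esub> D a)}"

definition Der :: "('a, 'm) ring_scheme \<Rightarrow> (complex \<Rightarrow> 'a) \<Rightarrow> ('a \<Rightarrow> 'a) lie_alg" where
  "Der A \<iota> =
     \<lparr>lie_carrier = derivations A \<iota>,
      lie_add = (\<lambda>D E. \<lambda>a \<in> carrier A. D a \<oplus>\<^bsub>A\<^esub> E a),
      lie_smult = (\<lambda>c D. \<lambda>a \<in> carrier A. \<iota> c \<otimes>\<^bsub>A\<^esub> D a),
      lie_bracket = (\<lambda>D E. \<lambda>a \<in> carrier A. D (E a) \<ominus>\<^bsub>A\<^esub> E (D a))\<rparr>"


section \<open>The family \<open>E\<^sub>7\<close>-tilde\<close>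

definition params :: "complex set" where
  "params = {t. t\<^sup>2 \<noteq> 4}"

definition special :: "complex set" where
  "special = {0, 6, -6}"

definition fam :: "complex \<Rightarrow> cps" where
  "fam t = varX ^ 4 + varY ^ 4 + varZ ^ 2 + cst t * varX ^ 2 * varY ^ 2"

definition Jacobian_ideal :: "cps \<Rightarrow> cps set" where
  "Jacobian_ideal f = Idl\<^bsub>\<O>\<^esub> {dx f, dy f, dz f}"

definition Ik :: "enat \<Rightarrow> complex \<Rightarrow> cps set" where
  "Ik k t = (case k of
      enat n \<Rightarrow> Idl\<^bsub>\<O>\<^esub> ({fam t} \<union> max_ideal_pow n \<cdot>\<^bsub>\<O>\<^esub> Jacobian_ideal (fam t))
    | \<infinity> \<Rightarrow> Idl\<^bsub>\<O>\<^esub> {fam t})"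

definition Alg :: "enat \<Rightarrow> complex \<Rightarrow> cps set ring" where
  "Alg k t = \<O> Quot Ik k t"

definition Yau_algebra :: "enat \<Rightarrow> complex \<Rightarrow> (cps set \<Rightarrow> cps set) lie_alg" where
  "Yau_algebra k t = Der (Alg k t) (\<lambda>c. Ik k t +>\<^bsub>\<O>\<^esub> cst c)"

text \<open>
  A morphism is the class modulo scalars of a homogeneous automorphism of the power series
  ring carrying \<open>Ik k t\<close> onto \<open>Ik k s\<close>. For \<open>k = 0\<close> this is finer than the
  isomorphism induced on \<open>Alg 0 t\<close>, where the class of \<open>varZ\<close> vanishes.
\<close>

definition Grp :: "enat \<Rightarrow> (complex, (cps \<Rightarrow> cps) set) groupoid" where
  "Grp k =
     \<lparr>Obj = params,
      Mor = (\<lambda>t s. {scalar_class \<phi> | \<phi>.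
               t \<in> params \<and> s \<in> params \<and> \<phi> \<in> homog_auts \<and> \<phi> ` Ik k t = Ik k s}),
      Comp = monoid.mult (homog_aut_group Mod scalars)\<rparr>"

definition mu4 :: "complex set" where
  "mu4 = {1, -1, \<i>, -\<i>}"

definition index_pair :: "complex \<Rightarrow> complex \<Rightarrow> bool" where
  "index_pair \<alpha> \<beta> \<longleftrightarrow>
     \<alpha> \<in> insert 0 mu4 \<and> \<beta> \<in> insert 0 mu4 \<and> \<not> (\<alpha> = 0 \<and> \<beta> = 0)"

definition Bmat :: "complex \<Rightarrow> complex \<Rightarrow> complex^2^2" where
  "Bmat \<alpha> \<beta> =
     (if \<beta> = 0 then vector [vector [1, 0], vector [0, \<alpha>]]
      else if \<alpha> = 0 then vector [vector [0, \<beta>], vector [1, 0]]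
      else vector [vector [1, \<beta>], vector [\<alpha>, - (\<alpha> * \<beta>)]])"

definition Btilde :: "complex \<Rightarrow> complex \<Rightarrow> complex \<Rightarrow> complex^3^3" where
  "Btilde \<alpha> \<beta> \<gamma> =
     vector [vector [Bmat \<alpha> \<beta> $ 1 $ 1, Bmat \<alpha> \<beta> $ 1 $ 2, 0],
             vector [Bmat \<alpha> \<beta> $ 2 $ 1, Bmat \<alpha> \<beta> $ 2 $ 2, 0],
             vector [0, 0, \<gamma>]]"

definition Btilde_class :: "complex \<Rightarrow> complex \<Rightarrow> complex \<Rightarrow> (cps \<Rightarrow> cps) set" where
  "Btilde_class \<alpha> \<beta> \<gamma> = scalar_class (lin_subst (Btilde \<alpha> \<beta> \<gamma>))"

text \<open>\<open>Bmat \<alpha> \<beta>\<close> takes the parameter \<open>t\<close> to \<open>frac_lin \<alpha> \<beta> t\<close>.\<close>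

definition frac_lin :: "complex \<Rightarrow> complex \<Rightarrow> complex \<Rightarrow> complex" where
  "frac_lin \<alpha> \<beta> t =
     (if \<beta> = 0 then \<alpha>\<^sup>2 * t
      else if \<alpha> = 0 then \<beta>\<^sup>2 * t
      else \<beta>\<^sup>2 * (12 - 2 * \<alpha>\<^sup>2 * t) / (2 + t * \<alpha>\<^sup>2))"

text \<open>
  The group operation is composition of substitutions. The composite of \<open>lin_subst M\<close> followed by
  \<open>lin_subst N\<close> is \<open>lin_subst (M ** N)\<close>, so that a left action results for composition of
  substitutions, not for the matrix product.
\<close>

definition Btilde_group :: "(cps \<Rightarrow> cps) set monoid" where
  "Btilde_group = (homog_aut_group Mod scalars)
     \<lparr>carrier := {Btilde_class \<alpha> \<beta> \<gamma> | \<alpha> \<beta> \<gamma>. index_pair \<alpha> \<beta> \<and> \<gamma> \<noteq> 0}\<rparr>"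

text \<open>The value is unique, as the class of \<open>Btilde \<alpha> \<beta> \<gamma>\<close> determines \<open>\<alpha>\<close> and \<open>\<beta>\<close>.\<close>

definition Btilde_action :: "(cps \<Rightarrow> cps) set \<Rightarrow> complex \<Rightarrow> complex" where
  "Btilde_action g =
     (\<lambda>t \<in> params - special. THE s. \<exists>\<alpha> \<beta> \<gamma>. index_pair \<alpha> \<beta> \<and> \<gamma> \<noteq> 0 \<and>
        g = Btilde_class \<alpha> \<beta> \<gamma> \<and> s = frac_lin \<alpha> \<beta> t)"

end

theory Submission
  imports Defs
begin

text \<open>
  Homogeneous automorphisms for the weights $(1,1,2)$ are invertible linear substitutions of $x,y$
  together with $z \mapsto \gamma z + q(x,y)$, $q$ a quadratic form
  (\<open>homog_auts_form\<close>). All identities between substitutions and derivations of power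
  series are checked on the variables: a defect that vanishes on them has arbitrarily high order
  (\<open>vanishing_by_generators\<close>).

  Morphisms. For \<open>k \<le> 1\<close> the equation lies in $m^kJ$ by Euler's relation, and
  $I_k$ remembers the span of the partial derivatives modulo higher order; a binary quartic of the
  family with $s \ne 0, \pm 6$ is determined by its partials up to a factor
  (\<open>partials_determine_quartic\<close>). For \<open>k \<ge> 2\<close> the part of weight
  four of $I_k$ contains, up to multiples of $z$, nothing but multiples of the equation. In both
  cases the substitution carries one normalized quartic $x^4+y^4+tx^2y^2$ to a multiple of another
  one. Annihilating the coefficients of $x^3y$ and $xy^3$ and equating those of $x^4$ and $y^4$
  forces the $2 \times 2$ block to be proportional to some $B_{\alpha,\beta}$
  (\<open>normal_form_matrix\<close>). The scale $\gamma$ of $z$ is free for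
  \<open>k \<le> 1\<close>, because $z$ belongs to the Jacobian ideal; for
  \<open>k \<ge> 2\<close> it must reproduce the factor of the equation. The matrices form a group
  acting on the parameters because, by the classification, their classes are precisely those that
  carry one non-exceptional ideal $I_0$ to another (\<open>Btilde_group_actionE\<close>,
  \<open>Btilde_group_memI\<close>).

  Torelli property. The ideal $I_1(t)$ is cut out by vanishing of the low coefficients and one
  functional $\ell_t(g) = t g_{40} - 2 g_{22} + t g_{04}$ on quartic parts
  (\<open>Ik1_eq\<close>). This makes the derivation algebra explicit: it has dimension 23 and
  consists of vector fields with polynomial coefficients (\<open>Yau_model_isomorphic\<close>).
  From the bracket alone one recovers the two-dimensional space of derivations
  $x^2y^2(g_1\partial_x + g_2\partial_y)$, and in it the lines that arise as the full image of a
  rank one map between intrinsically defined pieces. For such a line put $\eta = g_2x - g_1y$; a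
  computation with $\ell_t$ shows that the lines are given by $\ell_t(\eta^4) = 0$, that is, by
  $t(g_1^4+g_2^4) - 12g_1^2g_2^2 = 0$ (\<open>rank_one_quartic\<close>,
  \<open>rank_one_exists\<close>). So an isomorphism of the Lie algebras yields a linear map that
  matches the roots of the normalized quartics with parameters $-12/t$ and $-12/s$. By the normal
  form of matrices $-12/t$ is the image of $-12/s$ under one of the fractional linear maps
  (\<open>roots_determine_parameter\<close>), and $t \mapsto -12/t$ commutes with these maps
  (\<open>frac_lin_dual\<close>). Hence $t$ is an image of $s$, and the matching
  $\tilde B_{\alpha,\beta,\gamma}$ is a contact equivalence.
\<close>

section \<open>Coefficients of power series in three variables\<close>

lemma O_simps [simp]:
  "carrier \<O> = UNIV" "f \<otimes>\<^bsub>\<O>\<^esub> g = f * g" "f \<oplus>\<^bsub>\<O>\<^esub> g = f + g" "\<one>\<^bsub>\<O>\<^esub> = 1" "\<zero>\<^bsub>\<O>\<^esub> = 0"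
  by (simp_all add: ring_of_type_algebra_def)

lemma cring_O: "cring \<O>" and ring_O: "ring \<O>"
  by auto

lemma cps_eqI: "(\<And>i j k. coeff3 f i j k = coeff3 g i j k) \<Longrightarrow> f = g"
  unfolding coeff3_def by (intro fps_ext) auto

lemma coeff3_Abs3 [simp]: "coeff3 (Abs3 c) i j k = c i j k"
  by (simp add: coeff3_def Abs3_def)

lemma coeff3_add [simp]: "coeff3 (f + g) i j k = coeff3 f i j k + coeff3 g i j k"
  and coeff3_diff [simp]: "coeff3 (f - g) i j k = coeff3 f i j k - coeff3 g i j k"
  and coeff3_uminus [simp]: "coeff3 (- f) i j k = - coeff3 f i j k"
  and coeff3_0 [simp]: "coeff3 0 i j k = 0"
  by (simp_all add: coeff3_def)

lemma coeff3_sum [simp]: "coeff3 (sum F A) i j k = (\<Sum>a\<in>A. coeff3 (F a) i j k)"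
  by (simp add: coeff3_def fps_sum_nth)

lemma coeff3_cst: "coeff3 (cst c) i j k = (if i = 0 \<and> j = 0 \<and> k = 0 then c else 0)"
  by (simp add: coeff3_def cst_def)

lemma coeff3_1: "coeff3 1 i j k = (if i = 0 \<and> j = 0 \<and> k = 0 then 1 else 0)"
  by (simp add: coeff3_def)

lemma coeff3_cst_mult [simp]: "coeff3 (cst c * f) i j k = c * coeff3 f i j k"
  by (simp add: coeff3_def cst_def)

lemma coeff3_mult_cst [simp]: "coeff3 (f * cst c) i j k = c * coeff3 f i j k"
  by (simp add: mult.commute[of f])

lemma coeff3_var_mult [simp]:
  "coeff3 (varX * f) i j k = (if i = 0 then 0 else coeff3 f (i - 1) j k)"
  "coeff3 (varY * f) i j k = (if j = 0 then 0 else coeff3 f i (j - 1) k)"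
  "coeff3 (varZ * f) i j k = (if k = 0 then 0 else coeff3 f i j (k - 1))"
  by (simp_all add: coeff3_def varX_def varY_def varZ_def)

lemma coeff3_mult:
  "coeff3 (f * g) i j k =
     (\<Sum>k'=0..k. \<Sum>j'=0..j. \<Sum>i'=0..i. coeff3 f i' j' k' * coeff3 g (i - i') (j - j') (k - k'))"
  by (simp add: coeff3_def fps_mult_nth fps_sum_nth)

lemma coeff3_var:
  "coeff3 varX i j k = (if i = 1 \<and> j = 0 \<and> k = 0 then 1 else 0)"
  "coeff3 varY i j k = (if i = 0 \<and> j = 1 \<and> k = 0 then 1 else 0)"
  "coeff3 varZ i j k = (if i = 0 \<and> j = 0 \<and> k = 1 then 1 else 0)"
  using coeff3_var_mult[of 1 i j k] by (auto simp: coeff3_1)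

lemma cst_simps [simp]: "cst 0 = 0" "cst 1 = 1"
  by (simp_all add: cst_def)

lemma cst_add: "cst (a + b) = cst a + cst b"
  and cst_mult: "cst (a * b) = cst a * cst b"
  and cst_minus: "cst (- a) = - cst a"
  and cst_diff: "cst (a - b) = cst a - cst b"
  by (simp_all add: cst_def)

lemma cst_power: "cst (a ^ n) = cst a ^ n"
  by (induction n) (simp_all add: cst_mult)

lemma cst_numeral: "cst (numeral n) = numeral n"
proof -
  have "cst (of_nat m) = of_nat m" for m
    by (induction m) (simp_all add: cst_add)
  from this[of "numeral n"] show ?thesis by simp
qed

lemmas cst_hom = cst_add cst_mult cst_minus cst_diff cst_power cst_numeral

text \<open>
  Every series is a constant plus a combination of the variables. Iterating this writes a series as
  a polynomial plus a remainder of high order, which is how statements about generators are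
  transported to all power series.
\<close>

lemma decompose:
  obtains f1 f2 f3 where
    "f = cst (coeff3 f 0 0 0) + varX * f1 + varY * f2 + varZ * f3"
proof
  show "f = cst (coeff3 f 0 0 0)
      + varX * Abs3 (\<lambda>i j k. if j = 0 \<and> k = 0 then coeff3 f (Suc i) 0 0 else 0)
      + varY * Abs3 (\<lambda>i j k. if k = 0 then coeff3 f i (Suc j) 0 else 0)
      + varZ * Abs3 (\<lambda>i j k. coeff3 f i j (Suc k))"
    by (rule cps_eqI) (auto simp: coeff3_cst)
qed

definition ord_ge :: "nat \<Rightarrow> cps \<Rightarrow> bool" where
  "ord_ge n f \<longleftrightarrow> (\<forall>i j k. i + j + k < n \<longrightarrow> coeff3 f i j k = 0)"

lemma ord_ge_0 [simp]: "ord_ge 0 f"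
  by (simp add: ord_ge_def)

lemma ord_ge_add: "ord_ge n f \<Longrightarrow> ord_ge n g \<Longrightarrow> ord_ge n (f + g)"
  by (simp add: ord_ge_def)

lemma ord_ge_mult:
  assumes "ord_ge m f" "ord_ge n g"
  shows "ord_ge (m + n) (f * g)"
  unfolding ord_ge_def
proof (intro allI impI)
  fix i j k :: nat assume *: "i + j + k < m + n"
  have "coeff3 f i' j' k' * coeff3 g (i - i') (j - j') (k - k') = 0"
    if "i' \<le> i" "j' \<le> j" "k' \<le> k" for i' j' k'
  proof (cases "i' + j' + k' < m")
    case True
    then show ?thesis using assms by (simp add: ord_ge_def)
  next
    case False
    then have "(i - i') + (j - j') + (k - k') < n" using * that by linarith
    then show ?thesis using assms by (simp add: ord_ge_def)
  qed
  then show "coeff3 (f * g) i j k = 0"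
    unfolding coeff3_mult by (intro sum.neutral ballI) auto
qed

lemma ord_ge_all_imp_0: "(\<And>n. ord_ge n f) \<Longrightarrow> f = 0"
proof (rule cps_eqI)
  fix i j k assume "\<And>n. ord_ge n f"
  from this[of "Suc (i + j + k)"] show "coeff3 f i j k = coeff3 0 i j k"
    by (simp add: ord_ge_def)
qed

text \<open>
  A defect that vanishes on constants and is multiplied by elements of the maximal ideal when its
  argument is multiplied by a variable has arbitrarily high order, hence vanishes.
\<close>

lemma vanishing_by_generators:
  assumes E: "\<And>c f1 f2 f3. E (cst c + varX * f1 + varY * f2 + varZ * f3) =
                 l1 * E f1 + l2 * E f2 + l3 * E f3"
    and l: "ord_ge 1 l1" "ord_ge 1 l2" "ord_ge 1 l3"
  shows "E f = 0"
proof (rule ord_ge_all_imp_0)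
  fix n show "ord_ge n (E f)"
  proof (induction n arbitrary: f)
    case (Suc n)
    obtain f1 f2 f3 where f: "f = cst (coeff3 f 0 0 0) + varX * f1 + varY * f2 + varZ * f3"
      by (rule decompose)
    have "ord_ge (1 + n) (l1 * E f1 + l2 * E f2 + l3 * E f3)"
      by (intro ord_ge_add ord_ge_mult l Suc)
    then show ?case by (subst f) (simp add: E)
  qed simp
qed

section \<open>Algebra endomorphisms\<close>

definition alg_hom :: "(cps \<Rightarrow> cps) \<Rightarrow> bool" where
  "alg_hom \<phi> \<longleftrightarrow> (\<forall>f g. \<phi> (f + g) = \<phi> f + \<phi> g) \<and> (\<forall>f g. \<phi> (f * g) = \<phi> f * \<phi> g) \<and>
     (\<forall>c. \<phi> (cst c) = cst c)"

lemma alg_hom_add: "alg_hom \<phi> \<Longrightarrow> \<phi> (f + g) = \<phi> f + \<phi> g"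
  and alg_hom_mult: "alg_hom \<phi> \<Longrightarrow> \<phi> (f * g) = \<phi> f * \<phi> g"
  and alg_hom_cst: "alg_hom \<phi> \<Longrightarrow> \<phi> (cst c) = cst c"
  by (simp_all add: alg_hom_def)

lemma alg_hom_0: "alg_hom \<phi> \<Longrightarrow> \<phi> 0 = 0" and alg_hom_1: "alg_hom \<phi> \<Longrightarrow> \<phi> 1 = 1"
  using alg_hom_cst[of \<phi> 0] alg_hom_cst[of \<phi> 1] by simp_all

lemma alg_hom_minus: "alg_hom \<phi> \<Longrightarrow> \<phi> (- f) = - \<phi> f"
  using alg_hom_add[of \<phi> f "- f"] alg_hom_0[of \<phi>] by (simp add: eq_neg_iff_add_eq_0 add.commute)

lemma alg_hom_diff: "alg_hom \<phi> \<Longrightarrow> \<phi> (f - g) = \<phi> f - \<phi> g"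
  using alg_hom_add[of \<phi> f "- g"] by (simp add: alg_hom_minus)

lemma alg_hom_power: "alg_hom \<phi> \<Longrightarrow> \<phi> (f ^ n) = \<phi> f ^ n"
  by (induction n) (simp_all add: alg_hom_1 alg_hom_mult)

lemma alg_hom_sum: "alg_hom \<phi> \<Longrightarrow> \<phi> (sum F A) = (\<Sum>a\<in>A. \<phi> (F a))"
  by (induction A rule: infinite_finite_induct) (simp_all add: alg_hom_0 alg_hom_add)

lemma alg_hom_numeral: "alg_hom \<phi> \<Longrightarrow> \<phi> (numeral n) = numeral n"
  using alg_hom_cst[of \<phi> "numeral n"] by (simp add: cst_numeral)

lemmas alg_hom_simps = alg_hom_add alg_hom_mult alg_hom_cst alg_hom_0 alg_hom_1 alg_hom_minus
  alg_hom_diff alg_hom_power alg_hom_sum alg_hom_numeral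

text \<open>
  An algebra endomorphism that maps the variables into the maximal ideal is automatically
  continuous, so its values on the variables determine it.
\<close>

lemma alg_hom_eqI:
  assumes "alg_hom \<phi>" "alg_hom \<psi>"
    and "\<phi> varX = \<psi> varX" "\<phi> varY = \<psi> varY" "\<phi> varZ = \<psi> varZ"
    and "ord_ge 1 (\<phi> varX)" "ord_ge 1 (\<phi> varY)" "ord_ge 1 (\<phi> varZ)"
  shows "\<phi> = \<psi>"
proof
  fix f
  have "\<phi> f - \<psi> f = 0"
    by (rule vanishing_by_generators[of "\<lambda>f. \<phi> f - \<psi> f", OF _ assms(6-8)])
      (use assms in \<open>simp add: alg_hom_simps algebra_simps\<close>)
  then show "\<phi> f = \<psi> f" by simp
qed

lemma alg_hom_id: "alg_hom id" and alg_hom_comp: "alg_hom \<phi> \<Longrightarrow> alg_hom \<psi> \<Longrightarrow> alg_hom (\<phi> \<circ> \<psi>)"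
  by (simp_all add: alg_hom_def)

lemma alg_auts_iff: "\<phi> \<in> alg_auts \<longleftrightarrow> alg_hom \<phi> \<and> bij \<phi>"
  unfolding alg_auts_def ring_iso_def ring_hom_def alg_hom_def
  by (auto simp: bij_betw_def) (metis cst_simps(2))+

section \<open>Homogeneous series\<close>

lemma whomogeneous_add: "whomogeneous d f \<Longrightarrow> whomogeneous d g \<Longrightarrow> whomogeneous d (f + g)"
  and whomogeneous_0: "whomogeneous d 0"
  and whomogeneous_cst_mult: "whomogeneous d f \<Longrightarrow> whomogeneous d (cst c * f)"
  and whomogeneous_diff: "whomogeneous d f \<Longrightarrow> whomogeneous d g \<Longrightarrow> whomogeneous d (f - g)"
  by (simp_all add: whomogeneous_def) (metis add.right_neutral diff_0_right add_0 diff_self)+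

lemma whomogeneous_mult:
  assumes "whomogeneous d f" "whomogeneous e g"
  shows "whomogeneous (d + e) (f * g)"
  unfolding whomogeneous_def
proof (intro allI impI, rule ccontr)
  fix i j k assume nz: "coeff3 (f * g) i j k \<noteq> 0" and d: "i + j + 2 * k \<noteq> d + e"
  have "coeff3 f i' j' k' * coeff3 g (i - i') (j - j') (k - k') = 0"
    if "i' \<le> i" "j' \<le> j" "k' \<le> k" for i' j' k'
  proof (rule ccontr)
    assume "coeff3 f i' j' k' * coeff3 g (i - i') (j - j') (k - k') \<noteq> 0"
    then have "i' + j' + 2 * k' = d" "(i - i') + (j - j') + 2 * (k - k') = e"
      using assms unfolding whomogeneous_def by auto
    then show False using that d by linarith
  qed
  then have "coeff3 (f * g) i j k = 0"
    unfolding coeff3_mult by (intro sum.neutral ballI) auto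
  then show False using nz by simp
qed

lemma whomogeneous_gens:
  "whomogeneous 0 (cst c)" "whomogeneous 0 1" "whomogeneous (Suc 0) varX" "whomogeneous (Suc 0) varY" "whomogeneous 2 varZ"
  by (auto simp: whomogeneous_def coeff3_cst coeff3_1 coeff3_var split: if_splits)

lemma whomogeneous_power: "whomogeneous d f \<Longrightarrow> whomogeneous (n * d) (f ^ n)"
  by (induction n) (simp_all add: whomogeneous_gens whomogeneous_mult)

lemma whomogeneous_sum: "(\<And>a. a \<in> A \<Longrightarrow> whomogeneous d (F a)) \<Longrightarrow> whomogeneous d (sum F A)"
  by (induction A rule: infinite_finite_induct) (simp_all add: whomogeneous_0 whomogeneous_add)

lemma coeff3_monomial:
  "coeff3 (varX ^ a * varY ^ b * varZ ^ c) i j k = (if i = a \<and> j = b \<and> k = c then 1 else 0)"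
proof (induction a arbitrary: i)
  case 0
  show ?case
  proof (induction b arbitrary: j)
    case 0
    show ?case by (induction c arbitrary: k) (auto simp: coeff3_1)
  next
    case (Suc b)
    then show ?case by (auto simp: mult.assoc)
  qed
next
  case (Suc a)
  then show ?case by (auto simp: mult.assoc)
qed

lemma whomogeneous_expand:
  assumes "whomogeneous d f"
  shows "f = (\<Sum>(a, b, c) \<in> {..d} \<times> {..d} \<times> {..d}.
               cst (coeff3 f a b c) * (varX ^ a * varY ^ b * varZ ^ c))" (is "f = ?s")
proof (rule cps_eqI)
  fix i j k
  have "coeff3 ?s i j k = (\<Sum>x \<in> {..d} \<times> {..d} \<times> {..d}.
      if x = (i, j, k) then coeff3 f i j k else 0)"
    unfolding coeff3_sum by (intro sum.cong) (auto simp: coeff3_monomial split: if_splits)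
  also have "\<dots> = coeff3 f i j k"
    using assms[unfolded whomogeneous_def, rule_format, of i j k]
    by (cases "coeff3 f i j k = 0") (auto simp: sum.delta)
  finally show "coeff3 f i j k = coeff3 ?s i j k" ..
qed

lemma whomogeneous_1:
  assumes "whomogeneous (Suc 0) f"
  shows "f = cst (coeff3 f 1 0 0) * varX + cst (coeff3 f 0 1 0) * varY"
proof (rule cps_eqI)
  fix i j k
  have "coeff3 f i j k = 0" if "i + j + 2 * k \<noteq> 1"
    using assms that by (auto simp: whomogeneous_def)
  moreover have "(i = 1 \<and> j = 0 \<and> k = 0) \<or> (i = 0 \<and> j = 1 \<and> k = 0) \<or> i + j + 2 * k \<noteq> 1"
    by presburger
  ultimately show "coeff3 f i j k = coeff3 (cst (coeff3 f 1 0 0) * varX + cst (coeff3 f 0 1 0) * varY) i j k"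
    by (auto simp: coeff3_var)
qed

lemma whomogeneous_2:
  assumes "whomogeneous 2 f"
  shows "f = cst (coeff3 f 0 0 1) * varZ + cst (coeff3 f 2 0 0) * varX\<^sup>2 +
     cst (coeff3 f 1 1 0) * (varX * varY) + cst (coeff3 f 0 2 0) * varY\<^sup>2"
proof (rule cps_eqI)
  fix i j k
  have "coeff3 f i j k = 0" if "i + j + 2 * k \<noteq> 2"
    using assms that by (auto simp: whomogeneous_def)
  moreover have "(i = 0 \<and> j = 0 \<and> k = 1) \<or> (i = 2 \<and> j = 0 \<and> k = 0) \<or> (i = 1 \<and> j = 1 \<and> k = 0) \<or>
     (i = 0 \<and> j = 2 \<and> k = 0) \<or> i + j + 2 * k \<noteq> 2"
    by presburger
  ultimately show "coeff3 f i j k = coeff3 (cst (coeff3 f 0 0 1) * varZ + cst (coeff3 f 2 0 0) * varX\<^sup>2 +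
     cst (coeff3 f 1 1 0) * (varX * varY) + cst (coeff3 f 0 2 0) * varY\<^sup>2) i j k"
    by (auto simp: coeff3_var power2_eq_square)
qed

section \<open>Linear substitutions\<close>

definition blk :: "complex \<Rightarrow> complex \<Rightarrow> complex \<Rightarrow> complex \<Rightarrow> complex \<Rightarrow> complex^3^3" where
  "blk a b c d g = vector [vector [a, b, 0], vector [c, d, 0], vector [0, 0, g]]"

lemma lin_blk:
  "lin (blk a b c d g) 1 = cst a * varX + cst b * varY"
  "lin (blk a b c d g) 2 = cst c * varX + cst d * varY"
  "lin (blk a b c d g) 3 = cst g * varZ"
  by (simp_all add: lin_def blk_def)

text \<open>
  The substitution applied to the part of degree \<open>n\<close>. This is a finite sum of
  polynomials, and the substitution of linear forms preserves degrees, so identities for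
  \<open>lin_subst\<close> can be read off degree by degree.
\<close>

definition hsub :: "complex^3^3 \<Rightarrow> nat \<Rightarrow> cps \<Rightarrow> cps" where
  "hsub M n f = (\<Sum>(a, b, c) \<in> {(a, b, c). a + b + c = n}.
     cst (coeff3 f a b c) * (lin M 1 ^ a * lin M 2 ^ b * lin M 3 ^ c))"

lemma finite_triples [simp]: "finite {(a, b, c). a + b + c = (n::nat)}"
  by (rule finite_subset[of _ "{..n} \<times> {..n} \<times> {..n}"]) auto

lemma coeff3_lin_subst: "coeff3 (lin_subst M f) i j k = coeff3 (hsub M (i + j + k) f) i j k"
  by (simp add: lin_subst_def hsub_def case_prod_unfold)

lemma hsub_var_mult:
  "hsub M (Suc n) (varX * f) = lin M 1 * hsub M n f"
  "hsub M (Suc n) (varY * f) = lin M 2 * hsub M n f"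
  "hsub M (Suc n) (varZ * f) = lin M 3 * hsub M n f"
proof -
  let ?T = "\<lambda>n. {(a, b, c). a + b + c = (n::nat)}"
  have "hsub M (Suc n) (varX * f) =
    (\<Sum>(a, b, c) \<in> (\<lambda>(a, b, c). (Suc a, b, c)) ` ?T n.
     cst (coeff3 (varX * f) a b c) * (lin M 1 ^ a * lin M 2 ^ b * lin M 3 ^ c))"
    unfolding hsub_def
  proof (intro sum.mono_neutral_right ballI finite_triples)
    fix x assume x: "x \<in> ?T (Suc n) - (\<lambda>(a, b, c). (Suc a, b, c)) ` ?T n"
    obtain a b c where abc: "x = (a, b, c)" by (cases x)
    have "a = 0" using x unfolding abc by (cases a) (auto simp: image_iff)
    then show "(case x of (a, b, c) \<Rightarrow>
        cst (coeff3 (varX * f) a b c) * (lin M 1 ^ a * lin M 2 ^ b * lin M 3 ^ c)) = 0"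
      by (simp add: abc)
  qed auto
  then show "hsub M (Suc n) (varX * f) = lin M 1 * hsub M n f"
    by (subst (asm) sum.reindex)
      (auto simp: inj_on_def hsub_def sum_distrib_left case_prod_unfold algebra_simps)
  have "hsub M (Suc n) (varY * f) =
    (\<Sum>(a, b, c) \<in> (\<lambda>(a, b, c). (a, Suc b, c)) ` ?T n.
     cst (coeff3 (varY * f) a b c) * (lin M 1 ^ a * lin M 2 ^ b * lin M 3 ^ c))"
    unfolding hsub_def
  proof (intro sum.mono_neutral_right ballI finite_triples)
    fix x assume x: "x \<in> ?T (Suc n) - (\<lambda>(a, b, c). (a, Suc b, c)) ` ?T n"
    obtain a b c where abc: "x = (a, b, c)" by (cases x)
    have "b = 0" using x unfolding abc by (cases b) (auto simp: image_iff)
    then show "(case x of (a, b, c) \<Rightarrow>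
        cst (coeff3 (varY * f) a b c) * (lin M 1 ^ a * lin M 2 ^ b * lin M 3 ^ c)) = 0"
      by (simp add: abc)
  qed auto
  then show "hsub M (Suc n) (varY * f) = lin M 2 * hsub M n f"
    by (subst (asm) sum.reindex)
      (auto simp: inj_on_def hsub_def sum_distrib_left case_prod_unfold algebra_simps)
  have "hsub M (Suc n) (varZ * f) =
    (\<Sum>(a, b, c) \<in> (\<lambda>(a, b, c). (a, b, Suc c)) ` ?T n.
     cst (coeff3 (varZ * f) a b c) * (lin M 1 ^ a * lin M 2 ^ b * lin M 3 ^ c))"
    unfolding hsub_def
  proof (intro sum.mono_neutral_right ballI finite_triples)
    fix x assume x: "x \<in> ?T (Suc n) - (\<lambda>(a, b, c). (a, b, Suc c)) ` ?T n"
    obtain a b c where abc: "x = (a, b, c)" by (cases x)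
    have "c = 0" using x unfolding abc by (cases c) (auto simp: image_iff)
    then show "(case x of (a, b, c) \<Rightarrow>
        cst (coeff3 (varZ * f) a b c) * (lin M 1 ^ a * lin M 2 ^ b * lin M 3 ^ c)) = 0"
      by (simp add: abc)
  qed auto
  then show "hsub M (Suc n) (varZ * f) = lin M 3 * hsub M n f"
    by (subst (asm) sum.reindex)
      (auto simp: inj_on_def hsub_def sum_distrib_left case_prod_unfold algebra_simps)
qed

lemma coeff3_lin: "i + j + k \<noteq> 1 \<Longrightarrow> coeff3 (lin M r) i j k = 0"
  by (auto simp: lin_def coeff3_var)

lemma coeff3_lin_mult_cong:
  assumes "\<And>i j k. i + j + k = n \<Longrightarrow> coeff3 f i j k = coeff3 g i j k" "i + j + k = Suc n"
  shows "coeff3 (lin M r * f) i j k = coeff3 (lin M r * g) i j k"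
  unfolding coeff3_mult
proof (intro sum.cong refl)
  fix k' j' i' assume *: "k' \<in> {0..k}" "j' \<in> {0..j}" "i' \<in> {0..i}"
  show "coeff3 (lin M r) i' j' k' * coeff3 f (i - i') (j - j') (k - k') =
        coeff3 (lin M r) i' j' k' * coeff3 g (i - i') (j - j') (k - k')"
  proof (cases "i' + j' + k' = 1")
    case True
    then have "(i - i') + (j - j') + (k - k') = n" using * assms(2) by auto
    then show ?thesis using assms(1) by simp
  next
    case False
    then show ?thesis by (simp add: coeff3_lin)
  qed
qed

lemma ord_ge_lin: "ord_ge 1 (lin M r)"
  by (simp add: ord_ge_def coeff3_lin)

text \<open>
  A linear form contributes only in degree one, hence the coefficients of degree
  \<open>n + 1\<close> of a product with it depend only on the part of degree \<open>n\<close> of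
  the other factor.
\<close>

lemma lin_subst_var_mult:
  "lin_subst M (varX * f) = lin M 1 * lin_subst M f"
  "lin_subst M (varY * f) = lin M 2 * lin_subst M f"
  "lin_subst M (varZ * f) = lin M 3 * lin_subst M f"
proof -
  have *: "lin_subst M (v * f) = lin M r * lin_subst M f"
    if v: "\<And>n. hsub M (Suc n) (v * f) = lin M r * hsub M n f" "coeff3 (v * f) 0 0 0 = 0" for v r
  proof (rule cps_eqI)
    fix i j k
    show "coeff3 (lin_subst M (v * f)) i j k = coeff3 (lin M r * lin_subst M f) i j k"
    proof (cases "i + j + k")
      case 0
      have "hsub M 0 (v * f) = 0"
        unfolding hsub_def by (rule sum.neutral) (use v in auto)
      moreover have "ord_ge (1 + 0) (lin M r * lin_subst M f)"
        by (intro ord_ge_mult ord_ge_lin) simp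
      ultimately show ?thesis using 0 by (simp add: coeff3_lin_subst ord_ge_def)
    next
      case (Suc n)
      have "coeff3 (lin M r * hsub M n f) i j k = coeff3 (lin M r * lin_subst M f) i j k"
        by (rule coeff3_lin_mult_cong[OF _ Suc]) (simp add: coeff3_lin_subst)
      then show ?thesis by (simp add: coeff3_lin_subst Suc v)
    qed
  qed
  show "lin_subst M (varX * f) = lin M 1 * lin_subst M f"
    "lin_subst M (varY * f) = lin M 2 * lin_subst M f"
    "lin_subst M (varZ * f) = lin M 3 * lin_subst M f"
    by (rule *; simp add: hsub_var_mult)+
qed

lemma hsub_add: "hsub M n (f + g) = hsub M n f + hsub M n g"
  and hsub_cst_mult: "hsub M n (cst c * f) = cst c * hsub M n f"
  by (simp_all add: hsub_def cst_hom case_prod_unfold ring_distribs mult.assoc sum.distrib sum_distrib_left)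

lemma lin_subst_add: "lin_subst M (f + g) = lin_subst M f + lin_subst M g"
  and lin_subst_cst_mult: "lin_subst M (cst c * f) = cst c * lin_subst M f"
  by (rule cps_eqI; simp add: coeff3_lin_subst hsub_add hsub_cst_mult)+

lemma lin_subst_1: "lin_subst M 1 = 1"
proof -
  have "hsub M n 1 = (if n = 0 then 1 else 0)" for n
  proof (cases "n = 0")
    case True
    have "hsub M 0 1 = (\<Sum>(a, b, c) \<in> {(0::nat, 0::nat, 0::nat)}.
     cst (coeff3 1 a b c) * (lin M 1 ^ a * lin M 2 ^ b * lin M 3 ^ c))"
      unfolding hsub_def by (rule sum.cong) auto
    then show ?thesis using True by (simp add: coeff3_1)
  next
    case False
    then show ?thesis unfolding hsub_def by (auto simp: coeff3_1 intro!: sum.neutral)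
  qed
  then show ?thesis by (intro cps_eqI) (auto simp: coeff3_lin_subst coeff3_1)
qed

lemma lin_subst_cst: "lin_subst M (cst c) = cst c"
  using lin_subst_cst_mult[of M c 1] by (simp add: lin_subst_1)

lemma lin_subst_var:
  "lin_subst M varX = lin M 1" "lin_subst M varY = lin M 2" "lin_subst M varZ = lin M 3"
  using lin_subst_var_mult[of M 1] by (simp_all add: lin_subst_1)

text \<open>
  Multiplicativity in the first factor is compatible with multiplication by a variable, so its
  defect is subject to \<open>vanishing_by_generators\<close>.
\<close>

lemma alg_hom_lin_subst: "alg_hom (lin_subst M)"
proof -
  have "lin_subst M (f * g) - lin_subst M f * lin_subst M g = 0" for f g
  proof (rule vanishing_by_generators[of "\<lambda>f. lin_subst M (f * g) - lin_subst M f * lin_subst M g"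
        "lin M 1" "lin M 2" "lin M 3"])
    fix c f1 f2 f3
    show "lin_subst M ((cst c + varX * f1 + varY * f2 + varZ * f3) * g) -
       lin_subst M (cst c + varX * f1 + varY * f2 + varZ * f3) * lin_subst M g =
       lin M 1 * (lin_subst M (f1 * g) - lin_subst M f1 * lin_subst M g) +
       lin M 2 * (lin_subst M (f2 * g) - lin_subst M f2 * lin_subst M g) +
       lin M 3 * (lin_subst M (f3 * g) - lin_subst M f3 * lin_subst M g)"
      by (simp add: ring_distribs mult.assoc lin_subst_add lin_subst_var_mult lin_subst_cst_mult
          lin_subst_cst algebra_simps lin_subst_cst_mult[of M c g, unfolded mult.commute[of "cst c" g]])
  qed (rule ord_ge_lin)+
  then show ?thesis by (simp add: alg_hom_def lin_subst_add lin_subst_cst)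
qed

section \<open>Homogeneous automorphisms\<close>

lemma homog_autsD:
  assumes "\<phi> \<in> homog_auts"
  shows "alg_hom \<phi>" "bij \<phi>" "whomogeneous d f \<Longrightarrow> whomogeneous d (\<phi> f)" "inj \<phi>"
  using assms by (auto simp: homog_auts_def alg_auts_iff bij_is_inj)

lemma linear_preimages:
  assumes hom: "alg_hom \<phi>" and X: "\<phi> varX = cst a * varX + cst b * varY"
    and Y: "\<phi> varY = cst c * varX + cst d * varY" and det: "a * d - b * c \<noteq> 0"
  obtains u v u' v' where "\<phi> (cst u * varX + cst v * varY) = varX" "\<phi> (cst u' * varX + cst v' * varY) = varY"
proof -
  define D where "D = a * d - b * c"
  have "D \<noteq> 0" using det by (simp add: D_def)
  then have "d / D * a + - b / D * c = 1" "d / D * b + - b / D * d = 0"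
     "- c / D * a + a / D * c = 0" "- c / D * b + a / D * d = 1"
    by (simp_all add: field_simps) (simp_all add: D_def algebra_simps)
  moreover have "\<phi> (cst u * varX + cst v * varY) = cst (u * a + v * c) * varX + cst (u * b + v * d) * varY" for u v
    by (simp add: alg_hom_simps[OF hom] X Y cst_hom algebra_simps)
  ultimately show thesis using that[of "d / D" "- b / D" "- c / D" "a / D"] by simp
qed

text \<open>
  By weights, $x$ and $y$ have no other possible images; only the image of $z$ may contain
  quadratic terms. If the determinant or the coefficient of $z$ were zero, some nonzero polynomial
  would be mapped to zero.
\<close>

lemma homog_auts_form:
  assumes "\<phi> \<in> homog_auts"
  obtains a b c d g r1 r2 r3 where
    "\<phi> varX = cst a * varX + cst b * varY" "\<phi> varY = cst c * varX + cst d * varY"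
    "\<phi> varZ = cst g * varZ + cst r1 * varX\<^sup>2 + cst r2 * (varX * varY) + cst r3 * varY\<^sup>2"
    "a * d - b * c \<noteq> 0" "g \<noteq> 0"
proof -
  note hom = homog_autsD(1)[OF assms]
  have inj: "f = 0" if "\<phi> f = 0" for f
    using homog_autsD(4)[OF assms] that alg_hom_0[OF hom] by (auto simp: inj_def)
  obtain a b where X: "\<phi> varX = cst a * varX + cst b * varY"
    using whomogeneous_1 homog_autsD(3)[OF assms] whomogeneous_gens(3) by blast
  obtain c d where Y: "\<phi> varY = cst c * varX + cst d * varY"
    using whomogeneous_1 homog_autsD(3)[OF assms] whomogeneous_gens(4) by blast
  obtain g r1 r2 r3 where Z: "\<phi> varZ = cst g * varZ + cst r1 * varX\<^sup>2 + cst r2 * (varX * varY) + cst r3 * varY\<^sup>2"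
    using whomogeneous_2 homog_autsD(3)[OF assms] whomogeneous_gens(5) by blast
  have lin0: "u = 0 \<and> v = 0" if "cst u * varX + cst v * varY = 0" for u v
  proof -
    have "coeff3 (cst u * varX + cst v * varY) 1 0 0 = 0" "coeff3 (cst u * varX + cst v * varY) 0 1 0 = 0"
      unfolding that by simp_all
    then show ?thesis by (simp add: coeff3_var)
  qed
  have comb: "\<phi> (cst u * varX + cst v * varY) = cst (u * a + v * c) * varX + cst (u * b + v * d) * varY" for u v
    by (simp add: alg_hom_simps[OF hom] X Y cst_hom algebra_simps)
  have det: "a * d - b * c \<noteq> 0"
  proof
    assume "a * d - b * c = 0"
    then have "\<phi> (cst d * varX + cst (- b) * varY) = 0" "\<phi> (cst c * varX + cst (- a) * varY) = 0"
      unfolding comb by (simp_all add: algebra_simps)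
    then have "a = 0 \<and> b = 0"
      using lin0 inj by (metis neg_equal_0_iff_equal)
    then have "\<phi> varX = 0" using X by simp
    then have "varX = 0" by (rule inj)
    then have "coeff3 varX 1 0 0 = 0" by simp
    then show False by (simp add: coeff3_var)
  qed
  obtain u v u' v' where "\<phi> (cst u * varX + cst v * varY) = varX" "\<phi> (cst u' * varX + cst v' * varY) = varY"
    using linear_preimages[OF hom X Y det] .
  moreover define X' Y' where "X' = cst u * varX + cst v * varY" and "Y' = cst u' * varX + cst v' * varY"
  ultimately have XY': "\<phi> X' = varX" "\<phi> Y' = varY" by simp_all
  have "g \<noteq> 0"
  proof
    assume "g = 0"
    then have "\<phi> (varZ - (cst r1 * X'\<^sup>2 + cst r2 * (X' * Y') + cst r3 * Y'\<^sup>2)) = 0"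
      by (simp add: alg_hom_simps[OF hom] Z XY')
    then have "varZ - (cst r1 * X'\<^sup>2 + cst r2 * (X' * Y') + cst r3 * Y'\<^sup>2) = 0"
      by (rule inj)
    then have "coeff3 (varZ - (cst r1 * X'\<^sup>2 + cst r2 * (X' * Y') + cst r3 * Y'\<^sup>2)) 0 0 1 = 0"
      by simp
    then show False
      by (simp add: X'_def Y'_def power2_eq_square coeff3_mult coeff3_var)
  qed
  then show thesis using that X Y Z det by blast
qed

lemma whomogeneousD:
  "whomogeneous n f \<Longrightarrow> coeff3 f i j k \<noteq> 0 \<Longrightarrow> n = i * Suc 0 + j * Suc 0 + k * 2"
  by (force simp: whomogeneous_def)

lemma whomogeneous_ord_ge: "whomogeneous n f \<Longrightarrow> 0 < n \<Longrightarrow> ord_ge 1 f"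
  using whomogeneousD[of n f 0 0 0] by (auto simp: ord_ge_def)

lemma ord_ge_homog:
  assumes "\<phi> \<in> homog_auts"
  shows "ord_ge 1 (\<phi> varX)" "ord_ge 1 (\<phi> varY)" "ord_ge 1 (\<phi> varZ)"
  by (rule whomogeneous_ord_ge[OF homog_autsD(3)[OF assms whomogeneous_gens(3)] zero_less_Suc]
      whomogeneous_ord_ge[OF homog_autsD(3)[OF assms whomogeneous_gens(4)] zero_less_Suc]
      whomogeneous_ord_ge[OF homog_autsD(3)[OF assms whomogeneous_gens(5)] zero_less_numeral])+

lemma homog_auts_eqI:
  assumes "\<phi> \<in> homog_auts" "alg_hom \<psi>"
    "\<phi> varX = \<psi> varX" "\<phi> varY = \<psi> varY" "\<phi> varZ = \<psi> varZ"
  shows "\<phi> = \<psi>"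
  using alg_hom_eqI[OF homog_autsD(1)[OF assms(1)] assms(2-5) ord_ge_homog[OF assms(1)]] .

lemma alg_hom_inv:
  assumes "alg_hom \<phi>" "bij \<phi>"
  shows "alg_hom (inv_into UNIV \<phi>)"
  unfolding alg_hom_def
proof (intro conjI allI)
  fix f g :: cps and c
  note s = bij_is_surj[OF assms(2)] and i = bij_is_inj[OF assms(2)]
  show "inv_into UNIV \<phi> (f + g) = inv_into UNIV \<phi> f + inv_into UNIV \<phi> g"
    by (rule inv_f_eq[OF i]) (simp add: alg_hom_simps[OF assms(1)] surj_f_inv_f[OF s])
  show "inv_into UNIV \<phi> (f * g) = inv_into UNIV \<phi> f * inv_into UNIV \<phi> g"
    by (rule inv_f_eq[OF i]) (simp add: alg_hom_simps[OF assms(1)] surj_f_inv_f[OF s])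
  show "inv_into UNIV \<phi> (cst c) = cst c"
    by (rule inv_f_eq[OF i]) (simp add: alg_hom_simps[OF assms(1)])
qed

text \<open>
  A homogeneous automorphism hits the variables by homogeneous series of the right weight, hence
  also every homogeneous series, which is a finite combination of monomials.
\<close>

lemma homog_auts_inv:
  assumes "\<phi> \<in> homog_auts"
  shows "inv_into UNIV \<phi> \<in> homog_auts"
proof -
  note hom = homog_autsD(1)[OF assms]
  obtain a b c d g r1 r2 r3 where X: "\<phi> varX = cst a * varX + cst b * varY"
    and Y: "\<phi> varY = cst c * varX + cst d * varY"
    and Z: "\<phi> varZ = cst g * varZ + cst r1 * varX\<^sup>2 + cst r2 * (varX * varY) + cst r3 * varY\<^sup>2"
    and det: "a * d - b * c \<noteq> 0" and "g \<noteq> 0"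
    using homog_auts_form[OF assms] by metis
  obtain u v u' v' where "\<phi> (cst u * varX + cst v * varY) = varX" "\<phi> (cst u' * varX + cst v' * varY) = varY"
    using linear_preimages[OF hom X Y det] .
  moreover define X' Y' where "X' = cst u * varX + cst v * varY" and "Y' = cst u' * varX + cst v' * varY"
  ultimately have XY': "\<phi> X' = varX" "\<phi> Y' = varY" by simp_all
  define Z' where "Z' = cst (1 / g) * (varZ - (cst r1 * X'\<^sup>2 + cst r2 * (X' * Y') + cst r3 * Y'\<^sup>2))"
  have Z': "\<phi> Z' = varZ"
    using \<open>g \<noteq> 0\<close> by (simp add: Z'_def alg_hom_simps[OF hom] XY' Z mult.assoc[symmetric] cst_mult[symmetric])
  have hX: "whomogeneous (Suc 0) X'" and hY: "whomogeneous (Suc 0) Y'"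
    unfolding X'_def Y'_def by (intro whomogeneous_add whomogeneous_cst_mult whomogeneous_gens)+
  have hZ: "whomogeneous 2 Z'"
    unfolding Z'_def using whomogeneous_power[OF hX, of 2] whomogeneous_power[OF hY, of 2]
      whomogeneous_mult[OF hX hY]
    by (intro whomogeneous_add whomogeneous_diff whomogeneous_cst_mult whomogeneous_gens)
      (simp_all add: numeral_2_eq_2)
  have "whomogeneous n (inv_into UNIV \<phi> f)" if f: "whomogeneous n f" for n f
  proof -
    define f' where "f' = (\<Sum>(a, b, c) \<in> {..n} \<times> {..n} \<times> {..n}.
               cst (coeff3 f a b c) * (X' ^ a * Y' ^ b * Z' ^ c))"
    have "\<phi> f' = (\<Sum>(a, b, c) \<in> {..n} \<times> {..n} \<times> {..n}.
               cst (coeff3 f a b c) * (varX ^ a * varY ^ b * varZ ^ c))"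
      by (simp add: f'_def alg_hom_simps[OF hom] XY' Z' case_prod_unfold)
    also have "\<dots> = f" by (rule whomogeneous_expand[OF f, symmetric])
    finally have "\<phi> f' = f" .
    moreover have "whomogeneous n f'"
      unfolding f'_def
    proof (intro whomogeneous_sum, clarify)
      fix a b c
      show "whomogeneous n (cst (coeff3 f a b c) * (X' ^ a * Y' ^ b * Z' ^ c))"
      proof (cases "coeff3 f a b c = 0")
        case False
        then have "n = a * Suc 0 + b * Suc 0 + c * 2" by (rule whomogeneousD[OF f])
        then show ?thesis
          by (auto intro!: whomogeneous_cst_mult whomogeneous_mult whomogeneous_power hX hY hZ
              simp del: mult_Suc_right)
      qed (simp add: whomogeneous_0)
    qed
    ultimately show ?thesis
      using inv_f_f[OF homog_autsD(4)[OF assms], of f'] by simp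
  qed
  then show ?thesis
    using alg_hom_inv[OF hom homog_autsD(2)[OF assms]] bij_imp_bij_inv[OF homog_autsD(2)[OF assms]]
    by (auto simp: homog_auts_def alg_auts_iff)
qed

lemma homog_auts_comp: "\<phi> \<in> homog_auts \<Longrightarrow> \<psi> \<in> homog_auts \<Longrightarrow> \<phi> \<circ> \<psi> \<in> homog_auts"
  by (auto simp: homog_auts_def alg_auts_iff alg_hom_comp bij_comp)

lemma homog_auts_id: "id \<in> homog_auts"
  by (auto simp: homog_auts_def alg_auts_iff alg_hom_id)

lemma homog_group_simps [simp]:
  "carrier homog_aut_group = homog_auts" "\<phi> \<otimes>\<^bsub>homog_aut_group\<^esub> \<psi> = \<phi> \<circ> \<psi>"
  "\<one>\<^bsub>homog_aut_group\<^esub> = id"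
  by (simp_all add: homog_aut_group_def)

lemma group_homog: "group homog_aut_group"
proof (rule groupI)
  fix \<phi> assume "\<phi> \<in> carrier homog_aut_group"
  then show "\<exists>\<psi>\<in>carrier homog_aut_group. \<psi> \<otimes>\<^bsub>homog_aut_group\<^esub> \<phi> = \<one>\<^bsub>homog_aut_group\<^esub>"
    by (intro bexI[of _ "inv_into UNIV \<phi>"]) (auto simp: homog_auts_inv homog_autsD)
qed (auto simp: homog_auts_comp homog_auts_id)

section \<open>Block substitutions and scalars\<close>

lemma lin_subst_blk_var:
  "lin_subst (blk a b c d g) varX = cst a * varX + cst b * varY"
  "lin_subst (blk a b c d g) varY = cst c * varX + cst d * varY"
  "lin_subst (blk a b c d g) varZ = cst g * varZ"
  by (simp_all add: lin_subst_var lin_blk)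

lemmas lin_subst_simps = alg_hom_simps[OF alg_hom_lin_subst] lin_subst_blk_var

lemma lin_subst_blk_comp:
  "lin_subst (blk a b c d g) \<circ> lin_subst (blk a' b' c' d' g') =
   lin_subst (blk (a' * a + b' * c) (a' * b + b' * d) (c' * a + d' * c) (c' * b + d' * d) (g' * g))"
  by (rule sym, rule alg_hom_eqI)
    (auto simp: alg_hom_lin_subst alg_hom_comp lin_subst_simps lin_subst_blk_var cst_hom algebra_simps
      ord_ge_def coeff3_var)

lemma lin_subst_blk_cong:
  "a = a' \<Longrightarrow> b = b' \<Longrightarrow> c = c' \<Longrightarrow> d = d' \<Longrightarrow> g = g' \<Longrightarrow>
    lin_subst (blk a b c d g) = lin_subst (blk a' b' c' d' g')"
  by simp

lemma lin_subst_blk_1: "lin_subst (blk 1 0 0 1 1) = id"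
  by (rule alg_hom_eqI)
    (auto simp: alg_hom_lin_subst alg_hom_id lin_subst_blk_var ord_ge_def coeff3_var)

lemma lin_subst_whomogeneous:
  assumes "whomogeneous n f"
  shows "whomogeneous n (lin_subst (blk a b c d g) f)"
proof -
  let ?M = "blk a b c d g"
  have l: "whomogeneous (Suc 0) (lin ?M 1)" "whomogeneous (Suc 0) (lin ?M 2)" "whomogeneous 2 (lin ?M 3)"
    unfolding lin_blk by (intro whomogeneous_add whomogeneous_cst_mult whomogeneous_gens)+
  have "whomogeneous n (hsub ?M m f)" for m
    unfolding hsub_def
  proof (intro whomogeneous_sum, clarify)
    fix i j k
    show "whomogeneous n (cst (coeff3 f i j k) * (lin ?M 1 ^ i * lin ?M 2 ^ j * lin ?M 3 ^ k))"
    proof (cases "coeff3 f i j k = 0")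
      case False
      then have "n = i * Suc 0 + j * Suc 0 + k * 2" by (rule whomogeneousD[OF assms])
      then show ?thesis
        by (auto intro!: whomogeneous_cst_mult whomogeneous_mult whomogeneous_power l
            simp del: mult_Suc_right)
    qed (simp add: whomogeneous_0)
  qed
  then show ?thesis by (auto simp: whomogeneous_def coeff3_lin_subst)
qed

lemma lin_subst_blk_homog_auts:
  assumes "a * d - b * c \<noteq> 0" "g \<noteq> 0"
  shows "lin_subst (blk a b c d g) \<in> homog_auts"
proof -
  define D where "D = a * d - b * c"
  let ?N = "blk (d / D) (- b / D) (- c / D) (a / D) (1 / g)"
  have "D \<noteq> 0" using assms by (simp add: D_def)
  have "lin_subst (blk a b c d g) \<circ> lin_subst ?N = lin_subst (blk 1 0 0 1 1)"
    unfolding lin_subst_blk_comp using assms(2) \<open>D \<noteq> 0\<close>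
    by (intro lin_subst_blk_cong) (simp_all add: field_simps, simp_all add: D_def algebra_simps)
  moreover have "lin_subst ?N \<circ> lin_subst (blk a b c d g) = lin_subst (blk 1 0 0 1 1)"
    unfolding lin_subst_blk_comp using assms(2) \<open>D \<noteq> 0\<close>
    by (intro lin_subst_blk_cong) (simp_all add: field_simps, simp_all add: D_def algebra_simps)
  ultimately have "bij (lin_subst (blk a b c d g))"
    unfolding lin_subst_blk_1 using o_bij by blast
  then show ?thesis
    by (auto simp: homog_auts_def alg_auts_iff alg_hom_lin_subst lin_subst_whomogeneous)
qed

lemma scaling_blk: "scaling c = lin_subst (blk c 0 0 c (c\<^sup>2))"
  by (simp add: scaling_def blk_def)

lemma scaling_homog: "c \<noteq> 0 \<Longrightarrow> scaling c \<in> homog_auts"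
  unfolding scaling_blk by (rule lin_subst_blk_homog_auts) auto

lemma scaling_comp: "scaling c \<circ> scaling d = scaling (c * d)"
  unfolding scaling_blk lin_subst_blk_comp by (simp add: power_mult_distrib mult.commute)

lemma scaling_1: "scaling 1 = id"
  by (simp add: scaling_blk lin_subst_blk_1)

text \<open>
  On homogeneous series, a scalar $c$ acts as multiplication by a power of $c$ that depends on the
  weight only, and a homogeneous automorphism preserves the weight. So the scalars are central and
  left and right classes coincide.
\<close>

lemma scaling_commute:
  assumes "\<phi> \<in> homog_auts" "c \<noteq> 0"
  shows "scaling c \<circ> \<phi> = \<phi> \<circ> scaling c"
proof (rule homog_auts_eqI)
  note hom = homog_autsD(1)[OF assms(1)]
  show "scaling c \<circ> \<phi> \<in> homog_auts"
    using assms by (intro homog_auts_comp scaling_homog)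
  show "alg_hom (\<phi> \<circ> scaling c)"
    unfolding scaling_blk by (intro alg_hom_comp alg_hom_lin_subst hom)
  obtain a b a' b' g r1 r2 r3 where "\<phi> varX = cst a * varX + cst b * varY"
    and "\<phi> varY = cst a' * varX + cst b' * varY"
    and "\<phi> varZ = cst g * varZ + cst r1 * varX\<^sup>2 + cst r2 * (varX * varY) + cst r3 * varY\<^sup>2"
    using homog_auts_form[OF assms(1)] by metis
  then show "(scaling c \<circ> \<phi>) varX = (\<phi> \<circ> scaling c) varX"
     "(scaling c \<circ> \<phi>) varY = (\<phi> \<circ> scaling c) varY"
     "(scaling c \<circ> \<phi>) varZ = (\<phi> \<circ> scaling c) varZ"
    by (simp_all add: scaling_blk lin_subst_simps alg_hom_simps[OF hom] cst_hom algebra_simps power2_eq_square)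
qed

lemma scalars_subgroup: "subgroup scalars homog_aut_group"
proof
  fix \<phi> assume "\<phi> \<in> scalars"
  then obtain c where c: "\<phi> = scaling c" "c \<noteq> 0" by (auto simp: scalars_def)
  have "inv\<^bsub>homog_aut_group\<^esub> (scaling c) = scaling (inverse c)"
    using c by (intro group.inv_equality[OF group_homog]) (auto simp: scaling_comp scaling_1 scaling_homog)
  then show "inv\<^bsub>homog_aut_group\<^esub> \<phi> \<in> scalars"
    using c by (auto simp: scalars_def intro!: exI[of _ "inverse c"])
next
  show "scalars \<subseteq> carrier homog_aut_group" by (auto simp: scalars_def scaling_homog)
  show "\<one>\<^bsub>homog_aut_group\<^esub> \<in> scalars"
    by (auto simp: scalars_def intro!: exI[of _ 1] scaling_1[symmetric])
  fix \<phi> \<psi> assume "\<phi> \<in> scalars" "\<psi> \<in> scalars"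
  then show "\<phi> \<otimes>\<^bsub>homog_aut_group\<^esub> \<psi> \<in> scalars"
    by (auto simp: scalars_def scaling_comp)
qed

lemma scalars_normal: "scalars \<lhd> homog_aut_group"
proof (rule group.normalI[OF group_homog scalars_subgroup], rule ballI)
  fix \<phi> assume "\<phi> \<in> carrier homog_aut_group"
  then show "scalars #>\<^bsub>homog_aut_group\<^esub> \<phi> = \<phi> <#\<^bsub>homog_aut_group\<^esub> scalars"
    by (auto simp: r_coset_def l_coset_def scalars_def scaling_commute)
qed

lemma scalar_class_iff: "\<psi> \<in> scalar_class \<phi> \<longleftrightarrow> (\<exists>c. c \<noteq> 0 \<and> \<psi> = scaling c \<circ> \<phi>)"
  by (auto simp: scalar_class_def r_coset_def scalars_def)

lemma scalar_class_eqD: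
  assumes "scalar_class \<phi> = scalar_class \<psi>"
  obtains c where "c \<noteq> 0" "\<phi> = scaling c \<circ> \<psi>"
proof -
  have "\<phi> \<in> scalar_class \<phi>"
    unfolding scalar_class_iff by (rule exI[of _ 1]) (simp add: scaling_1)
  then show thesis using assms that by (auto simp: scalar_class_iff)
qed

lemma scalar_class_scaling:
  assumes "c \<noteq> 0"
  shows "scalar_class (scaling c \<circ> \<psi>) = scalar_class \<psi>"
proof -
  have "\<exists>d. d \<noteq> 0 \<and> scaling e \<circ> \<psi> = scaling d \<circ> (scaling c \<circ> \<psi>)" if "e \<noteq> 0" for e
    using that assms by (intro exI[of _ "e / c"]) (simp add: comp_assoc[symmetric] scaling_comp)
  moreover have "\<exists>d. d \<noteq> 0 \<and> scaling e \<circ> (scaling c \<circ> \<psi>) = scaling d \<circ> \<psi>" if "e \<noteq> 0" for e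
    using that assms by (intro exI[of _ "e * c"]) (simp add: comp_assoc[symmetric] scaling_comp)
  ultimately show ?thesis by (auto simp: scalar_class_iff)
qed

lemma scalar_class_mult:
  assumes "\<phi> \<in> homog_auts" "\<psi> \<in> homog_auts"
  shows "scalar_class \<phi> \<otimes>\<^bsub>homog_aut_group Mod scalars\<^esub> scalar_class \<psi> = scalar_class (\<phi> \<circ> \<psi>)"
  using normal.rcos_sum[OF scalars_normal, of \<phi> \<psi>] assms
  by (simp add: scalar_class_def FactGroup_def)

lemma scalar_class_carrier: "carrier (homog_aut_group Mod scalars) = scalar_class ` homog_auts"
  by (auto simp: FactGroup_def RCOSETS_def scalar_class_def)

lemma Btilde_blk:
  "Btilde \<alpha> 0 \<gamma> = blk 1 0 0 \<alpha> \<gamma>"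
  "\<beta> \<noteq> 0 \<Longrightarrow> Btilde 0 \<beta> \<gamma> = blk 0 \<beta> 1 0 \<gamma>"
  "\<beta> \<noteq> 0 \<Longrightarrow> \<alpha> \<noteq> 0 \<Longrightarrow> Btilde \<alpha> \<beta> \<gamma> = blk 1 \<beta> \<alpha> (- (\<alpha> * \<beta>)) \<gamma>"
  by (simp_all add: Btilde_def Bmat_def blk_def)

section \<open>Partial derivatives\<close>

lemma coeff3_deriv [simp]:
  "coeff3 (dx f) i j k = of_nat (Suc i) * coeff3 f (Suc i) j k"
  "coeff3 (dy f) i j k = of_nat (Suc j) * coeff3 f i (Suc j) k"
  "coeff3 (dz f) i j k = of_nat (Suc k) * coeff3 f i j (Suc k)"
  by (simp_all add: dx_def dy_def dz_def)

lemma deriv_add: "dx (f + g) = dx f + dx g" "dy (f + g) = dy f + dy g" "dz (f + g) = dz f + dz g"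
  by (rule cps_eqI; simp add: algebra_simps)+

lemma deriv_cst_mult: "dx (cst c * f) = cst c * dx f" "dy (cst c * f) = cst c * dy f"
  "dz (cst c * f) = cst c * dz f"
  by (rule cps_eqI; simp add: algebra_simps)+

lemma deriv_var_mult:
  "dx (varX * f) = f + varX * dx f" "dx (varY * f) = varY * dx f" "dx (varZ * f) = varZ * dx f"
  "dy (varX * f) = varX * dy f" "dy (varY * f) = f + varY * dy f" "dy (varZ * f) = varZ * dy f"
  "dz (varX * f) = varX * dz f" "dz (varY * f) = varY * dz f" "dz (varZ * f) = f + varZ * dz f"
  by (rule cps_eqI; auto simp: algebra_simps gr0_conv_Suc)+

lemma deriv_cst: "dx (cst c) = 0" "dy (cst c) = 0" "dz (cst c) = 0"
  by (rule cps_eqI; simp add: coeff3_cst)+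

lemma deriv_1: "dx 1 = 0" "dy 1 = 0" "dz 1 = 0"
  using deriv_cst[of 1] by simp_all

lemma deriv_var:
  "dx varX = 1" "dx varY = 0" "dx varZ = 0" "dy varX = 0" "dy varY = 1" "dy varZ = 0"
  "dz varX = 0" "dz varY = 0" "dz varZ = 1"
  using deriv_var_mult[of 1] by (simp_all add: deriv_1)

lemma ord_ge_var: "ord_ge 1 varX" "ord_ge 1 varY" "ord_ge 1 varZ"
  by (simp_all add: ord_ge_def coeff3_var)

lemma deriv_mult:
  "dx (f * g) = dx f * g + f * dx g" "dy (f * g) = dy f * g + f * dy g"
  "dz (f * g) = dz f * g + f * dz g"
proof -
  note s = ring_distribs mult.assoc deriv_add deriv_cst_mult deriv_var_mult deriv_cst
  have "dx (f * g) - (dx f * g + f * dx g) = 0"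
    by (rule vanishing_by_generators[of "\<lambda>f. dx (f * g) - (dx f * g + f * dx g)", OF _ ord_ge_var])
      (simp add: s)
  moreover have "dy (f * g) - (dy f * g + f * dy g) = 0"
    by (rule vanishing_by_generators[of "\<lambda>f. dy (f * g) - (dy f * g + f * dy g)", OF _ ord_ge_var])
      (simp add: s)
  moreover have "dz (f * g) - (dz f * g + f * dz g) = 0"
    by (rule vanishing_by_generators[of "\<lambda>f. dz (f * g) - (dz f * g + f * dz g)", OF _ ord_ge_var])
      (simp add: s)
  ultimately show "dx (f * g) = dx f * g + f * dx g" "dy (f * g) = dy f * g + f * dy g"
    "dz (f * g) = dz f * g + f * dz g" by simp_all
qed

lemma deriv_diff: "dx (f - g) = dx f - dx g" "dy (f - g) = dy f - dy g" "dz (f - g) = dz f - dz g"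
  by (rule cps_eqI; simp add: algebra_simps)+

lemmas deriv_simps = deriv_add deriv_diff deriv_mult deriv_cst deriv_1 deriv_var

text \<open>
  Both sides are derivations along the substitution and agree on the variables.
\<close>

lemma chain_rule:
  fixes a b c d g :: complex
  defines "L \<equiv> lin_subst (blk a b c d g)"
  shows "dx (L f) = cst a * L (dx f) + cst c * L (dy f)"
    "dy (L f) = cst b * L (dx f) + cst d * L (dy f)"
    "dz (L f) = cst g * L (dz f)"
proof -
  let ?l1 = "cst a * varX + cst b * varY" and ?l2 = "cst c * varX + cst d * varY" and ?l3 = "cst g * varZ"
  have o: "ord_ge 1 ?l1" "ord_ge 1 ?l2" "ord_ge 1 ?l3"
    by (simp_all add: ord_ge_def coeff3_var)
  note s = deriv_simps lin_subst_simps
  have "dx (L f) - (cst a * L (dx f) + cst c * L (dy f)) = 0"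
    by (rule vanishing_by_generators[of "\<lambda>f. dx (L f) - (cst a * L (dx f) + cst c * L (dy f))", OF _ o])
      (simp add: L_def s, simp add: algebra_simps)
  moreover have "dy (L f) - (cst b * L (dx f) + cst d * L (dy f)) = 0"
    by (rule vanishing_by_generators[of "\<lambda>f. dy (L f) - (cst b * L (dx f) + cst d * L (dy f))", OF _ o])
      (simp add: L_def s, simp add: algebra_simps)
  moreover have "dz (L f) - cst g * L (dz f) = 0"
    by (rule vanishing_by_generators[of "\<lambda>f. dz (L f) - cst g * L (dz f)", OF _ o])
      (simp add: L_def s, simp add: algebra_simps)
  ultimately show "dx (L f) = cst a * L (dx f) + cst c * L (dy f)"
    "dy (L f) = cst b * L (dx f) + cst d * L (dy f)"
    "dz (L f) = cst g * L (dz f)" by simp_all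
qed

lemma deriv_fam:
  "dx (fam t) = cst 4 * varX ^ 3 + cst (2 * t) * (varX * varY\<^sup>2)"
  "dy (fam t) = cst 4 * varY ^ 3 + cst (2 * t) * (varX\<^sup>2 * varY)"
  "dz (fam t) = cst 2 * varZ"
  by (simp_all add: fam_def eval_nat_numeral deriv_simps cst_hom algebra_simps)

lemma Euler_fam:
  "fam t = cst (1/4) * (varX * dx (fam t) + varY * dy (fam t)) + cst (1/2) * (varZ * dz (fam t))"
proof -
  have "cst 4 * fam t = varX * dx (fam t) + varY * dy (fam t) + cst 2 * (varZ * dz (fam t))"
    unfolding deriv_fam by (simp add: fam_def cst_hom eval_nat_numeral algebra_simps)
  then have "cst (1/4) * (cst 4 * fam t) =
      cst (1/4) * (varX * dx (fam t) + varY * dy (fam t) + cst 2 * (varZ * dz (fam t)))"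
    by simp
  then show ?thesis
    by (simp add: mult.assoc[symmetric] cst_mult[symmetric] ring_distribs)
qed

section \<open>Ideals of power series\<close>

lemma a_inv_O [simp]: "\<ominus>\<^bsub>\<O>\<^esub> f = - f"
  by (rule abelian_group.minus_equality[OF ring.is_abelian_group[OF ring_O]]) auto

lemma a_minus_O [simp]: "f \<ominus>\<^bsub>\<O>\<^esub> g = f - g"
  by (simp add: a_minus_def)

lemma ideal_O_I:
  assumes "0 \<in> I" "\<And>f g. f \<in> I \<Longrightarrow> g \<in> I \<Longrightarrow> f + g \<in> I" "\<And>f h. f \<in> I \<Longrightarrow> h * f \<in> I"
  shows "ideal I \<O>"
proof (rule idealI[OF ring_O])
  have inv: "inv\<^bsub>add_monoid \<O>\<^esub> f = - f" for f
    using a_inv_O[of f] by (simp only: a_inv_def)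
  have "- f \<in> I" if "f \<in> I" for f
    using assms(3)[OF that, of "-1"] by simp
  then show "subgroup I (add_monoid \<O>)"
    by (intro subgroup.intro) (use assms in \<open>simp_all only: inv, simp_all\<close>)
qed (use assms in \<open>auto simp: mult.commute\<close>)

lemma ideal_O_D:
  assumes "ideal I \<O>"
  shows "0 \<in> I" "f \<in> I \<Longrightarrow> g \<in> I \<Longrightarrow> f + g \<in> I" "f \<in> I \<Longrightarrow> h * f \<in> I" "f \<in> I \<Longrightarrow> f * h \<in> I"
    "f \<in> I \<Longrightarrow> - f \<in> I" "f \<in> I \<Longrightarrow> g \<in> I \<Longrightarrow> f - g \<in> I"
proof -
  note S = ideal.axioms(1)[OF assms]
  interpret ideal I \<O> by fact
  show "0 \<in> I" using additive_subgroup.zero_closed[OF S] by simp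
  show add: "f \<in> I \<Longrightarrow> g \<in> I \<Longrightarrow> f + g \<in> I" for f g using additive_subgroup.a_closed[OF S, of f g] by simp
  show "f \<in> I \<Longrightarrow> h * f \<in> I" using I_l_closed[of f h] by simp
  show "f \<in> I \<Longrightarrow> f * h \<in> I" using I_r_closed[of f h] by simp
  show neg: "f \<in> I \<Longrightarrow> - f \<in> I" for f using additive_subgroup.a_inv_closed[OF S, of f] by simp
  show "f \<in> I \<Longrightarrow> g \<in> I \<Longrightarrow> f - g \<in> I" using add[of f "- g"] neg[of g] by simp
qed

lemma ideal_Idl: "ideal (Idl\<^bsub>\<O>\<^esub> S) \<O>"
  by (rule ring.genideal_ideal[OF ring_O]) simp

lemma Idl_incl: "f \<in> S \<Longrightarrow> f \<in> Idl\<^bsub>\<O>\<^esub> S"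
  using ring.genideal_self[OF ring_O, of S] by auto

lemma Idl_minimal: "ideal I \<O> \<Longrightarrow> S \<subseteq> I \<Longrightarrow> Idl\<^bsub>\<O>\<^esub> S \<subseteq> I"
  by (rule ring.genideal_minimal[OF ring_O])

lemma ideal_image:
  assumes "\<phi> \<in> alg_auts" "ideal I \<O>"
  shows "ideal (\<phi> ` I) \<O>"
proof (rule ideal_O_I)
  have hom: "alg_hom \<phi>" and bij: "bij \<phi>" using assms by (auto simp: alg_auts_iff)
  show "0 \<in> \<phi> ` I"
    using ideal_O_D(1)[OF assms(2)] alg_hom_0[OF hom] by (metis image_eqI)
  show "f + g \<in> \<phi> ` I" if "f \<in> \<phi> ` I" "g \<in> \<phi> ` I" for f g
    using that ideal_O_D(2)[OF assms(2)] by (auto simp: alg_hom_add[OF hom, symmetric])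
  show "h * f \<in> \<phi> ` I" if f: "f \<in> \<phi> ` I" for f h
  proof -
    obtain f' where "f = \<phi> f'" "f' \<in> I" using f by auto
    moreover obtain h' where "h = \<phi> h'" using bij_is_surj[OF bij] by (metis surj_def)
    ultimately show ?thesis
      using ideal_O_D(3)[OF assms(2)] by (auto simp: alg_hom_mult[OF hom, symmetric])
  qed
qed

lemma alg_auts_inv: "\<phi> \<in> alg_auts \<Longrightarrow> inv_into UNIV \<phi> \<in> alg_auts"
  by (simp add: alg_auts_iff alg_hom_inv bij_imp_bij_inv)

lemma image_Idl_subset:
  assumes "\<phi> \<in> alg_auts"
  shows "Idl\<^bsub>\<O>\<^esub> (\<phi> ` S) \<subseteq> \<phi> ` (Idl\<^bsub>\<O>\<^esub> S)"
  using Idl_incl by (intro Idl_minimal ideal_image[OF assms] ideal_Idl) blast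

lemma image_Idl:
  assumes "\<phi> \<in> alg_auts"
  shows "\<phi> ` (Idl\<^bsub>\<O>\<^esub> S) = Idl\<^bsub>\<O>\<^esub> (\<phi> ` S)"
proof
  let ?\<psi> = "inv_into UNIV \<phi>"
  have bij: "bij \<phi>" using assms by (simp add: alg_auts_iff)
  have "?\<psi> ` \<phi> ` S = S"
    using bij_is_inj[OF bij] by (simp add: image_inv_f_f)
  then have "Idl\<^bsub>\<O>\<^esub> S \<subseteq> ?\<psi> ` (Idl\<^bsub>\<O>\<^esub> (\<phi> ` S))"
    using image_Idl_subset[OF alg_auts_inv[OF assms], of "\<phi> ` S"] by simp
  then have "\<phi> ` (Idl\<^bsub>\<O>\<^esub> S) \<subseteq> \<phi> ` ?\<psi> ` (Idl\<^bsub>\<O>\<^esub> (\<phi> ` S))"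
    by (rule image_mono)
  also have "\<dots> = Idl\<^bsub>\<O>\<^esub> (\<phi> ` S)"
    using bij_is_surj[OF bij] by (simp add: image_f_inv_f)
  finally show "\<phi> ` (Idl\<^bsub>\<O>\<^esub> S) \<subseteq> Idl\<^bsub>\<O>\<^esub> (\<phi> ` S)" .
qed (rule image_Idl_subset[OF assms])

lemma image_ideal_prod:
  assumes "alg_hom \<phi>"
  shows "\<phi> ` (I \<cdot>\<^bsub>\<O>\<^esub> J) = \<phi> ` I \<cdot>\<^bsub>\<O>\<^esub> \<phi> ` J"
proof
  have "\<phi> f \<in> \<phi> ` I \<cdot>\<^bsub>\<O>\<^esub> \<phi> ` J" if "f \<in> I \<cdot>\<^bsub>\<O>\<^esub> J" for f
    using that
  proof induction
    case (prod i j)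
    then show ?case using ideal_prod.prod[of "\<phi> i" "\<phi> ` I" "\<phi> j" "\<phi> ` J" \<O>]
      by (simp add: alg_hom_mult[OF assms])
  next
    case (sum f g)
    then show ?case using ideal_prod.sum[of "\<phi> f" \<O> "\<phi> ` I" "\<phi> ` J" "\<phi> g"]
      by (simp add: alg_hom_add[OF assms])
  qed
  then show "\<phi> ` (I \<cdot>\<^bsub>\<O>\<^esub> J) \<subseteq> \<phi> ` I \<cdot>\<^bsub>\<O>\<^esub> \<phi> ` J" by auto
  have "f \<in> \<phi> ` (I \<cdot>\<^bsub>\<O>\<^esub> J)" if "f \<in> \<phi> ` I \<cdot>\<^bsub>\<O>\<^esub> \<phi> ` J" for f
    using that
  proof induction
    case (prod i j)
    then show ?case using ideal_prod.prod[of _ I _ J \<O>]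
      by (auto simp: alg_hom_mult[OF assms, symmetric])
  next
    case (sum f g)
    then show ?case using ideal_prod.sum[of _ \<O> I J]
      by (auto simp: alg_hom_add[OF assms, symmetric])
  qed
  then show "\<phi> ` I \<cdot>\<^bsub>\<O>\<^esub> \<phi> ` J \<subseteq> \<phi> ` (I \<cdot>\<^bsub>\<O>\<^esub> J)" by auto
qed

lemma ideal_prod_O_I: "i \<in> I \<Longrightarrow> j \<in> J \<Longrightarrow> i * j \<in> I \<cdot>\<^bsub>\<O>\<^esub> J"
  using ideal_prod.prod[of i I j J \<O>] by simp

lemma ideal_prod_subset:
  assumes "\<And>i j. i \<in> I \<Longrightarrow> j \<in> J \<Longrightarrow> i * j \<in> K" "\<And>f g. f \<in> K \<Longrightarrow> g \<in> K \<Longrightarrow> f + g \<in> K"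
  shows "I \<cdot>\<^bsub>\<O>\<^esub> J \<subseteq> K"
proof
  fix f assume "f \<in> I \<cdot>\<^bsub>\<O>\<^esub> J"
  then show "f \<in> K" by induction (use assms in auto)
qed

lemma max_ideal_iff: "f \<in> max_ideal \<longleftrightarrow> coeff3 f 0 0 0 = 0"
proof
  have "ideal {f. coeff3 f 0 0 0 = 0} \<O>"
    by (rule ideal_O_I) (simp_all add: coeff3_mult)
  then have "max_ideal \<subseteq> {f. coeff3 f 0 0 0 = 0}"
    unfolding max_ideal_def by (rule Idl_minimal) (auto simp: coeff3_var)
  then show "f \<in> max_ideal \<Longrightarrow> coeff3 f 0 0 0 = 0" by auto
next
  assume 0: "coeff3 f 0 0 0 = 0"
  obtain f1 f2 f3 where "f = cst (coeff3 f 0 0 0) + varX * f1 + varY * f2 + varZ * f3"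
    by (rule decompose)
  then have "f = varX * f1 + varY * f2 + varZ * f3" using 0 by simp
  moreover note I = ideal_Idl[of "{varX, varY, varZ}"]
  have "varX * f1 + varY * f2 + varZ * f3 \<in> max_ideal"
    unfolding max_ideal_def by (intro ideal_O_D(2,4)[OF I] Idl_incl) auto
  ultimately show "f \<in> max_ideal" by simp
qed

lemma max_ideal_pow_ord_ge: "f \<in> max_ideal_pow n \<Longrightarrow> ord_ge n f"
proof (induction n arbitrary: f)
  case (Suc n)
  have "max_ideal_pow (Suc n) \<subseteq> {f. ord_ge (1 + n) f}"
    unfolding max_ideal_pow.simps
    by (intro ideal_prod_subset CollectI) (auto intro!: ord_ge_mult[of 1, simplified] Suc ord_ge_add simp: max_ideal_iff ord_ge_def[of "Suc 0"])
  then show ?case using Suc.prems by auto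
qed simp

lemma image_max_ideal:
  assumes "\<phi> \<in> homog_auts"
  shows "\<phi> ` max_ideal = max_ideal"
proof -
  have *: "\<phi> ` max_ideal \<subseteq> max_ideal" if "\<phi> \<in> homog_auts" for \<phi>
  proof
    have A: "\<phi> \<in> alg_auts" using that by (simp add: homog_auts_def)
    fix f assume "f \<in> \<phi> ` max_ideal"
    moreover have "\<phi> ` max_ideal \<subseteq> max_ideal"
      unfolding max_ideal_def image_Idl[OF A]
      using ord_ge_homog[OF that] ideal_Idl[of "{varX, varY, varZ}"]
      by (intro Idl_minimal) (auto simp: max_ideal_def[symmetric] max_ideal_iff ord_ge_def)
    ultimately show "f \<in> max_ideal" by auto
  qed
  have "max_ideal = \<phi> ` inv_into UNIV \<phi> ` max_ideal"
    using bij_is_surj[OF homog_autsD(2)[OF assms]] by (simp add: image_f_inv_f)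
  also have "\<dots> \<subseteq> \<phi> ` max_ideal"
    by (intro image_mono * homog_auts_inv assms)
  finally show ?thesis using *[OF assms] by auto
qed

lemma image_max_ideal_pow:
  assumes "\<phi> \<in> homog_auts"
  shows "\<phi> ` max_ideal_pow n = max_ideal_pow n"
  using bij_is_surj[OF homog_autsD(2)[OF assms]]
  by (induction n) (simp_all add: image_ideal_prod[OF homog_autsD(1)[OF assms]] image_max_ideal[OF assms])

section \<open>The ideals of the family\<close>

abbreviation jac :: "complex \<Rightarrow> cps set" where "jac t \<equiv> Jacobian_ideal (fam t)"

lemma ideal_jac: "ideal (jac t) \<O>"
  unfolding Jacobian_ideal_def by (rule ideal_Idl)

lemma deriv_in_jac: "dx (fam t) \<in> jac t" "dy (fam t) \<in> jac t" "dz (fam t) \<in> jac t"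
  unfolding Jacobian_ideal_def by (auto intro: Idl_incl)

lemma ideal_Ik: "ideal (Ik k t) \<O>"
  by (auto simp: Ik_def ideal_Idl split: enat.split)

lemma fam_in_Ik: "fam t \<in> Ik k t"
  by (auto simp: Ik_def intro: Idl_incl split: enat.split)

lemma prod_in_Ik: "i \<in> max_ideal_pow n \<Longrightarrow> j \<in> jac t \<Longrightarrow> i * j \<in> Ik (enat n) t"
  by (auto simp: Ik_def intro!: Idl_incl ideal_prod_O_I)

text \<open>
  For all \<open>k\<close> at once: the powers of the maximal ideal are preserved, so only the
  equation, up to a constant factor, and its Jacobian ideal have to be followed.
\<close>

lemma image_Ik_contact:
  assumes \<phi>: "\<phi> \<in> homog_auts" and c: "\<phi> (fam t) = cst c * fam s" "c \<noteq> 0" and J: "\<phi> ` jac t = jac s"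
  shows "\<phi> ` Ik k t = Ik k s"
proof -
  have A: "\<phi> \<in> alg_auts" using \<phi> by (simp add: homog_auts_def)
  have *: "Idl\<^bsub>\<O>\<^esub> (insert (cst c * fam s) S) = Idl\<^bsub>\<O>\<^esub> (insert (fam s) S)" for S
  proof
    show "Idl\<^bsub>\<O>\<^esub> (insert (cst c * fam s) S) \<subseteq> Idl\<^bsub>\<O>\<^esub> (insert (fam s) S)"
      using Idl_incl by (intro Idl_minimal ideal_Idl) (auto intro!: ideal_O_D(3)[OF ideal_Idl])
    have "cst (1 / c) * (cst c * fam s) \<in> Idl\<^bsub>\<O>\<^esub> (insert (cst c * fam s) S)"
      by (intro ideal_O_D(3)[OF ideal_Idl] Idl_incl) simp
    then have "fam s \<in> Idl\<^bsub>\<O>\<^esub> (insert (cst c * fam s) S)"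
      using c by (simp add: mult.assoc[symmetric] cst_mult[symmetric])
    then show "Idl\<^bsub>\<O>\<^esub> (insert (fam s) S) \<subseteq> Idl\<^bsub>\<O>\<^esub> (insert (cst c * fam s) S)"
      by (intro Idl_minimal ideal_Idl) (auto intro: Idl_incl)
  qed
  show ?thesis
    by (cases k)
      (simp_all add: Ik_def image_Idl[OF A] image_Un image_ideal_prod[OF homog_autsD(1)[OF \<phi>]]
        image_max_ideal_pow[OF \<phi>] J c *)
qed

text \<open>
  Euler's relation expresses the equation by its partial derivatives with coefficients in the
  maximal ideal.
\<close>

lemma Ik_01:
  assumes "k \<in> {0, 1}"
  shows "Ik (enat k) t = Idl\<^bsub>\<O>\<^esub> (max_ideal_pow k \<cdot>\<^bsub>\<O>\<^esub> jac t)" (is "_ = ?I")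
proof
  have 1: "v \<in> max_ideal_pow 0" "v \<in> max_ideal_pow 1" if "coeff3 v 0 0 0 = 0" for v
    using that ideal_prod_O_I[of v max_ideal 1 UNIV] by (simp_all add: max_ideal_iff)
  have p: "v * w \<in> ?I" if "coeff3 v 0 0 0 = 0" "w \<in> jac t" for v w
    using 1[OF that(1)] assms that by (auto intro!: Idl_incl ideal_prod_O_I)
  have "cst (1/4) * (varX * dx (fam t) + varY * dy (fam t)) + cst (1/2) * (varZ * dz (fam t)) \<in> ?I"
    by (intro ideal_O_D(2,3)[OF ideal_Idl] p deriv_in_jac) (simp_all add: coeff3_var)
  then have "fam t \<in> ?I" by (simp only: Euler_fam[symmetric])
  then have "{fam t} \<union> max_ideal_pow k \<cdot>\<^bsub>\<O>\<^esub> jac t \<subseteq> ?I"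
    using Idl_incl by blast
  from Idl_minimal[OF ideal_Idl this] show "Ik (enat k) t \<subseteq> ?I"
    by (simp add: Ik_def)
  have "max_ideal_pow k \<cdot>\<^bsub>\<O>\<^esub> jac t \<subseteq> Ik (enat k) t"
    unfolding Ik_def enat.simps using Idl_incl by blast
  from Idl_minimal[OF ideal_Ik this] show "?I \<subseteq> Ik (enat k) t" .
qed

lemma image_Ik_01:
  assumes \<phi>: "\<phi> \<in> homog_auts" and J: "\<phi> ` jac t = jac s" and k: "k \<in> {0, 1}"
  shows "\<phi> ` Ik (enat k) t = Ik (enat k) s"
proof -
  have A: "\<phi> \<in> alg_auts" using \<phi> by (simp add: homog_auts_def)
  show ?thesis
    by (simp add: Ik_01[OF k] image_Idl[OF A] image_ideal_prod[OF homog_autsD(1)[OF \<phi>]]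
        image_max_ideal_pow[OF \<phi>] J)
qed

text \<open>
  The partial derivatives of the transformed equation are invertible combinations of the
  transformed partial derivatives. The factors of the binary quartic and of $z^2$ may differ,
  because the derivative with respect to $z$ only contributes $z$ up to a constant.
\<close>

lemma image_jac:
  assumes det: "a * d - b * c \<noteq> 0" "g \<noteq> 0" and e: "e \<noteq> 0"
    and f: "lin_subst (blk a b c d g) (fam t) =
      cst e * (varX ^ 4 + varY ^ 4 + cst s * (varX\<^sup>2 * varY\<^sup>2)) + cst (g\<^sup>2) * varZ\<^sup>2"
  shows "lin_subst (blk a b c d g) ` jac t = jac s"
proof -
  let ?L = "lin_subst (blk a b c d g)"
  define fx where "fx = ?L (dx (fam t))"
  define fy where "fy = ?L (dy (fam t))"
  define fz where "fz = ?L (dz (fam t))"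
  define D where "D = a * d - b * c"
  have L: "?L \<in> homog_auts" "?L \<in> alg_auts"
    using lin_subst_blk_homog_auts[OF det] by (simp_all add: homog_auts_def)
  have im: "?L ` jac t = Idl\<^bsub>\<O>\<^esub> {fx, fy, fz}"
    unfolding Jacobian_ideal_def image_Idl[OF L(2)] by (simp add: fx_def fy_def fz_def)
  have d: "dx (?L (fam t)) = cst e * dx (fam s)" "dy (?L (fam t)) = cst e * dy (fam s)"
    "dz (?L (fam t)) = cst (2 * g\<^sup>2) * varZ"
    unfolding f deriv_fam by (simp_all add: deriv_simps eval_nat_numeral cst_hom algebra_simps)
  have ch: "cst e * dx (fam s) = cst a * fx + cst c * fy" "cst e * dy (fam s) = cst b * fx + cst d * fy"
    "cst g * fz = cst (2 * g\<^sup>2) * varZ"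
    using chain_rule[of a b c d g "fam t"]
    unfolding d fx_def fy_def fz_def by simp_all
  have div: "cst u * v = w \<Longrightarrow> u \<noteq> 0 \<Longrightarrow> v = cst (1/u) * w" for u v w
    by (auto simp flip: mult.assoc cst_mult)
  have "cst D * fx = cst (d * e) * dx (fam s) + cst (- c * e) * dy (fam s)"
    "cst D * fy = cst (- b * e) * dx (fam s) + cst (a * e) * dy (fam s)"
    by (simp_all add: cst_hom mult.assoc ch D_def) (simp_all add: algebra_simps)
  note Dxy = this
  have "D \<noteq> 0" using det by (simp add: D_def)
  have fxy: "fx = cst (1/D) * (cst (d * e) * dx (fam s) + cst (- c * e) * dy (fam s))"
    "fy = cst (1/D) * (cst (- b * e) * dx (fam s) + cst (a * e) * dy (fam s))"
    using div[OF Dxy(1) \<open>D \<noteq> 0\<close>] div[OF Dxy(2) \<open>D \<noteq> 0\<close>] .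
  have "fz = cst (1/g) * (cst (2 * g\<^sup>2) * varZ)" using div[OF ch(3)] det by simp
  then have fz: "fz = cst g * dz (fam s)"
    using det by (simp add: deriv_fam power2_eq_square mult.commute[of 2] flip: mult.assoc cst_mult)
  have "{fx, fy, fz} \<subseteq> jac s"
    unfolding fxy fz
    by (intro insert_subsetI empty_subsetI ideal_O_D(2,3)[OF ideal_jac] deriv_in_jac)
  moreover have "{dx (fam s), dy (fam s), dz (fam s)} \<subseteq> Idl\<^bsub>\<O>\<^esub> {fx, fy, fz}"
  proof -
    have "cst (1/e) * (cst a * fx + cst c * fy) \<in> Idl\<^bsub>\<O>\<^esub> {fx, fy, fz}"
      "cst (1/e) * (cst b * fx + cst d * fy) \<in> Idl\<^bsub>\<O>\<^esub> {fx, fy, fz}"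
      "cst (1/g) * fz \<in> Idl\<^bsub>\<O>\<^esub> {fx, fy, fz}"
      by (intro ideal_O_D(2,3)[OF ideal_Idl] Idl_incl; simp)+
    then show ?thesis using div[OF ch(1) e] div[OF ch(2) e] div[OF fz[symmetric]] det by simp
  qed
  ultimately show ?thesis
    unfolding im using Idl_minimal[OF ideal_jac, of "{fx, fy, fz}" s]
      Idl_minimal[OF ideal_Idl, of "{dx (fam s), dy (fam s), dz (fam s)}" "{fx, fy, fz}"]
    unfolding Jacobian_ideal_def by blast
qed

section \<open>Linear conditions satisfied by the ideals\<close>

lemma coeff3_var_power_mult [simp]:
  "coeff3 (varX ^ n * f) i j k = (if i < n then 0 else coeff3 f (i - n) j k)"
  "coeff3 (varY ^ n * f) i j k = (if j < n then 0 else coeff3 f i (j - n) k)"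
  "coeff3 (varZ ^ n * f) i j k = (if k < n then 0 else coeff3 f i j (k - n))"
  by (induction n arbitrary: i j k) (auto simp: mult.assoc not_less less_diff_conv Suc_le_eq)

lemma coeff3_var_power:
  "coeff3 (varX ^ n) i j k = (if i = n \<and> j = 0 \<and> k = 0 then 1 else 0)"
  "coeff3 (varY ^ n) i j k = (if i = 0 \<and> j = n \<and> k = 0 then 1 else 0)"
  "coeff3 (varZ ^ n) i j k = (if i = 0 \<and> j = 0 \<and> k = n then 1 else 0)"
  using coeff3_var_power_mult[of n 1 i j k] by (auto simp: coeff3_1)

lemmas coeff3_eval = coeff3_var coeff3_var_power coeff3_cst coeff3_1

lemmas coeff3_mult_eval = coeff3_mult eval_nat_numeral sum.atLeast0_atMost_Suc

text \<open>
  Ideals given by linear conditions on a few coefficients, which will be shown to contain the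
  Jacobian ideal (\<open>bound0\<close>), $I_1$ (\<open>bound1\<close>), all $I_k$ with
  \<open>k \<ge> 2\<close> (\<open>bound2\<close>) and all $I_k$ with \<open>k \<ge> 3\<close>
  (\<open>bound3\<close>). The conditions on \<open>bound0\<close> say that the cubic part in
  $x,y$ is a combination of $\partial_xf_s$ and $\partial_yf_s$. Those on \<open>bound2\<close>
  say that the terms of weight four are a multiple of $f_s$ up to multiples of $z$ other than
  $z^2$; the extra terms $x^2z, xyz, y^2z$ come from $m^2\partial_zf_s$ and disappear in
  \<open>bound3\<close>.
\<close>

definition bound0 :: "complex \<Rightarrow> cps set" where
  "bound0 s = {f. coeff3 f 0 0 0 = 0 \<and> coeff3 f 1 0 0 = 0 \<and> coeff3 f 0 1 0 = 0 \<and>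
     coeff3 f 2 0 0 = 0 \<and> coeff3 f 1 1 0 = 0 \<and> coeff3 f 0 2 0 = 0 \<and>
     2 * coeff3 f 1 2 0 = s * coeff3 f 3 0 0 \<and> 2 * coeff3 f 2 1 0 = s * coeff3 f 0 3 0}"

text \<open>
  This functional on quartic parts vanishes on the products of $x$ and $y$ with $\partial_xf_s$
  and $\partial_yf_s$. In other words, these partial derivatives are apolar to the quartic in
  $g_1, g_2$ that is obtained by evaluating it at $(g_1x+g_2y)^4$.
\<close>

abbreviation apolar :: "complex \<Rightarrow> cps \<Rightarrow> complex" where
  "apolar s f \<equiv> s * coeff3 f 4 0 0 - 2 * coeff3 f 2 2 0 + s * coeff3 f 0 4 0"

definition bound1 :: "complex \<Rightarrow> cps set" where
  "bound1 s = {f. coeff3 f 0 0 0 = 0 \<and> coeff3 f 1 0 0 = 0 \<and> coeff3 f 0 1 0 = 0 \<and> coeff3 f 0 0 1 = 0 \<and>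
     coeff3 f 2 0 0 = 0 \<and> coeff3 f 1 1 0 = 0 \<and> coeff3 f 0 2 0 = 0 \<and>
     coeff3 f 3 0 0 = 0 \<and> coeff3 f 2 1 0 = 0 \<and> coeff3 f 1 2 0 = 0 \<and> coeff3 f 0 3 0 = 0 \<and>
     apolar s f = 0}"

definition bound2 :: "complex \<Rightarrow> cps set" where
  "bound2 s = {f. coeff3 f 0 0 0 = 0 \<and> coeff3 f 1 0 0 = 0 \<and> coeff3 f 0 1 0 = 0 \<and> coeff3 f 0 0 1 = 0 \<and>
     coeff3 f 2 0 0 = 0 \<and> coeff3 f 1 1 0 = 0 \<and> coeff3 f 0 2 0 = 0 \<and>
     coeff3 f 3 0 0 = 0 \<and> coeff3 f 2 1 0 = 0 \<and> coeff3 f 1 2 0 = 0 \<and> coeff3 f 0 3 0 = 0 \<and>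
     coeff3 f 1 0 1 = 0 \<and> coeff3 f 0 1 1 = 0 \<and>
     coeff3 f 4 0 0 = coeff3 f 0 0 2 \<and> coeff3 f 3 1 0 = 0 \<and> coeff3 f 2 2 0 = s * coeff3 f 0 0 2 \<and>
     coeff3 f 1 3 0 = 0 \<and> coeff3 f 0 4 0 = coeff3 f 0 0 2}"

definition bound3 :: "complex \<Rightarrow> cps set" where
  "bound3 s = {f \<in> bound2 s. coeff3 f 2 0 1 = 0 \<and> coeff3 f 1 1 1 = 0 \<and> coeff3 f 0 2 1 = 0}"

lemma ideal_bound0: "ideal (bound0 s) \<O>"
  by (rule ideal_O_I) (auto simp: bound0_def algebra_simps coeff3_mult_eval)

lemma ideal_bound1: "ideal (bound1 s) \<O>"
proof (rule ideal_O_I)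
  fix f h assume f: "f \<in> bound1 s"
  have e: "coeff3 (h * f) 4 0 0 = coeff3 h 0 0 0 * coeff3 f 4 0 0"
      "coeff3 (h * f) 2 2 0 = coeff3 h 0 0 0 * coeff3 f 2 2 0"
      "coeff3 (h * f) 0 4 0 = coeff3 h 0 0 0 * coeff3 f 0 4 0"
    using f by (simp_all add: bound1_def coeff3_mult_eval)
  have "apolar s (h * f) =
      coeff3 h 0 0 0 * (apolar s f)"
    unfolding e by (simp only: algebra_simps)
  also have "\<dots> = 0" using f by (simp add: bound1_def)
  finally show "h * f \<in> bound1 s"
    using f unfolding bound1_def by (auto simp: coeff3_mult_eval)
qed (auto simp: bound1_def algebra_simps)

lemma ideal_bound2: "ideal (bound2 s) \<O>"
  by (rule ideal_O_I) (auto simp: bound2_def algebra_simps coeff3_mult_eval)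

lemma ideal_bound3: "ideal (bound3 s) \<O>"
  by (rule ideal_O_I)
    (use ideal_O_D[OF ideal_bound2] in \<open>auto simp: bound3_def\<close>, auto simp: bound2_def coeff3_mult_eval)

lemma jac_bound0: "jac s \<subseteq> bound0 s"
  unfolding Jacobian_ideal_def
  by (intro Idl_minimal ideal_bound0) (auto simp: bound0_def deriv_fam coeff3_eval)

lemma fam_bounds: "fam s \<in> bound0 s" "fam s \<in> bound1 s" "fam s \<in> bound2 s" "fam s \<in> bound3 s"
  by (simp_all add: bound0_def bound1_def bound2_def bound3_def fam_def coeff3_eval mult.assoc)

lemma Ik_subset:
  assumes "ideal K \<O>" "fam s \<in> K" "\<And>i j. ord_ge n i \<Longrightarrow> j \<in> bound0 s \<Longrightarrow> i * j \<in> K"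
  shows "Ik (enat n) s \<subseteq> K"
proof -
  have "max_ideal_pow n \<cdot>\<^bsub>\<O>\<^esub> jac s \<subseteq> K"
    using assms(3)[OF max_ideal_pow_ord_ge subsetD[OF jac_bound0]] ideal_O_D(2)[OF assms(1)]
    by (intro ideal_prod_subset)
  then have "{fam s} \<union> max_ideal_pow n \<cdot>\<^bsub>\<O>\<^esub> jac s \<subseteq> K" using assms(2) by auto
  from Idl_minimal[OF assms(1) this] show ?thesis by (simp add: Ik_def)
qed

lemma Ik_0_bound: "Ik (enat 0) s \<subseteq> bound0 s"
  by (intro Ik_subset ideal_bound0 fam_bounds ideal_O_D(3)[OF ideal_bound0])

lemma Ik_1_bound: "Ik (enat 1) s \<subseteq> bound1 s"
proof (intro Ik_subset ideal_bound1 fam_bounds)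
  fix i j assume i: "ord_ge 1 i" and j: "j \<in> bound0 s"
  have i0: "coeff3 i 0 0 0 = 0" using i by (simp add: ord_ge_def)
  have e: "coeff3 (i * j) 4 0 0 = coeff3 i 1 0 0 * coeff3 j 3 0 0"
      "coeff3 (i * j) 2 2 0 = coeff3 i 1 0 0 * coeff3 j 1 2 0 + coeff3 i 0 1 0 * coeff3 j 2 1 0"
      "coeff3 (i * j) 0 4 0 = coeff3 i 0 1 0 * coeff3 j 0 3 0"
    using i0 j by (simp_all add: bound0_def coeff3_mult_eval)
  have "apolar s (i * j) =
    coeff3 i 1 0 0 * (s * coeff3 j 3 0 0 - 2 * coeff3 j 1 2 0) +
    coeff3 i 0 1 0 * (s * coeff3 j 0 3 0 - 2 * coeff3 j 2 1 0)"
    unfolding e by (simp only: algebra_simps)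
  also have "\<dots> = 0" using j by (simp add: bound0_def)
  finally show "i * j \<in> bound1 s"
    using i0 j unfolding bound0_def bound1_def by (auto simp: coeff3_mult_eval)
qed

lemma ord_ge_mono: "ord_ge n f \<Longrightarrow> m \<le> n \<Longrightarrow> ord_ge m f"
  by (simp add: ord_ge_def)

lemma ord_ge_2D:
  assumes "ord_ge 2 f"
  shows "coeff3 f 0 0 0 = 0" "coeff3 f 1 0 0 = 0" "coeff3 f 0 1 0 = 0" "coeff3 f 0 0 1 = 0"
  using assms by (simp_all add: ord_ge_def)

lemma ord_ge_3D:
  assumes "ord_ge 3 f"
  shows "coeff3 f 2 0 0 = 0" "coeff3 f 1 1 0 = 0" "coeff3 f 0 2 0 = 0"
    "coeff3 f 1 0 1 = 0" "coeff3 f 0 1 1 = 0" "coeff3 f 0 0 2 = 0"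
  using assms by (simp_all add: ord_ge_def)

lemma mult_bound2: "ord_ge 2 i \<Longrightarrow> j \<in> bound0 s \<Longrightarrow> i * j \<in> bound2 s"
  using ord_ge_2D[of i] by (simp add: bound0_def bound2_def coeff3_mult_eval)

lemma Ik_2_bound:
  assumes "2 \<le> k"
  shows "Ik k s \<subseteq> bound2 s"
proof (cases k)
  case (enat n)
  show ?thesis unfolding enat
  proof (intro Ik_subset ideal_bound2 fam_bounds)
    fix i j assume "ord_ge n i" and j: "j \<in> bound0 s"
    then have "ord_ge 2 i"
      using assms enat by (auto intro: ord_ge_mono simp: numeral_eq_enat)
    then show "i * j \<in> bound2 s" using j by (rule mult_bound2)
  qed
next
  case infinity
  then show ?thesis
    using Idl_minimal[OF ideal_bound2, of "{fam s}" s] fam_bounds by (simp add: Ik_def)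
qed

lemma Ik_3_bound:
  assumes "3 \<le> k"
  shows "Ik k s \<subseteq> bound3 s"
proof (cases k)
  case (enat n)
  show ?thesis unfolding enat
  proof (intro Ik_subset ideal_bound3 fam_bounds)
    fix i j assume "ord_ge n i" and j: "j \<in> bound0 s"
    then have 3: "ord_ge 3 i"
      using assms enat by (auto intro: ord_ge_mono simp: numeral_eq_enat)
    then have 2: "ord_ge 2 i" by (rule ord_ge_mono) simp
    have "coeff3 (i * j) 2 0 1 = 0" "coeff3 (i * j) 1 1 1 = 0" "coeff3 (i * j) 0 2 1 = 0"
      using ord_ge_2D[OF 2] ord_ge_3D[OF 3] j by (simp_all add: bound0_def coeff3_mult_eval)
    then show "i * j \<in> bound3 s" using mult_bound2[OF 2 j] by (simp add: bound3_def)
  qed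
next
  case infinity
  then show ?thesis
    using Idl_minimal[OF ideal_bound3, of "{fam s}" s] fam_bounds by (simp add: Ik_def)
qed

section \<open>Binary quartics\<close>

lemma mu4_iff: "x \<in> mu4 \<longleftrightarrow> x ^ 4 = (1::complex)"
proof -
  have "x ^ 4 - 1 = (x\<^sup>2 - 1) * (x\<^sup>2 + 1)" by Groebner_Basis.algebra
  also have "x\<^sup>2 + 1 = (x - \<i>) * (x + \<i>)"
    by (simp add: algebra_simps power2_eq_square)
  also have "(x\<^sup>2 - 1) * ((x - \<i>) * (x + \<i>)) = (x - 1) * (x + 1) * (x - \<i>) * (x + \<i>)"
    by Groebner_Basis.algebra
  finally have "x ^ 4 - 1 = (x - 1) * (x + 1) * (x - \<i>) * (x + \<i>)" .
  moreover have "x ^ 4 = 1 \<longleftrightarrow> x ^ 4 - 1 = 0" by simp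
  ultimately have "x ^ 4 = 1 \<longleftrightarrow> (x - 1) * (x + 1) * (x - \<i>) * (x + \<i>) = 0" by simp
  also have "\<dots> \<longleftrightarrow> x \<in> mu4" by (auto simp: mu4_def add_eq_0_iff2)
  finally show ?thesis ..
qed

lemma mu4_square: "x \<in> mu4 \<Longrightarrow> x\<^sup>2 = 1 \<or> x\<^sup>2 = (-1::complex)"
  by (auto simp: mu4_def)

lemma mu4_nonzero: "x \<in> mu4 \<Longrightarrow> x \<noteq> 0"
  by (auto simp: mu4_def)

lemma index_pair_cases [consumes 1]:
  assumes "index_pair \<alpha> \<beta>"
  obtains "\<beta> = 0" "\<alpha> \<in> mu4" | "\<alpha> = 0" "\<beta> \<in> mu4" "\<beta> \<noteq> 0" | "\<alpha> \<in> mu4" "\<beta> \<in> mu4"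
  using assms mu4_nonzero[of \<beta>] unfolding index_pair_def by blast

text \<open>
  The factor in \<open>f\<^sub>t \<circ> B = c \<cdot> f\<^sub>s\<close> for binary quartics,
  where \<open>B\<close> is \<open>Bmat \<alpha> \<beta>\<close> and \<open>s\<close> is
  \<open>frac_lin \<alpha> \<beta> t\<close>.
\<close>

definition cB :: "complex \<Rightarrow> complex \<Rightarrow> complex \<Rightarrow> complex" where
  "cB \<alpha> \<beta> t = (if \<alpha> = 0 \<or> \<beta> = 0 then 1 else 2 + \<alpha>\<^sup>2 * t)"

lemma params_iff: "t \<in> params \<longleftrightarrow> t \<noteq> 2 \<and> t \<noteq> -2"
  unfolding params_def using power2_eq_iff[of t 2] by auto

lemma params_denom: "t \<in> params \<Longrightarrow> \<alpha> \<in> mu4 \<Longrightarrow> 2 + \<alpha>\<^sup>2 * t \<noteq> 0"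
  using mu4_square[of \<alpha>] by (auto simp: params_iff add_eq_0_iff2 minus_equation_iff[of t])

lemma cB_nonzero: "t \<in> params \<Longrightarrow> index_pair \<alpha> \<beta> \<Longrightarrow> cB \<alpha> \<beta> t \<noteq> 0"
  using params_denom by (auto simp: cB_def index_pair_def)

lemma params_uminus: "- t \<in> params \<longleftrightarrow> t \<in> params"
  by (simp add: params_def)

lemma special_uminus: "- t \<in> special \<longleftrightarrow> t \<in> special"
proof -
  have "- t = 6 \<longleftrightarrow> t = - 6" "- t = - 6 \<longleftrightarrow> t = 6" by (auto simp: minus_equation_iff[of t])
  then show ?thesis by (auto simp: special_def)
qed

lemma frac_lin_params:
  assumes "t \<in> params" "index_pair \<alpha> \<beta>"
  shows "frac_lin \<alpha> \<beta> t \<in> params"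
    and "t \<notin> special \<Longrightarrow> frac_lin \<alpha> \<beta> t \<notin> special"
proof -
  have *: "frac_lin \<alpha> \<beta> t \<in> params \<and> (t \<notin> special \<longrightarrow> frac_lin \<alpha> \<beta> t \<notin> special)"
  proof (cases "\<alpha> = 0 \<or> \<beta> = 0")
    case True
    then have "frac_lin \<alpha> \<beta> t = t \<or> frac_lin \<alpha> \<beta> t = - t"
      using assms(2) mu4_square[of \<alpha>] mu4_square[of \<beta>] by (auto simp: frac_lin_def index_pair_def)
    then show ?thesis using assms(1) by (auto simp: params_uminus special_uminus)
  next
    case False
    then have ab: "\<alpha> \<in> mu4" "\<beta> \<in> mu4" using assms(2) by (auto simp: index_pair_def)
    define u where "u = \<alpha>\<^sup>2 * t"
    have nz: "2 + u \<noteq> 0" using params_denom[OF assms(1) ab(1)] by (simp add: u_def)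
    have "u = t \<or> u = - t" using mu4_square[OF ab(1)] by (auto simp: u_def)
    then have "u \<in> params" "t \<notin> special \<Longrightarrow> u \<notin> special"
      using assms(1) by (auto simp: params_uminus special_uminus)
    then have u: "u \<noteq> 2" "t \<notin> special \<Longrightarrow> u \<noteq> 0 \<and> u \<noteq> 6 \<and> u \<noteq> - 6"
      by (auto simp: params_iff special_def)
    define v where "v = (12 - 2 * u) / (2 + u)"
    have "frac_lin \<alpha> \<beta> t = \<beta>\<^sup>2 * v"
      using False by (simp add: frac_lin_def u_def v_def ac_simps)
    then have s: "frac_lin \<alpha> \<beta> t = v \<or> frac_lin \<alpha> \<beta> t = - v"
      using mu4_square[OF ab(2)] by auto
    have v: "v * (2 + u) = 12 - 2 * u" using nz by (simp add: v_def)
    have *: "4 * (u - 2) = (2 - v) * (2 + u)" "16 = (v + 2) * (2 + u)" "2 * (u - 6) = - v * (2 + u)"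
      "8 * u = (6 - v) * (2 + u)" "4 * (u + 6) = (v + 6) * (2 + u)"
      using v by Groebner_Basis.algebra+
    have "v \<noteq> 2" using *(1) u(1) by auto
    moreover have "v \<noteq> - 2" using *(2) by auto
    moreover have "v \<noteq> 0 \<and> v \<noteq> 6 \<and> v \<noteq> - 6" if "t \<notin> special"
      using *(3-5) u(2)[OF that] by (auto simp: add_eq_0_iff2)
    ultimately have "v \<in> params" "t \<notin> special \<Longrightarrow> v \<notin> special"
      by (auto simp: params_iff special_def)
    then show ?thesis
      using s by (auto simp: params_uminus special_uminus)
  qed
  then show "frac_lin \<alpha> \<beta> t \<in> params" "t \<notin> special \<Longrightarrow> frac_lin \<alpha> \<beta> t \<notin> special"
    by auto
qed

text \<open>
  The coefficients of $f_t(ax+by,cx+dy)$ at the monomials $x^4$, $x^3y$, $x^2y^2$, $xy^3$ (with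
  prefix \<open>q\<close>; that at $y^4$ is \<open>qx4 t b d\<close>) and of
  $(\partial_xf_t)(ax+by,cx+dy)$ at $x^3, x^2y, xy^2$ (with prefix \<open>p\<close>; that at $y^3$
  is \<open>px3 t b d\<close>), where $f_t$ stands for its binary part. By symmetry, interchanging
  the rows $(a,b)$ and $(c,d)$ gives the coefficients for $\partial_yf_t$.
\<close>

abbreviation px3 :: "'a::idom \<Rightarrow> 'a \<Rightarrow> 'a \<Rightarrow> 'a" where
  "px3 t a c \<equiv> 4 * a^3 + 2 * t * a * c\<^sup>2"
abbreviation px2y :: "'a::idom \<Rightarrow> 'a \<Rightarrow> 'a \<Rightarrow> 'a \<Rightarrow> 'a \<Rightarrow> 'a" where
  "px2y t a b c d \<equiv> 12 * a\<^sup>2 * b + 2 * t * (b * c\<^sup>2 + 2 * a * c * d)"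
abbreviation pxy2 :: "'a::idom \<Rightarrow> 'a \<Rightarrow> 'a \<Rightarrow> 'a \<Rightarrow> 'a \<Rightarrow> 'a" where
  "pxy2 t a b c d \<equiv> 12 * a * b\<^sup>2 + 2 * t * (2 * b * c * d + a * d\<^sup>2)"
abbreviation qx4 :: "'a::idom \<Rightarrow> 'a \<Rightarrow> 'a \<Rightarrow> 'a" where
  "qx4 t a c \<equiv> a^4 + c^4 + t * a\<^sup>2 * c\<^sup>2"
abbreviation qx3y :: "'a::idom \<Rightarrow> 'a \<Rightarrow> 'a \<Rightarrow> 'a \<Rightarrow> 'a \<Rightarrow> 'a" where
  "qx3y t a b c d \<equiv> 4 * a^3 * b + 4 * c^3 * d + 2 * t * a * c * (b * c + a * d)"
abbreviation qx2y2 :: "'a::idom \<Rightarrow> 'a \<Rightarrow> 'a \<Rightarrow> 'a \<Rightarrow> 'a \<Rightarrow> 'a" where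
  "qx2y2 t a b c d \<equiv>
     6 * a\<^sup>2 * b\<^sup>2 + 6 * c\<^sup>2 * d\<^sup>2 + t * (a\<^sup>2 * d\<^sup>2 + b\<^sup>2 * c\<^sup>2 + 4 * a * b * c * d)"
abbreviation qxy3 :: "'a::idom \<Rightarrow> 'a \<Rightarrow> 'a \<Rightarrow> 'a \<Rightarrow> 'a \<Rightarrow> 'a" where
  "qxy3 t a b c d \<equiv> 4 * a * b^3 + 4 * c * d^3 + 2 * t * b * d * (b * c + a * d)"

lemma binary_cubic_expand:
  fixes a b c d t x y :: "'a::idom"
  shows "4 * (a * x + b * y) ^ 3
     + (2 * t) * ((a * x + b * y) * (c * x + d * y)\<^sup>2) =
   (px3 t a c) * x ^ 3
   + px2y t a b c d * (x\<^sup>2 * y)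
   + pxy2 t a b c d * (x * y\<^sup>2)
   + px3 t b d * y ^ 3"
  by Groebner_Basis.algebra

lemma binary_quartic_expand:
  fixes a b c d t x y :: "'a::idom"
  shows "(a * x + b * y) ^ 4 + (c * x + d * y) ^ 4
     + t * (a * x + b * y)\<^sup>2 * (c * x + d * y)\<^sup>2 =
   (qx4 t a c) * x ^ 4
   + qx3y t a b c d * (x ^ 3 * y)
   + qx2y2 t a b c d * (x\<^sup>2 * y\<^sup>2)
   + qxy3 t a b c d * (x * y ^ 3)
   + qx4 t b d * y ^ 4"
  by Groebner_Basis.algebra

lemma quartic_expand:
  "(cst a * varX + cst b * varY) ^ 4 + (cst c * varX + cst d * varY) ^ 4
     + cst t * (cst a * varX + cst b * varY)\<^sup>2 * (cst c * varX + cst d * varY)\<^sup>2 =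
   cst (qx4 t a c) * varX ^ 4
   + cst (qx3y t a b c d) * (varX ^ 3 * varY)
   + cst (qx2y2 t a b c d) * (varX\<^sup>2 * varY\<^sup>2)
   + cst (qxy3 t a b c d) * (varX * varY ^ 3)
   + cst (qx4 t b d) * varY ^ 4"
  unfolding cst_hom by (rule binary_quartic_expand)

lemma cubic_expand:
  "cst 4 * (cst a * varX + cst b * varY) ^ 3
     + cst (2 * t) * ((cst a * varX + cst b * varY) * (cst c * varX + cst d * varY)\<^sup>2) =
   cst (px3 t a c) * varX ^ 3
   + cst (px2y t a b c d) * (varX\<^sup>2 * varY)
   + cst (pxy2 t a b c d) * (varX * varY\<^sup>2)
   + cst (px3 t b d) * varY ^ 3"
  unfolding cst_hom by (rule binary_cubic_expand)

text \<open>
  The hypotheses say that both transformed partial derivatives lie in the span of the partials of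
  the quartic with parameter \<open>s\<close>. The chain rule and Euler's relation recover the
  transformed quartic from them; its coefficients $q_1$ at $x^3y$ and $q_3$ at $xy^3$ satisfy
  $6q_3 = sq_1$ and $6q_1 = sq_3$, whence the condition on \<open>s\<^sup>2\<close>. For
  \<open>s = 0\<close> the conclusion fails, as $x^4+y^4$ and $ax^4+by^4$ have the same span of
  partials.
\<close>

lemma partials_determine_quartic:
  fixes a b c d s t :: complex
  assumes s: "s \<noteq> 0" "s\<^sup>2 \<noteq> 36"
    and 1: "2 * pxy2 t a b c d = s * px3 t a c"
    and 2: "2 * px2y t a b c d = s * px3 t b d"
    and 3: "2 * pxy2 t c d a b = s * px3 t c a"
    and 4: "2 * px2y t c d a b = s * px3 t d b"
  shows "qx3y t a b c d = 0" (is "?g1 = 0")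
    and "qxy3 t a b c d = 0" (is "?g3 = 0")
    and "qx4 t a c = qx4 t b d" (is "?g0 = ?g4")
    and "qx2y2 t a b c d
       = s * qx4 t a c" (is "?g2 = _")
proof -
  have "4 * ?g2 = a * (2 * pxy2 t a b c d) + c * (2 * pxy2 t c d a b)" by Groebner_Basis.algebra
  also have "\<dots> = a * (s * px3 t a c) + c * (s * px3 t c a)" by (simp only: 1 3)
  also have "\<dots> = 4 * (s * ?g0)" by Groebner_Basis.algebra
  finally show g2: "?g2 = s * ?g0" by (simp only: mult_left_cancel[OF zero_neq_numeral[symmetric]])
  have "4 * ?g2 = b * (2 * px2y t a b c d) + d * (2 * px2y t c d a b)" by Groebner_Basis.algebra
  also have "\<dots> = b * (s * px3 t b d) + d * (s * px3 t d b)" by (simp only: 2 4)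
  also have "\<dots> = 4 * (s * ?g4)" by Groebner_Basis.algebra
  finally have "?g2 = s * ?g4" by (simp only: mult_left_cancel[OF zero_neq_numeral[symmetric]])
  then show "?g0 = ?g4" unfolding g2 using s(1) by simp
  have "6 * ?g3 = b * (2 * pxy2 t a b c d) + d * (2 * pxy2 t c d a b)" by Groebner_Basis.algebra
  also have "\<dots> = b * (s * px3 t a c) + d * (s * px3 t c a)" by (simp only: 1 3)
  also have "\<dots> = s * ?g1" by Groebner_Basis.algebra
  finally have e1: "6 * ?g3 = s * ?g1" .
  have "6 * ?g1 = a * (2 * px2y t a b c d) + c * (2 * px2y t c d a b)" by Groebner_Basis.algebra
  also have "\<dots> = a * (s * px3 t b d) + c * (s * px3 t d b)" by (simp only: 2 4)
  also have "\<dots> = s * ?g3" by Groebner_Basis.algebra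
  finally have e2: "6 * ?g1 = s * ?g3" .
  have *: "u = 0 \<and> v = 0" if "6 * u = s * v" "6 * v = s * u" for u v
  proof -
    have "(36 - s\<^sup>2) * u = 0" "(36 - s\<^sup>2) * v = 0" using that by Groebner_Basis.algebra+
    then show ?thesis using s by auto
  qed
  show "?g1 = 0" "?g3 = 0" using *[OF e1 e2] by simp_all
qed

lemma scaling_Btilde:
  assumes "r \<noteq> 0"
  shows "scaling r \<circ> lin_subst (blk a b c d (g / r\<^sup>2)) = lin_subst (blk (r * a) (r * b) (r * c) (r * d) g)"
  unfolding scaling_blk lin_subst_blk_comp using assms by (intro lin_subst_blk_cong) auto

text \<open>
  Eliminating between the coefficients at $x^3y$ and $xy^3$ gives $(ad+bc)(2cd+tab) = 0$ and
  $(ad+bc)(2ab+tcd) = 0$. Either $ad+bc = 0$, which is the shape of $B_{\alpha,\beta}$ with both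
  indices nonzero, or $ab = cd = 0$ because \<open>t\<^sup>2 \<noteq> 4\<close>, and the matrix is
  monomial. Equality of the coefficients at $x^4$ and $y^4$ makes the ratios fourth roots of
  unity.
\<close>

lemma normal_form_matrix:
  fixes a b c d t g :: complex
  assumes t: "t \<in> params" and det: "a * d - b * c \<noteq> 0"
    and g1: "qx3y t a b c d = 0"
    and g3: "qxy3 t a b c d = 0"
    and g04: "qx4 t a c = qx4 t b d"
  obtains \<alpha> \<beta> r where "index_pair \<alpha> \<beta>" "r \<noteq> 0"
    "lin_subst (blk a b c d g) = scaling r \<circ> lin_subst (Btilde \<alpha> \<beta> (g / r\<^sup>2))"
    "qx4 t a c = r^4 * cB \<alpha> \<beta> t"
    "qx2y2 t a b c d =
       r^4 * cB \<alpha> \<beta> t * frac_lin \<alpha> \<beta> t"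
proof -
  have t4: "t\<^sup>2 \<noteq> 4" using t by (simp add: params_def)
  have "2 * ((a * d - b * c) * ((a * d + b * c) * (2 * c * d + t * a * b))) =
      a\<^sup>2 * qxy3 t a b c d -
      b\<^sup>2 * qx3y t a b c d"
    by Groebner_Basis.algebra
  moreover have "2 * ((a * d - b * c) * ((a * d + b * c) * (2 * a * b + t * c * d))) =
      d\<^sup>2 * qx3y t a b c d -
      c\<^sup>2 * qxy3 t a b c d"
    by Groebner_Basis.algebra
  ultimately have alt: "(a * d + b * c = 0) \<or> (2 * c * d + t * a * b = 0 \<and> 2 * a * b + t * c * d = 0)"
    using det unfolding g1 g3 by auto
  show thesis
  proof (cases "a * d + b * c = 0")
    case False
    then have "2 * c * d + t * a * b = 0" "2 * a * b + t * c * d = 0" using alt by auto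
    then have "(t\<^sup>2 - 4) * (a * b) = 0" "(t\<^sup>2 - 4) * (c * d) = 0" by Groebner_Basis.algebra+
    then have abcd: "a * b = 0" "c * d = 0" using t4 by auto
    show thesis
    proof (cases "a = 0")
      case True
      then have nz: "b \<noteq> 0" "c \<noteq> 0" "d = 0" using det abcd by auto
      have "b ^ 4 = c ^ 4" using g04 True nz by simp
      then have m: "b / c \<in> mu4" using nz by (simp add: mu4_iff power_divide)
      show thesis
      proof (rule that[of 0 "b / c" c])
        show "index_pair 0 (b / c)" using m nz by (simp add: index_pair_def)
        show "lin_subst (blk a b c d g) = scaling c \<circ> lin_subst (Btilde 0 (b / c) (g / c\<^sup>2))"
          using nz True by (simp add: Btilde_blk scaling_Btilde)
        show "qx2y2 t a b c d =
          c ^ 4 * cB 0 (b / c) t * frac_lin 0 (b / c) t"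
          using nz True by (simp add: cB_def frac_lin_def field_simps eval_nat_numeral)
      qed (use nz True in \<open>simp_all add: cB_def\<close>)
    next
      case a: False
      then have nz: "b = 0" "d \<noteq> 0" "c = 0" using det abcd by auto
      have "a ^ 4 = d ^ 4" using g04 nz by simp
      then have m: "d / a \<in> mu4" using a nz by (simp add: mu4_iff power_divide)
      show thesis
      proof (rule that[of "d / a" 0 a])
        show "index_pair (d / a) 0" using m a nz by (simp add: index_pair_def)
        show "lin_subst (blk a b c d g) = scaling a \<circ> lin_subst (Btilde (d / a) 0 (g / a\<^sup>2))"
          using nz a by (simp add: Btilde_blk scaling_Btilde)
        show "qx2y2 t a b c d =
          a ^ 4 * cB (d / a) 0 t * frac_lin (d / a) 0 t"
          using nz a by (simp add: cB_def frac_lin_def field_simps eval_nat_numeral)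
      qed (use nz a in \<open>simp_all add: cB_def\<close>)
    qed
  next
    case True
    then have nz: "a \<noteq> 0" "b \<noteq> 0" "c \<noteq> 0" "d \<noteq> 0" using det by auto
    define \<alpha> \<beta> where "\<alpha> = c / a" and "\<beta> = b / a"
    have abc: "c = a * \<alpha>" "b = a * \<beta>" "\<alpha> \<noteq> 0" "\<beta> \<noteq> 0" using nz by (simp_all add: \<alpha>_def \<beta>_def)
    have "a * (d + a * \<alpha> * \<beta>) = 0" using True abc by Groebner_Basis.algebra
    then have d: "d = - (a * \<alpha> * \<beta>)" using nz by (simp add: add_eq_0_iff2)
    have "qx3y t a b c d = 4 * a ^ 4 * \<beta> * (1 - \<alpha> ^ 4)"
      unfolding abc(1,2) d by Groebner_Basis.algebra
    then have \<alpha>4: "\<alpha> ^ 4 = 1" unfolding g1 using nz abc by simp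
    then have \<alpha>: "\<alpha> \<in> mu4" by (simp add: mu4_iff)
    have g0: "qx4 t a c = a ^ 4 * (1 + \<alpha> ^ 4 + \<alpha>\<^sup>2 * t)"
      unfolding abc(1,2) d by Groebner_Basis.algebra
    have g4: "qx4 t b d = a ^ 4 * \<beta> ^ 4 * (1 + \<alpha> ^ 4 + \<alpha>\<^sup>2 * t)"
      unfolding abc(1,2) d by Groebner_Basis.algebra
    have "a ^ 4 * (2 + \<alpha>\<^sup>2 * t) * (1 - \<beta> ^ 4) =
        a ^ 4 * (1 + 1 + \<alpha>\<^sup>2 * t) - a ^ 4 * \<beta> ^ 4 * (1 + 1 + \<alpha>\<^sup>2 * t)"
      by (simp add: algebra_simps)
    also have "\<dots> = 0" using g04 unfolding g0 g4 \<alpha>4 by simp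
    finally have "a ^ 4 * (2 + \<alpha>\<^sup>2 * t) * (1 - \<beta> ^ 4) = 0" .
    then have \<beta>4: "\<beta> ^ 4 = 1" using nz params_denom[OF t \<alpha>] by simp
    then have \<beta>: "\<beta> \<in> mu4" by (simp add: mu4_iff)
    show thesis
    proof (rule that[of \<alpha> \<beta> a])
      show "index_pair \<alpha> \<beta>" using \<alpha> \<beta> abc by (simp add: index_pair_def)
      show "lin_subst (blk a b c d g) = scaling a \<circ> lin_subst (Btilde \<alpha> \<beta> (g / a\<^sup>2))"
        using nz abc d by (simp add: Btilde_blk scaling_Btilde mult.assoc)
      show "qx4 t a c = a ^ 4 * cB \<alpha> \<beta> t"
        unfolding g0 \<alpha>4 using abc(3,4) by (simp add: cB_def)
      have cf: "cB \<alpha> \<beta> t * frac_lin \<alpha> \<beta> t = \<beta>\<^sup>2 * (12 - 2 * \<alpha>\<^sup>2 * t)"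
        using abc params_denom[OF t \<alpha>] by (simp add: cB_def frac_lin_def mult.commute)
      have "qx2y2 t a b c d =
        a ^ 4 * (\<beta>\<^sup>2 * (6 + 6 * \<alpha> ^ 4 - 2 * \<alpha>\<^sup>2 * t))"
        unfolding abc(1,2) d by Groebner_Basis.algebra
      also have "\<dots> = a ^ 4 * (cB \<alpha> \<beta> t * frac_lin \<alpha> \<beta> t)"
        unfolding \<alpha>4 cf by simp
      finally show "qx2y2 t a b c d =
        a ^ 4 * cB \<alpha> \<beta> t * frac_lin \<alpha> \<beta> t"
        by (simp only: mult.assoc)
    qed (use nz in simp)
  qed
qed

section \<open>Classification of the morphisms\<close>

lemma lin_subst_blk_fam:
  "lin_subst (blk a b c d g) (fam t) =
   cst (qx4 t a c) * varX ^ 4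
   + cst (qx3y t a b c d) * (varX ^ 3 * varY)
   + cst (qx2y2 t a b c d) * (varX\<^sup>2 * varY\<^sup>2)
   + cst (qxy3 t a b c d) * (varX * varY ^ 3)
   + cst (qx4 t b d) * varY ^ 4 + cst (g\<^sup>2) * varZ\<^sup>2"
  unfolding quartic_expand[symmetric]
  by (simp add: fam_def lin_subst_simps power_mult_distrib cst_power)

lemma Btilde_fam:
  assumes "t \<in> params" "index_pair \<alpha> \<beta>"
  shows "lin_subst (Btilde \<alpha> \<beta> \<gamma>) (fam t) =
    cst (cB \<alpha> \<beta> t) * (varX ^ 4 + varY ^ 4 + cst (frac_lin \<alpha> \<beta> t) * (varX\<^sup>2 * varY\<^sup>2)) + cst (\<gamma>\<^sup>2) * varZ\<^sup>2"
proof -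
  from assms(2) show ?thesis
  proof (cases rule: index_pair_cases)
    case 1
    then show ?thesis using mu4_iff[of \<alpha>]
      by (simp add: Btilde_blk lin_subst_blk_fam cB_def frac_lin_def mult.commute)
  next
    case 2
    then show ?thesis using mu4_iff[of \<beta>]
      by (simp add: Btilde_blk lin_subst_blk_fam cB_def frac_lin_def mult.commute)
  next
    case 3
    then have nz: "\<alpha> \<noteq> 0" "\<beta> \<noteq> 0" by (auto dest: mu4_nonzero)
    have p: "\<alpha> ^ 4 = 1" "\<beta> ^ 4 = 1" using 3 by (simp_all add: mu4_iff)
    let ?d = "- (\<alpha> * \<beta>)"
    have cf: "cB \<alpha> \<beta> t * frac_lin \<alpha> \<beta> t = \<beta>\<^sup>2 * (12 - 2 * \<alpha>\<^sup>2 * t)"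
      using nz params_denom[OF assms(1) 3(1)] by (simp add: cB_def frac_lin_def mult.commute)
    have "1^4 + \<alpha>^4 + t * 1\<^sup>2 * \<alpha>\<^sup>2 = 1 + \<alpha>^4 + t * \<alpha>\<^sup>2" by simp
    also have "\<dots> = cB \<alpha> \<beta> t" using nz p by (simp add: cB_def mult.commute)
    finally have 0: "1^4 + \<alpha>^4 + t * 1\<^sup>2 * \<alpha>\<^sup>2 = cB \<alpha> \<beta> t" .
    have "4 * 1^3 * \<beta> + 4 * \<alpha>^3 * ?d + 2 * t * 1 * \<alpha> * (\<beta> * \<alpha> + 1 * ?d) = 4 * \<beta> * (1 - \<alpha>^4)"
      unfolding power_one mult_1_right mult_1_left by Groebner_Basis.algebra
    then have 1: "4 * 1^3 * \<beta> + 4 * \<alpha>^3 * ?d + 2 * t * 1 * \<alpha> * (\<beta> * \<alpha> + 1 * ?d) = 0"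
      using p by simp
    have "6 * 1\<^sup>2 * \<beta>\<^sup>2 + 6 * \<alpha>\<^sup>2 * ?d\<^sup>2 + t * (1\<^sup>2 * ?d\<^sup>2 + \<beta>\<^sup>2 * \<alpha>\<^sup>2 + 4 * 1 * \<beta> * \<alpha> * ?d) =
        \<beta>\<^sup>2 * (6 + 6 * \<alpha>^4 - 2 * \<alpha>\<^sup>2 * t)"
      unfolding power_one mult_1_right mult_1_left by Groebner_Basis.algebra
    then have 2: "6 * 1\<^sup>2 * \<beta>\<^sup>2 + 6 * \<alpha>\<^sup>2 * ?d\<^sup>2 + t * (1\<^sup>2 * ?d\<^sup>2 + \<beta>\<^sup>2 * \<alpha>\<^sup>2 + 4 * 1 * \<beta> * \<alpha> * ?d) =
        cB \<alpha> \<beta> t * frac_lin \<alpha> \<beta> t"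
      unfolding cf p by simp
    have "4 * 1 * \<beta>^3 + 4 * \<alpha> * ?d^3 + 2 * t * \<beta> * ?d * (\<beta> * \<alpha> + 1 * ?d) = 4 * \<beta>^3 * (1 - \<alpha>^4)"
      unfolding power_one mult_1_right mult_1_left by Groebner_Basis.algebra
    then have 3: "4 * 1 * \<beta>^3 + 4 * \<alpha> * ?d^3 + 2 * t * \<beta> * ?d * (\<beta> * \<alpha> + 1 * ?d) = 0"
      using p by simp
    have "\<beta>^4 + ?d^4 + t * \<beta>\<^sup>2 * ?d\<^sup>2 = \<beta>^4 * (1 + \<alpha>^4 + t * \<alpha>\<^sup>2)"
      by Groebner_Basis.algebra
    also have "\<dots> = cB \<alpha> \<beta> t" using nz p by (simp add: cB_def mult.commute)
    finally have 4: "\<beta>^4 + ?d^4 + t * \<beta>\<^sup>2 * ?d\<^sup>2 = cB \<alpha> \<beta> t" .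
    show ?thesis
      unfolding Btilde_blk(3)[OF nz(2,1)] lin_subst_blk_fam 0 1 2 3 4
      by (simp add: cst_mult ring_distribs mult.assoc)
  qed
qed

lemma Btilde_fam_contact:
  assumes "t \<in> params" "index_pair \<alpha> \<beta>" "\<gamma>\<^sup>2 = cB \<alpha> \<beta> t"
  shows "lin_subst (Btilde \<alpha> \<beta> \<gamma>) (fam t) = cst (cB \<alpha> \<beta> t) * fam (frac_lin \<alpha> \<beta> t)"
  by (subst Btilde_fam[OF assms(1,2)]) (simp add: fam_def assms(3) algebra_simps)

lemma Btilde_as_blk:
  assumes "index_pair \<alpha> \<beta>"
  shows "\<exists>a b c d. (\<forall>\<gamma>. Btilde \<alpha> \<beta> \<gamma> = blk a b c d \<gamma>) \<and> a * d - b * c \<noteq> 0"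
proof -
  from assms show ?thesis
  proof (cases rule: index_pair_cases)
    case 1
    then show ?thesis
      by (intro exI[of _ 1] exI[of _ 0] exI[of _ 0] exI[of _ \<alpha>]) (simp add: Btilde_blk mu4_nonzero)
  next
    case 2
    then show ?thesis
      by (intro exI[of _ 0] exI[of _ \<beta>] exI[of _ 1] exI[of _ 0]) (simp add: Btilde_blk)
  next
    case 3
    then show ?thesis
      by (intro exI[of _ 1] exI[of _ \<beta>] exI[of _ \<alpha>] exI[of _ "- (\<alpha> * \<beta>)"])
        (simp add: Btilde_blk mu4_nonzero)
  qed
qed

lemma Btilde_homog:
  assumes "index_pair \<alpha> \<beta>" "\<gamma> \<noteq> 0"
  shows "lin_subst (Btilde \<alpha> \<beta> \<gamma>) \<in> homog_auts"
proof -
  obtain a b c d where "\<forall>\<gamma>. Btilde \<alpha> \<beta> \<gamma> = blk a b c d \<gamma>" "a * d - b * c \<noteq> 0"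
    using Btilde_as_blk[OF assms(1)] by blast
  then show ?thesis using lin_subst_blk_homog_auts[of a d b c \<gamma>] assms(2) by simp
qed

text \<open>
  Any nonzero $\gamma$ is admissible, because the Jacobian ideal contains $z$.
\<close>

lemma image_jac_Btilde:
  assumes t: "t \<in> params" and i: "index_pair \<alpha> \<beta>" and g: "\<gamma> \<noteq> 0"
  shows "lin_subst (Btilde \<alpha> \<beta> \<gamma>) ` jac t = jac (frac_lin \<alpha> \<beta> t)"
proof -
  obtain a b c d where B: "\<And>\<gamma>. Btilde \<alpha> \<beta> \<gamma> = blk a b c d \<gamma>" and det: "a * d - b * c \<noteq> 0"
    using Btilde_as_blk[OF i] by blast
  show ?thesis
    using Btilde_fam[OF t i] cB_nonzero[OF t i] unfolding B by (intro image_jac[OF det g]) auto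
qed

lemma image_Ik_01_Btilde:
  assumes "t \<in> params" "index_pair \<alpha> \<beta>" "\<gamma> \<noteq> 0" "k \<in> {0, 1}"
  shows "lin_subst (Btilde \<alpha> \<beta> \<gamma>) ` Ik (enat k) t = Ik (enat k) (frac_lin \<alpha> \<beta> t)"
  by (rule image_Ik_01[OF Btilde_homog[OF assms(2,3)] image_jac_Btilde[OF assms(1-3)] assms(4)])

lemma image_Ik_Btilde:
  assumes "t \<in> params" "index_pair \<alpha> \<beta>" "\<gamma>\<^sup>2 = cB \<alpha> \<beta> t"
  shows "lin_subst (Btilde \<alpha> \<beta> \<gamma>) ` Ik k t = Ik k (frac_lin \<alpha> \<beta> t)"
proof -
  have g: "\<gamma> \<noteq> 0" using cB_nonzero[OF assms(1,2)] assms(3) by auto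
  show ?thesis
    by (rule image_Ik_contact[OF Btilde_homog[OF assms(2) g] Btilde_fam_contact[OF assms]
          cB_nonzero[OF assms(1,2)] image_jac_Btilde[OF assms(1,2) g]])
qed

lemma image_Ik_scaling:
  assumes "c \<noteq> 0"
  shows "scaling c ` Ik k t = Ik k t"
proof -
  have f: "lin_subst (blk c 0 0 c (c\<^sup>2)) (fam t) =
      cst (c ^ 4) * (varX ^ 4 + varY ^ 4 + cst t * (varX\<^sup>2 * varY\<^sup>2)) + cst ((c\<^sup>2)\<^sup>2) * varZ\<^sup>2"
    by (subst lin_subst_blk_fam) (simp add: cst_hom algebra_simps flip: power_mult power_add)
  then have "lin_subst (blk c 0 0 c (c\<^sup>2)) (fam t) = cst (c ^ 4) * fam t"
    by (simp add: fam_def algebra_simps flip: power_mult)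
  then show ?thesis
    unfolding scaling_blk
    by (rule image_Ik_contact[OF _ _ _ image_jac[OF _ _ _ f], rotated])
      (use assms in \<open>auto intro: lin_subst_blk_homog_auts\<close>)
qed

lemma image_deriv_fam:
  assumes hom: "alg_hom \<phi>"
    and X: "\<phi> varX = cst a * varX + cst b * varY" and Y: "\<phi> varY = cst c * varX + cst d * varY"
  shows "\<phi> (dx (fam t)) =
     cst (px3 t a c) * varX ^ 3
     + cst (px2y t a b c d) * (varX\<^sup>2 * varY)
     + cst (pxy2 t a b c d) * (varX * varY\<^sup>2)
     + cst (px3 t b d) * varY ^ 3"
    and "\<phi> (dy (fam t)) =
     cst (px3 t c a) * varX ^ 3
     + cst (px2y t c d a b) * (varX\<^sup>2 * varY)
     + cst (pxy2 t c d a b) * (varX * varY\<^sup>2)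
     + cst (px3 t d b) * varY ^ 3"
  unfolding cubic_expand[symmetric] deriv_fam by (simp_all add: alg_hom_simps[OF hom] X Y mult.commute)

text \<open>
  This undoes the multiplication by the maximal ideal and thereby reduces $I_1$ to $I_0$.
\<close>

lemma colon_bound1:
  assumes "varX * h \<in> bound1 s" "varY * h \<in> bound1 s"
  shows "h \<in> bound0 s"
  using assms by (simp add: bound0_def bound1_def)

text \<open>
  For \<open>k \<le> 1\<close> the ideal remembers the span of the partial derivatives, and no quadratic term can be
  added to the image of $z$.
\<close>

lemma low_conditions:
  assumes \<phi>: "\<phi> \<in> homog_auts" and k: "k \<in> {0, 1}" and im: "\<phi> ` Ik (enat k) t \<subseteq> Ik (enat k) s"
    and X: "\<phi> varX = cst a * varX + cst b * varY" and Y: "\<phi> varY = cst c * varX + cst d * varY"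
    and Z: "\<phi> varZ = cst g * varZ + cst r1 * varX\<^sup>2 + cst r2 * (varX * varY) + cst r3 * varY\<^sup>2"
    and det: "a * d - b * c \<noteq> 0"
  shows "\<phi> (dx (fam t)) \<in> bound0 s" "\<phi> (dy (fam t)) \<in> bound0 s" "r1 = 0 \<and> r2 = 0 \<and> r3 = 0"
proof -
  note hom = homog_autsD(1)[OF \<phi>]
  have ab: "a \<noteq> 0 \<or> b \<noteq> 0" using det by auto
  have *: "\<phi> (dx (fam t)) \<in> bound0 s \<and> \<phi> (dy (fam t)) \<in> bound0 s \<and> r1 = 0 \<and> r2 = 0 \<and> r3 = 0"
  proof (cases "k = 0")
    case True
    have "\<phi> w \<in> bound0 s" if "w \<in> jac t" for w
    proof -
      have "w \<in> Ik (enat k) t" using prod_in_Ik[of 1 0 w t] that True by simp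
      then have "\<phi> w \<in> Ik (enat 0) s" using im True by auto
      then show ?thesis by (rule subsetD[OF Ik_0_bound])
    qed
    then have "\<phi> (dx (fam t)) \<in> bound0 s" "\<phi> (dy (fam t)) \<in> bound0 s" and z: "\<phi> (dz (fam t)) \<in> bound0 s"
      using deriv_in_jac by simp_all
    moreover from z have "r1 = 0 \<and> r2 = 0 \<and> r3 = 0"
      by (simp add: deriv_fam alg_hom_simps[OF hom] Z bound0_def coeff3_eval)
    ultimately show ?thesis by simp
  next
    case False
    have k1: "k = 1" using k False by simp
    have gen: "\<phi> v * \<phi> w \<in> bound1 s" if "v = varX \<or> v = varY" "w \<in> jac t" for v w
    proof -
      have "v * 1 \<in> max_ideal \<cdot>\<^bsub>\<O>\<^esub> UNIV"
        using that by (intro ideal_prod_O_I) (auto simp: max_ideal_iff coeff3_var)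
      then have "v * w \<in> Ik (enat 1) t"
        using that by (intro prod_in_Ik) simp_all
      then have "\<phi> (v * w) \<in> Ik (enat 1) s" using im k1 by auto
      then have "\<phi> (v * w) \<in> bound1 s" by (rule subsetD[OF Ik_1_bound])
      then show ?thesis by (simp add: alg_hom_simps[OF hom])
    qed
    have XY: "varX * \<phi> w \<in> bound1 s" "varY * \<phi> w \<in> bound1 s" if "w \<in> jac t" for w
    proof -
      have "cst (a * d - b * c) * varX = cst d * \<phi> varX - cst b * \<phi> varY"
        "cst (a * d - b * c) * varY = cst a * \<phi> varY - cst c * \<phi> varX"
        by (simp_all add: X Y cst_hom algebra_simps)
      then have "cst (1 / (a * d - b * c)) * (cst (a * d - b * c) * varX) * \<phi> w =
          cst (1 / (a * d - b * c)) * (cst d * (\<phi> varX * \<phi> w) - cst b * (\<phi> varY * \<phi> w))"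
        "cst (1 / (a * d - b * c)) * (cst (a * d - b * c) * varY) * \<phi> w =
          cst (1 / (a * d - b * c)) * (cst a * (\<phi> varY * \<phi> w) - cst c * (\<phi> varX * \<phi> w))"
        by (simp_all only: left_diff_distrib mult.assoc)
      then have e: "varX * \<phi> w =
          cst (1 / (a * d - b * c)) * (cst d * (\<phi> varX * \<phi> w) - cst b * (\<phi> varY * \<phi> w))"
        "varY * \<phi> w =
          cst (1 / (a * d - b * c)) * (cst a * (\<phi> varY * \<phi> w) - cst c * (\<phi> varX * \<phi> w))"
        using det by (simp_all add: mult.assoc[symmetric] cst_mult[symmetric])
      show "varX * \<phi> w \<in> bound1 s" "varY * \<phi> w \<in> bound1 s"
        unfolding e by (intro ideal_O_D(3,6)[OF ideal_bound1] gen[of varX] gen[of varY] that disjI1 disjI2 refl)+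
    qed
    \<comment> \<open>The product of a linear form with the quadratic terms of the image of $z$ is a cubic form in an ideal without cubic terms.\<close>
    have "\<phi> varX * \<phi> (dz (fam t)) \<in> bound1 s" by (intro gen disjI1 refl deriv_in_jac)
    then have "a * r1 = 0" "a * (r2 * 2) + b * (r1 * 2) = 0" "a * (r3 * 2) + b * (r2 * 2) = 0" "b * r3 = 0"
      by (simp_all add: deriv_fam alg_hom_simps[OF hom] X Z bound1_def coeff3_eval ring_distribs mult.assoc)
        (simp_all add: algebra_simps)
    then have "r1 = 0 \<and> r2 = 0 \<and> r3 = 0" using ab by auto
    moreover have "\<phi> (dx (fam t)) \<in> bound0 s"
      by (intro colon_bound1 XY deriv_in_jac)
    moreover have "\<phi> (dy (fam t)) \<in> bound0 s"
      by (intro colon_bound1 XY deriv_in_jac)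
    ultimately show ?thesis by simp
  qed
  then show "\<phi> (dx (fam t)) \<in> bound0 s" "\<phi> (dy (fam t)) \<in> bound0 s" "r1 = 0 \<and> r2 = 0 \<and> r3 = 0"
    by simp_all
qed

lemma low_classify:
  assumes \<phi>: "\<phi> \<in> homog_auts" and k: "k \<in> {0, 1}" and im: "\<phi> ` Ik (enat k) t = Ik (enat k) s"
    and t: "t \<in> params" and s: "s \<notin> special"
  obtains \<alpha> \<beta> \<gamma> where "index_pair \<alpha> \<beta>" "\<gamma> \<noteq> 0" "scalar_class \<phi> = Btilde_class \<alpha> \<beta> \<gamma>"
    "s = frac_lin \<alpha> \<beta> t"
proof -
  note hom = homog_autsD(1)[OF \<phi>]
  obtain a b c d g r1 r2 r3 where X: "\<phi> varX = cst a * varX + cst b * varY"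
    and Y: "\<phi> varY = cst c * varX + cst d * varY"
    and Z: "\<phi> varZ = cst g * varZ + cst r1 * varX\<^sup>2 + cst r2 * (varX * varY) + cst r3 * varY\<^sup>2"
    and det: "a * d - b * c \<noteq> 0" and g: "g \<noteq> 0"
    using homog_auts_form[OF \<phi>] by metis
  note low = low_conditions[OF \<phi> k equalityD1[OF im] X Y Z det]
  note fx = image_deriv_fam(1)[OF hom X Y] and fy = image_deriv_fam(2)[OF hom X Y]
  have s0: "s \<noteq> 0" "s\<^sup>2 \<noteq> 36"
    using s power2_eq_iff[of s 6] by (auto simp: special_def)
  have eqs: "2 * pxy2 t a b c d = s * px3 t a c"
    "2 * px2y t a b c d = s * px3 t b d"
    "2 * pxy2 t c d a b = s * px3 t c a"
    "2 * px2y t c d a b = s * px3 t d b"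
    using low(1,2) unfolding fx fy bound0_def mem_Collect_eq
    by (simp_all add: coeff3_eval del: distrib_left_numeral)
  note q = partials_determine_quartic[OF s0 eqs]
  obtain \<alpha> \<beta> r where B: "index_pair \<alpha> \<beta>" "r \<noteq> 0"
    "lin_subst (blk a b c d g) = scaling r \<circ> lin_subst (Btilde \<alpha> \<beta> (g / r\<^sup>2))"
    "qx4 t a c = r^4 * cB \<alpha> \<beta> t"
    "qx2y2 t a b c d =
       r^4 * cB \<alpha> \<beta> t * frac_lin \<alpha> \<beta> t"
    using normal_form_matrix[OF t det q(1-3)] by metis
  have "s * (r^4 * cB \<alpha> \<beta> t) = frac_lin \<alpha> \<beta> t * (r^4 * cB \<alpha> \<beta> t)"
    using q(4) unfolding B(4,5) by (simp only: mult.commute)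
  then have "s = frac_lin \<alpha> \<beta> t" using B(2) cB_nonzero[OF t B(1)] by auto
  moreover have "\<phi> = lin_subst (blk a b c d g)"
    by (rule homog_auts_eqI[OF \<phi> alg_hom_lin_subst]) (simp_all add: X Y Z lin_subst_blk_var low(3))
  then have "scalar_class \<phi> = Btilde_class \<alpha> \<beta> (g / r\<^sup>2)"
    unfolding B(3) Btilde_class_def using B(2) by (simp add: scalar_class_scaling)
  ultimately show thesis using that[of \<alpha> \<beta> "g / r\<^sup>2"] B(1,2) g by simp
qed

text \<open>
  For \<open>k \<ge> 2\<close> the part of weight four of the ideal consists of the multiples of the defining equation,
  up to multiples of $z$ for \<open>k = 2\<close>. So the equation itself is carried to a multiple of the other one.
\<close>

lemma high_classify:
  assumes \<phi>: "\<phi> \<in> homog_auts" and k: "2 \<le> k" and im: "\<phi> ` Ik k t = Ik k s"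
    and t: "t \<in> params"
  obtains \<alpha> \<beta> \<gamma> where "index_pair \<alpha> \<beta>" "\<gamma>\<^sup>2 = cB \<alpha> \<beta> t" "scalar_class \<phi> = Btilde_class \<alpha> \<beta> \<gamma>"
    "s = frac_lin \<alpha> \<beta> t"
proof -
  note hom = homog_autsD(1)[OF \<phi>]
  obtain a b c d g r1 r2 r3 where X: "\<phi> varX = cst a * varX + cst b * varY"
    and Y: "\<phi> varY = cst c * varX + cst d * varY"
    and Z: "\<phi> varZ = cst g * varZ + cst r1 * varX\<^sup>2 + cst r2 * (varX * varY) + cst r3 * varY\<^sup>2"
    and det: "a * d - b * c \<noteq> 0" and g: "g \<noteq> 0"
    using homog_auts_form[OF \<phi>] by metis
  have ab: "a \<noteq> 0 \<or> b \<noteq> 0" using det by auto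
  let ?q = "cst (qx4 t a c) * varX ^ 4
   + cst (qx3y t a b c d) * (varX ^ 3 * varY)
   + cst (qx2y2 t a b c d) * (varX\<^sup>2 * varY\<^sup>2)
   + cst (qxy3 t a b c d) * (varX * varY ^ 3)
   + cst (qx4 t b d) * varY ^ 4"
  have F: "\<phi> (fam t) = ?q + \<phi> varZ * \<phi> varZ"
    unfolding quartic_expand[symmetric]
    by (simp add: fam_def alg_hom_simps[OF hom] X Y power2_eq_square)
  have in_s: "\<phi> (fam t) \<in> Ik k s" using fam_in_Ik im by blast
  define w where "w = \<phi> varZ"
  have w: "coeff3 w 0 0 0 = 0" "coeff3 w 1 0 0 = 0" "coeff3 w 0 1 0 = 0" "coeff3 w 0 0 1 = g"
    "coeff3 w 2 0 0 = r1" "coeff3 w 1 1 0 = r2" "coeff3 w 0 2 0 = r3" "coeff3 w 1 0 1 = 0"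
    "coeff3 w 0 1 1 = 0" "coeff3 w 2 0 1 = 0" "coeff3 w 1 1 1 = 0" "coeff3 w 0 2 1 = 0"
    by (simp_all add: w_def Z coeff3_eval)
  have "r1 = 0 \<and> r2 = 0 \<and> r3 = 0"
  proof (cases "3 \<le> k")
    case True
    have "\<phi> (fam t) \<in> bound3 s" using in_s Ik_3_bound[OF True] by blast
    then have z: "coeff3 (\<phi> (fam t)) 2 0 1 = 0" "coeff3 (\<phi> (fam t)) 1 1 1 = 0" "coeff3 (\<phi> (fam t)) 0 2 1 = 0"
      by (simp_all add: bound3_def)
    have "coeff3 (w * w) 2 0 1 = 2 * g * r1" "coeff3 (w * w) 1 1 1 = 2 * g * r2" "coeff3 (w * w) 0 2 1 = 2 * g * r3"
      using w by (simp_all add: coeff3_mult_eval)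
    then have "2 * g * r1 = 0" "2 * g * r2 = 0" "2 * g * r3 = 0"
      using z unfolding F w_def[symmetric] by (simp_all add: coeff3_eval)
    then show ?thesis using g by simp
  next
    case False
    then have k2: "k = enat 2"
      using k by (cases k) (auto simp: numeral_eq_enat)
    \<comment> \<open>The terms $x^2z$ etc. are admissible for \<open>k = 2\<close>, so the image of $x^2z$ is used instead of that of $z^2$.\<close>
    have X1: "varX \<in> max_ideal" by (simp add: max_ideal_iff coeff3_var)
    have "varX * 1 \<in> max_ideal \<cdot>\<^bsub>\<O>\<^esub> UNIV" by (rule ideal_prod_O_I[OF X1 UNIV_I])
    from ideal_prod_O_I[OF X1 this] have "varX * (varX * 1) \<in> max_ideal_pow 2"
      by (simp add: numeral_2_eq_2)
    then have "varX * (varX * 1) * dz (fam t) \<in> Ik k t"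
      unfolding k2 by (intro prod_in_Ik deriv_in_jac)
    then have "\<phi> (varX * (varX * 1) * dz (fam t)) \<in> bound2 s"
      using im Ik_2_bound[OF k] by blast
    moreover have "\<phi> (varX * (varX * 1) * dz (fam t)) =
        cst 2 * (cst a * (varX * (cst a * (varX * w) + cst b * (varY * w)))
          + cst b * (varY * (cst a * (varX * w) + cst b * (varY * w))))"
      unfolding deriv_fam by (simp add: alg_hom_simps[OF hom] X w_def[symmetric] algebra_simps)
    ultimately have "a = 0 \<or> r1 = 0" "2 * (a * (a * r2 + b * r1)) + 2 * (b * (a * r1)) = 0"
      "2 * (a * (a * r3 + b * r2)) + 2 * (b * (a * r2 + b * r1)) = 0"
      "2 * (a * (b * r3)) + 2 * (b * (a * r3 + b * r2)) = 0" "b = 0 \<or> r3 = 0"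
      by (simp_all add: bound2_def w w[unfolded One_nat_def])
    then show ?thesis using ab by auto
  qed
  then have Z': "\<phi> varZ = cst g * varZ" using Z by simp
  have "\<phi> (fam t) \<in> bound2 s" using in_s Ik_2_bound[OF k] by blast
  then have q: "qx4 t a c = g * g"
     "qx3y t a b c d = 0"
     "qx2y2 t a b c d = s * (g * g)"
     "qxy3 t a b c d = 0"
     "qx4 t b d = g * g"
    unfolding F Z' bound2_def mem_Collect_eq
    by (simp_all add: coeff3_eval mult.assoc)
  have q04: "qx4 t a c = qx4 t b d" using q by simp
  obtain \<alpha> \<beta> r where B: "index_pair \<alpha> \<beta>" "r \<noteq> 0"
    "lin_subst (blk a b c d g) = scaling r \<circ> lin_subst (Btilde \<alpha> \<beta> (g / r\<^sup>2))"
    "qx4 t a c = r^4 * cB \<alpha> \<beta> t"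
    "qx2y2 t a b c d =
       r^4 * cB \<alpha> \<beta> t * frac_lin \<alpha> \<beta> t"
    using normal_form_matrix[OF t det q(2,4) q04] by metis
  have gg: "g * g = r^4 * cB \<alpha> \<beta> t" using q(1) B(4) by simp
  have "s * (r^4 * cB \<alpha> \<beta> t) = frac_lin \<alpha> \<beta> t * (r^4 * cB \<alpha> \<beta> t)"
    using q(3) unfolding B(5) gg by (simp only: mult.commute)
  then have "s = frac_lin \<alpha> \<beta> t" using B(2) cB_nonzero[OF t B(1)] by auto
  moreover have "\<phi> = lin_subst (blk a b c d g)"
    by (rule homog_auts_eqI[OF \<phi> alg_hom_lin_subst]) (simp_all add: X Y Z' lin_subst_blk_var)
  then have "scalar_class \<phi> = Btilde_class \<alpha> \<beta> (g / r\<^sup>2)"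
    unfolding B(3) Btilde_class_def using B(2) by (simp add: scalar_class_scaling)
  moreover have "(g / r\<^sup>2)\<^sup>2 = cB \<alpha> \<beta> t"
    using gg B(2) by (simp add: power_divide power2_eq_square eval_nat_numeral)
  ultimately show thesis using that[of \<alpha> \<beta> "g / r\<^sup>2"] B(1) by simp
qed

section \<open>The groupoids\<close>

text \<open>
  The parameter is visible in the ratio of the coefficients of $\partial_xf_s$.
\<close>

lemma Ik_0_inj:
  assumes "Ik 0 s = Ik 0 s'"
  shows "s = s'"
proof -
  have "dx (fam s) \<in> Ik 0 s"
    using prod_in_Ik[of 1 0 "dx (fam s)"] deriv_in_jac by (simp add: zero_enat_def)
  then have "dx (fam s) \<in> bound0 s'" using assms Ik_0_bound by (auto simp: zero_enat_def)
  then show ?thesis by (simp add: bound0_def deriv_fam coeff3_eval)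
qed

lemma image_Ik_scalar_class:
  assumes "\<psi> \<in> homog_auts" "scalar_class \<phi> = scalar_class \<psi>"
  shows "\<phi> ` Ik k t = \<psi> ` Ik k t"
proof -
  obtain c where c: "c \<noteq> 0" "\<phi> = scaling c \<circ> \<psi>"
    using scalar_class_eqD[OF assms(2)] by metis
  have e: "\<phi> = \<psi> \<circ> scaling c" using c scaling_commute[OF assms(1)] by simp
  show ?thesis unfolding e image_comp[symmetric] image_Ik_scaling[OF c(1)] ..
qed

lemma Mor_low:
  assumes k: "k \<in> {0, 1}" and t: "t \<in> params" and s: "s \<in> params - special"
  shows "Mor (Grp (enat k)) t s =
    {g. \<exists>\<alpha> \<beta> \<gamma>. index_pair \<alpha> \<beta> \<and> \<gamma> \<noteq> 0 \<and> g = Btilde_class \<alpha> \<beta> \<gamma> \<and> s = frac_lin \<alpha> \<beta> t}" (is "_ = ?R")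
proof -
  have M: "Mor (Grp (enat k)) t s = {scalar_class \<phi> | \<phi>. \<phi> \<in> homog_auts \<and> \<phi> ` Ik (enat k) t = Ik (enat k) s}"
    using t s by (simp add: Grp_def)
  have "scalar_class \<phi> \<in> ?R" if "\<phi> \<in> homog_auts" "\<phi> ` Ik (enat k) t = Ik (enat k) s" for \<phi>
    using low_classify[OF that(1) k that(2) t] s by blast
  moreover have "\<exists>\<phi>. Btilde_class \<alpha> \<beta> \<gamma> = scalar_class \<phi> \<and> \<phi> \<in> homog_auts \<and>
      \<phi> ` Ik (enat k) t = Ik (enat k) (frac_lin \<alpha> \<beta> t)" if "index_pair \<alpha> \<beta>" "\<gamma> \<noteq> 0" for \<alpha> \<beta> \<gamma>
    using Btilde_homog[OF that] image_Ik_01_Btilde[OF t that k] unfolding Btilde_class_def by blast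
  ultimately show ?thesis unfolding M by blast
qed

lemma Mor_high:
  assumes k: "2 \<le> k" and t: "t \<in> params" and s: "s \<in> params"
  shows "Mor (Grp k) t s =
    {g. \<exists>\<alpha> \<beta> \<gamma>. index_pair \<alpha> \<beta> \<and> \<gamma>\<^sup>2 = cB \<alpha> \<beta> t \<and> g = Btilde_class \<alpha> \<beta> \<gamma> \<and> s = frac_lin \<alpha> \<beta> t}" (is "_ = ?R")
proof -
  have M: "Mor (Grp k) t s = {scalar_class \<phi> | \<phi>. \<phi> \<in> homog_auts \<and> \<phi> ` Ik k t = Ik k s}"
    using t s by (simp add: Grp_def)
  have "scalar_class \<phi> \<in> ?R" if "\<phi> \<in> homog_auts" "\<phi> ` Ik k t = Ik k s" for \<phi>
    using high_classify[OF that(1) k that(2) t] by blast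
  moreover have "\<exists>\<phi>. Btilde_class \<alpha> \<beta> \<gamma> = scalar_class \<phi> \<and> \<phi> \<in> homog_auts \<and>
      \<phi> ` Ik k t = Ik k (frac_lin \<alpha> \<beta> t)" if "index_pair \<alpha> \<beta>" "\<gamma>\<^sup>2 = cB \<alpha> \<beta> t" for \<alpha> \<beta> \<gamma>
  proof -
    have "\<gamma> \<noteq> 0" using cB_nonzero[OF t that(1)] that(2) by auto
    then show ?thesis
      using Btilde_homog[OF that(1)] image_Ik_Btilde[OF t that] unfolding Btilde_class_def by blast
  qed
  ultimately show ?thesis unfolding M by blast
qed

lemma Btilde_class_id: "Btilde_class 1 0 1 = scalar_class id"
  by (simp add: Btilde_class_def Btilde_blk lin_subst_blk_1)

lemma Mor_high_explicit:
  assumes k: "2 \<le> k" and t: "t \<in> params" and s: "s \<in> params"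
  shows "Mor (Grp k) t s =
          {g. s = t \<and>
              g \<in> {scalar_class id, Btilde_class (-1) 0 1, Btilde_class 0 1 1,
                   Btilde_class 0 (-1) 1,
                   Btilde_class 1 0 (-1), Btilde_class (-1) 0 (-1), Btilde_class 0 1 (-1),
                   Btilde_class 0 (-1) (-1)}} \<union>
          {g. \<exists>\<alpha> \<in> mu4. s = \<alpha>\<^sup>2 * t \<and>
              g \<in> {Btilde_class \<alpha> 0 1, Btilde_class 0 \<alpha> 1,
                   Btilde_class \<alpha> 0 (-1), Btilde_class 0 \<alpha> (-1)}} \<union>
          {g. \<exists>\<alpha> \<in> mu4. \<exists>\<beta> \<in> mu4. s = \<beta>\<^sup>2 * (12 - 2 * \<alpha>\<^sup>2 * t) / (2 + \<alpha>\<^sup>2 * t) \<and>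
              g \<in> {Btilde_class \<alpha> \<beta> (csqrt (2 + \<alpha>\<^sup>2 * t)),
                   Btilde_class \<alpha> \<beta> (- csqrt (2 + \<alpha>\<^sup>2 * t))}}"
    (is "_ = ?A \<union> ?B \<union> ?C")
proof -
  define R where "R = {g. \<exists>\<alpha> \<beta> \<gamma>. index_pair \<alpha> \<beta> \<and> \<gamma>\<^sup>2 = cB \<alpha> \<beta> t \<and> g = Btilde_class \<alpha> \<beta> \<gamma> \<and> s = frac_lin \<alpha> \<beta> t}"
  have RI: "Btilde_class \<alpha> \<beta> \<gamma> \<in> R" if "index_pair \<alpha> \<beta>" "\<gamma>\<^sup>2 = cB \<alpha> \<beta> t" "s = frac_lin \<alpha> \<beta> t" for \<alpha> \<beta> \<gamma>
    using that unfolding R_def by blast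
  have R1: "Btilde_class \<alpha> 0 \<gamma> \<in> R" "Btilde_class 0 \<alpha> \<gamma> \<in> R"
    if "\<alpha> \<in> mu4" "\<gamma> = 1 \<or> \<gamma> = -1" "s = \<alpha>\<^sup>2 * t" for \<alpha> \<gamma>
    using that mu4_nonzero[OF that(1)] by (auto intro!: RI simp: index_pair_def cB_def frac_lin_def)
  have R2: "Btilde_class \<alpha> \<beta> \<gamma> \<in> R"
    if "\<alpha> \<in> mu4" "\<beta> \<in> mu4" "\<gamma>\<^sup>2 = 2 + \<alpha>\<^sup>2 * t" "s = \<beta>\<^sup>2 * (12 - 2 * \<alpha>\<^sup>2 * t) / (2 + \<alpha>\<^sup>2 * t)" for \<alpha> \<beta> \<gamma>
    using that mu4_nonzero[OF that(1)] mu4_nonzero[OF that(2)]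
    by (auto intro!: RI simp: index_pair_def cB_def frac_lin_def mult.commute)
  have m: "1 \<in> mu4" "-1 \<in> mu4" by (simp_all add: mu4_def)
  have P: "Btilde_class 1 0 \<gamma> \<in> R" "Btilde_class (-1) 0 \<gamma> \<in> R" "Btilde_class 0 1 \<gamma> \<in> R"
    "Btilde_class 0 (-1) \<gamma> \<in> R" if "\<gamma> = 1 \<or> \<gamma> = -1" "s = t" for \<gamma>
  proof -
    have s1: "s = 1\<^sup>2 * t" "s = (-1)\<^sup>2 * t" using that(2) by simp_all
    show "Btilde_class 1 0 \<gamma> \<in> R" by (rule R1(1)[OF m(1) that(1) s1(1)])
    show "Btilde_class (-1) 0 \<gamma> \<in> R" by (rule R1(1)[OF m(2) that(1) s1(2)])
    show "Btilde_class 0 1 \<gamma> \<in> R" by (rule R1(2)[OF m(1) that(1) s1(1)])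
    show "Btilde_class 0 (-1) \<gamma> \<in> R" by (rule R1(2)[OF m(2) that(1) s1(2)])
  qed
  have A: "?A \<subseteq> R"
  proof (intro subsetI, elim CollectE conjE)
    fix g assume st: "s = t" and g: "g \<in> {scalar_class id, Btilde_class (-1) 0 1, Btilde_class 0 1 1,
                   Btilde_class 0 (-1) 1,
                   Btilde_class 1 0 (-1), Btilde_class (-1) 0 (-1), Btilde_class 0 1 (-1),
                   Btilde_class 0 (-1) (-1)}"
    show "g \<in> R"
      using g P[OF disjI1[OF refl] st] P[OF disjI2[OF refl] st]
      unfolding Btilde_class_id[symmetric] insert_iff empty_iff by (elim disjE) simp_all
  qed
  have B: "?B \<subseteq> R"
  proof (intro subsetI, elim CollectE bexE conjE)
    fix g \<alpha> assume "\<alpha> \<in> mu4" "s = \<alpha>\<^sup>2 * t" "g \<in> {Btilde_class \<alpha> 0 1, Btilde_class 0 \<alpha> 1,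
                   Btilde_class \<alpha> 0 (-1), Btilde_class 0 \<alpha> (-1)}"
    then show "g \<in> R" using R1[of \<alpha> 1] R1[of \<alpha> "-1"] by (elim insertE emptyE) simp_all
  qed
  have C: "?C \<subseteq> R"
  proof (intro subsetI, elim CollectE bexE conjE)
    fix g \<alpha> \<beta> assume "\<alpha> \<in> mu4" "\<beta> \<in> mu4" "s = \<beta>\<^sup>2 * (12 - 2 * \<alpha>\<^sup>2 * t) / (2 + \<alpha>\<^sup>2 * t)"
      "g \<in> {Btilde_class \<alpha> \<beta> (csqrt (2 + \<alpha>\<^sup>2 * t)), Btilde_class \<alpha> \<beta> (- csqrt (2 + \<alpha>\<^sup>2 * t))}"
    then show "g \<in> R"
      using R2[of \<alpha> \<beta> "csqrt (2 + \<alpha>\<^sup>2 * t)"] R2[of \<alpha> \<beta> "- csqrt (2 + \<alpha>\<^sup>2 * t)"]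
      by (elim insertE emptyE) simp_all
  qed
  have D: "g \<in> ?B \<union> ?C" if gR: "g \<in> R" for g
  proof -
    obtain \<alpha> \<beta> \<gamma> where i: "index_pair \<alpha> \<beta>" and g2: "\<gamma>\<^sup>2 = cB \<alpha> \<beta> t" and g: "g = Btilde_class \<alpha> \<beta> \<gamma>"
      and s: "s = frac_lin \<alpha> \<beta> t" using gR unfolding R_def by blast
    from i show ?thesis
    proof (cases rule: index_pair_cases)
      case 1
      then have "\<gamma> = 1 \<or> \<gamma> = -1" using g2 by (simp add: cB_def power2_eq_1_iff)
      then have "g \<in> ?B" using 1 g s
        by (intro CollectI bexI[of _ \<alpha>] conjI) (auto simp: frac_lin_def)
      then show ?thesis by blast
    next
      case 2
      then have "\<gamma> = 1 \<or> \<gamma> = -1" using g2 by (simp add: cB_def power2_eq_1_iff)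
      then have "g \<in> ?B" using 2 g s
        by (intro CollectI bexI[of _ \<beta>] conjI) (auto simp: frac_lin_def)
      then show ?thesis by blast
    next
      case 3
      then have nz: "\<alpha> \<noteq> 0" "\<beta> \<noteq> 0" by (auto dest: mu4_nonzero)
      have "\<gamma>\<^sup>2 = (csqrt (2 + \<alpha>\<^sup>2 * t))\<^sup>2" using g2 nz by (simp add: cB_def)
      then have "\<gamma> = csqrt (2 + \<alpha>\<^sup>2 * t) \<or> \<gamma> = - csqrt (2 + \<alpha>\<^sup>2 * t)"
        unfolding power2_eq_iff .
      moreover have "s = \<beta>\<^sup>2 * (12 - 2 * \<alpha>\<^sup>2 * t) / (2 + \<alpha>\<^sup>2 * t)"
        using s nz by (simp add: frac_lin_def mult.commute)
      ultimately have "g \<in> ?C" using 3 g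
        by (intro CollectI bexI[of _ \<alpha>] bexI[of _ \<beta>] conjI) auto
      then show ?thesis by blast
    qed
  qed
  have "R = ?A \<union> ?B \<union> ?C"
  proof (rule equalityI)
    show "R \<subseteq> ?A \<union> ?B \<union> ?C"
    proof
      fix g assume "g \<in> R"
      from D[OF this] show "g \<in> ?A \<union> ?B \<union> ?C" unfolding Un_assoc by (rule UnI2)
    qed
    show "?A \<union> ?B \<union> ?C \<subseteq> R" by (intro Un_least A B C)
  qed
  then show ?thesis unfolding Mor_high[OF assms] R_def .
qed

abbreviation generic :: "complex set" where "generic \<equiv> params - special"

lemma Btilde_group_carrier:
  "carrier Btilde_group = {Btilde_class \<alpha> \<beta> \<gamma> | \<alpha> \<beta> \<gamma>. index_pair \<alpha> \<beta> \<and> \<gamma> \<noteq> 0}"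
  by (simp add: Btilde_group_def)

lemma Btilde_group_rep:
  assumes "g \<in> carrier Btilde_group"
  obtains \<phi> where "\<phi> \<in> homog_auts" "g = scalar_class \<phi>"
  using assms Btilde_homog unfolding Btilde_group_carrier Btilde_class_def by blast

text \<open>
  The matrices form a group because their classes are exactly the classes of automorphisms that
  carry $I_0$ at some generic parameter to $I_0$ at another one; this description is visibly
  closed under composition and inversion. Since $I_0$ determines the parameter, it also shows that
  the action is well defined.
\<close>

lemma Btilde_group_actionE:
  assumes \<phi>: "\<phi> \<in> homog_auts" and c: "scalar_class \<phi> \<in> carrier Btilde_group" and t: "t \<in> generic"
  shows "Btilde_action (scalar_class \<phi>) t \<in> generic"
    and "\<phi> ` Ik 0 t = Ik 0 (Btilde_action (scalar_class \<phi>) t)"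
proof -
  have im: "\<phi> ` Ik 0 t = Ik 0 (frac_lin \<alpha> \<beta> t)"
    if "scalar_class \<phi> = Btilde_class \<alpha> \<beta> \<gamma>" "index_pair \<alpha> \<beta>" "\<gamma> \<noteq> 0" for \<alpha> \<beta> \<gamma>
    using image_Ik_scalar_class[OF Btilde_homog[OF that(2,3)] that(1)[unfolded Btilde_class_def], of 0 t]
      image_Ik_01_Btilde[of t \<alpha> \<beta> \<gamma> 0] t that by (simp add: zero_enat_def)
  obtain \<alpha> \<beta> \<gamma> where B: "scalar_class \<phi> = Btilde_class \<alpha> \<beta> \<gamma>" "index_pair \<alpha> \<beta>" "\<gamma> \<noteq> 0"
    using c unfolding Btilde_group_carrier by blast
  have "Btilde_action (scalar_class \<phi>) t = (THE s. \<exists>\<alpha> \<beta> \<gamma>. index_pair \<alpha> \<beta> \<and> \<gamma> \<noteq> 0 \<and>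
        scalar_class \<phi> = Btilde_class \<alpha> \<beta> \<gamma> \<and> s = frac_lin \<alpha> \<beta> t)"
    using t by (simp add: Btilde_action_def)
  also have "\<dots> = frac_lin \<alpha> \<beta> t"
  proof (rule the_equality)
    show "\<exists>\<alpha>' \<beta>' \<gamma>'. index_pair \<alpha>' \<beta>' \<and> \<gamma>' \<noteq> 0 \<and>
        scalar_class \<phi> = Btilde_class \<alpha>' \<beta>' \<gamma>' \<and> frac_lin \<alpha> \<beta> t = frac_lin \<alpha>' \<beta>' t"
      using B by blast
    fix s assume "\<exists>\<alpha>' \<beta>' \<gamma>'. index_pair \<alpha>' \<beta>' \<and> \<gamma>' \<noteq> 0 \<and>
        scalar_class \<phi> = Btilde_class \<alpha>' \<beta>' \<gamma>' \<and> s = frac_lin \<alpha>' \<beta>' t"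
    then obtain \<alpha>' \<beta>' \<gamma>' where "index_pair \<alpha>' \<beta>'" "\<gamma>' \<noteq> 0"
      "scalar_class \<phi> = Btilde_class \<alpha>' \<beta>' \<gamma>'" "s = frac_lin \<alpha>' \<beta>' t" by blast
    then show "s = frac_lin \<alpha> \<beta> t" using im[of \<alpha>' \<beta>' \<gamma>'] im[OF B] by (intro Ik_0_inj) simp
  qed
  finally show "Btilde_action (scalar_class \<phi>) t \<in> generic"
    "\<phi> ` Ik 0 t = Ik 0 (Btilde_action (scalar_class \<phi>) t)"
    using im[OF B] frac_lin_params[of t \<alpha> \<beta>] B(2) t by auto
qed

lemma Btilde_action_eqI:
  assumes "\<phi> \<in> homog_auts" "scalar_class \<phi> \<in> carrier Btilde_group" "t \<in> generic"
    and "\<phi> ` Ik 0 t = Ik 0 s"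
  shows "Btilde_action (scalar_class \<phi>) t = s"
  using Btilde_group_actionE(2)[OF assms(1-3)] assms(4) by (intro Ik_0_inj) simp

lemma Btilde_group_memI:
  assumes "\<phi> \<in> homog_auts" "t \<in> params" "s \<notin> special" "\<phi> ` Ik 0 t = Ik 0 s"
  shows "scalar_class \<phi> \<in> carrier Btilde_group"
proof -
  obtain \<alpha> \<beta> \<gamma> where "index_pair \<alpha> \<beta>" "\<gamma> \<noteq> 0" "scalar_class \<phi> = Btilde_class \<alpha> \<beta> \<gamma>"
    by (rule low_classify[of \<phi> 0 t s]) (use assms in \<open>auto simp: zero_enat_def\<close>)
  then show ?thesis unfolding Btilde_group_carrier by blast
qed

lemma generic_1: "1 \<in> generic"
  by (simp add: params_def special_def)

lemma image_inv_homog: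
  assumes "\<phi> \<in> homog_auts" "\<phi> ` I = J"
  shows "inv_into UNIV \<phi> ` J = I"
  using assms homog_autsD(4)[OF assms(1)] by (auto simp: image_inv_f_f)

lemma Btilde_group_comp:
  assumes "\<phi> \<in> homog_auts" "\<psi> \<in> homog_auts"
    and "scalar_class \<phi> \<in> carrier Btilde_group" "scalar_class \<psi> \<in> carrier Btilde_group" and t: "t \<in> generic"
  shows "(\<phi> \<circ> \<psi>) ` Ik 0 t = Ik 0 (Btilde_action (scalar_class \<phi>) (Btilde_action (scalar_class \<psi>) t))"
    and "scalar_class (\<phi> \<circ> \<psi>) \<in> carrier Btilde_group"
proof -
  note \<psi>t = Btilde_group_actionE[OF assms(2,4) t]
  note \<phi>t = Btilde_group_actionE[OF assms(1,3) \<psi>t(1)]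
  show im: "(\<phi> \<circ> \<psi>) ` Ik 0 t = Ik 0 (Btilde_action (scalar_class \<phi>) (Btilde_action (scalar_class \<psi>) t))"
    by (simp only: image_comp[symmetric] \<psi>t(2) \<phi>t(2))
  show "scalar_class (\<phi> \<circ> \<psi>) \<in> carrier Btilde_group"
    using Btilde_group_memI[OF homog_auts_comp[OF assms(1,2)] _ _ im] t \<phi>t(1) by auto
qed

lemma Btilde_group_inv:
  assumes "\<phi> \<in> homog_auts" "scalar_class \<phi> \<in> carrier Btilde_group"
  shows "scalar_class (inv_into UNIV \<phi>) \<in> carrier Btilde_group"
proof -
  note a = Btilde_group_actionE[OF assms generic_1]
  show ?thesis
    using Btilde_group_memI[OF homog_auts_inv[OF assms(1)] _ _ image_inv_homog[OF assms(1) a(2)]] a(1) generic_1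
    by auto
qed

lemmas scalar_class_set_mult = scalar_class_mult[unfolded mult_FactGroup]

abbreviation "class_group \<equiv> homog_aut_group Mod scalars"

lemma group_class_group: "group class_group"
  by (rule normal.factorgroup_is_group[OF scalars_normal])

lemma one_class_group: "\<one>\<^bsub>class_group\<^esub> = scalar_class id"
proof -
  have "scalars = scalar_class id"
    using scaling_1 by (auto simp: scalar_class_iff scalars_def)
  then show ?thesis by (simp add: FactGroup_def)
qed

lemma Btilde_subgroup: "subgroup (carrier Btilde_group) class_group"
proof (rule group.subgroupI[OF group_class_group])
  show "carrier Btilde_group \<subseteq> carrier class_group"
    unfolding scalar_class_carrier using Btilde_group_rep by blast
  have "Btilde_class 1 0 1 \<in> carrier Btilde_group"
    unfolding Btilde_group_carrier by (intro CollectI exI[of _ 1] exI[of _ 0]) (simp add: index_pair_def mu4_def)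
  then show "carrier Btilde_group \<noteq> {}" by auto
  fix g assume g: "g \<in> carrier Btilde_group"
  then obtain \<phi> where \<phi>: "\<phi> \<in> homog_auts" "g = scalar_class \<phi>" by (rule Btilde_group_rep)
  have "inv\<^bsub>class_group\<^esub> g = scalar_class (inv_into UNIV \<phi>)"
    using \<phi> homog_auts_inv[OF \<phi>(1)] homog_autsD(4)[OF \<phi>(1)]
    by (intro group.inv_equality[OF group_class_group])
      (auto simp: scalar_class_carrier one_class_group scalar_class_set_mult simp del: one_FactGroup carrier_FactGroup)
  then show "inv\<^bsub>class_group\<^esub> g \<in> carrier Btilde_group"
    using Btilde_group_inv[of \<phi>] \<phi> g by simp
  fix h assume h: "h \<in> carrier Btilde_group"
  then obtain \<psi> where \<psi>: "\<psi> \<in> homog_auts" "h = scalar_class \<psi>" by (rule Btilde_group_rep)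
  show "g \<otimes>\<^bsub>class_group\<^esub> h \<in> carrier Btilde_group"
    using Btilde_group_comp(2)[of \<phi> \<psi>, OF _ _ _ _ generic_1] g h \<phi> \<psi> by (simp add: scalar_class_set_mult)
qed

lemma Btilde_group_eq: "Btilde_group = class_group\<lparr>carrier := carrier Btilde_group\<rparr>"
  by (simp add: Btilde_group_def)

lemma group_Btilde: "group Btilde_group"
  using subgroup.subgroup_is_group[OF Btilde_subgroup group_class_group] unfolding Btilde_group_eq[symmetric] .

lemma Btilde_mult: "g \<otimes>\<^bsub>Btilde_group\<^esub> h = g \<otimes>\<^bsub>class_group\<^esub> h"
  by (simp add: Btilde_group_def)

lemma Btilde_action_Bij:
  assumes "g \<in> carrier Btilde_group"
  shows "Btilde_action g \<in> Bij generic"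
proof -
  obtain \<phi> where \<phi>: "\<phi> \<in> homog_auts" "g = scalar_class \<phi>" by (rule Btilde_group_rep[OF assms])
  let ?\<psi> = "inv_into UNIV \<phi>"
  have \<psi>: "?\<psi> \<in> homog_auts" "scalar_class ?\<psi> \<in> carrier Btilde_group"
    using Btilde_group_inv[of \<phi>] \<phi> assms homog_auts_inv by auto
  have c: "scalar_class \<phi> \<in> carrier Btilde_group" using \<phi> assms by simp
  have "Btilde_action (scalar_class ?\<psi>) (Btilde_action g t) = t" if "t \<in> generic" for t
  proof -
    note a = Btilde_group_actionE[OF \<phi>(1) c that]
    show ?thesis unfolding \<phi>(2)
      using a(1) image_inv_homog[OF \<phi>(1) a(2)] by (intro Btilde_action_eqI \<psi>)
  qed
  moreover have "Btilde_action g (Btilde_action (scalar_class ?\<psi>) t) = t" if "t \<in> generic" for t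
  proof -
    note a = Btilde_group_actionE[OF \<psi> that]
    have "\<phi> ` ?\<psi> ` Ik 0 t = Ik 0 t"
      using bij_is_surj[OF homog_autsD(2)[OF \<phi>(1)]] by (simp add: image_f_inv_f)
    then show ?thesis unfolding \<phi>(2) using a by (intro Btilde_action_eqI \<phi>(1) c) auto
  qed
  moreover have "Btilde_action g \<in> generic \<rightarrow> generic" "Btilde_action (scalar_class ?\<psi>) \<in> generic \<rightarrow> generic"
    using Btilde_group_actionE(1)[OF \<phi>(1) c] Btilde_group_actionE(1)[OF \<psi>] \<phi>(2) by blast+
  ultimately have "bij_betw (Btilde_action g) generic generic"
    by (intro bij_betwI[of _ _ _ "Btilde_action (scalar_class ?\<psi>)"]) auto
  then show ?thesis by (simp add: Bij_def Btilde_action_def)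
qed

lemma group_action_Btilde: "group_action Btilde_group generic Btilde_action"
proof (unfold group_action_def, intro group_hom.intro group_hom_axioms.intro group_Btilde group_BijGroup homI)
  show "Btilde_action g \<in> carrier (BijGroup generic)" if "g \<in> carrier Btilde_group" for g
    using Btilde_action_Bij[OF that] by (simp add: BijGroup_def)
  fix g h assume g: "g \<in> carrier Btilde_group" and h: "h \<in> carrier Btilde_group"
  obtain \<phi> where \<phi>: "\<phi> \<in> homog_auts" "g = scalar_class \<phi>" by (rule Btilde_group_rep[OF g])
  obtain \<psi> where \<psi>: "\<psi> \<in> homog_auts" "h = scalar_class \<psi>" by (rule Btilde_group_rep[OF h])
  have "Btilde_action (scalar_class (\<phi> \<circ> \<psi>)) = compose generic (Btilde_action g) (Btilde_action h)"
  proof (rule extensionalityI[of _ generic])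
    fix t assume t: "t \<in> generic"
    show "Btilde_action (scalar_class (\<phi> \<circ> \<psi>)) t = compose generic (Btilde_action g) (Btilde_action h) t"
      using Btilde_group_comp[OF \<phi>(1) \<psi>(1) _ _ t] g h \<phi> \<psi> t
      by (simp add: compose_eq Btilde_action_eqI homog_auts_comp)
  qed (simp_all add: Btilde_action_def compose_def)
  then show "Btilde_action (g \<otimes>\<^bsub>Btilde_group\<^esub> h) = Btilde_action g \<otimes>\<^bsub>BijGroup generic\<^esub> Btilde_action h"
    using Btilde_action_Bij[OF g] Btilde_action_Bij[OF h] \<phi> \<psi>
    by (simp add: BijGroup_def Btilde_mult scalar_class_set_mult)
qed

lemma restrict_Grp_low:
  assumes k: "k \<in> {0, 1}"
  shows "restrict_groupoid (Grp (enat k)) generic = action_groupoid Btilde_group generic Btilde_action"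
proof -
  have "Mor (Grp (enat k)) t s = {g \<in> carrier Btilde_group. Btilde_action g t = s}"
    if t: "t \<in> generic" and s: "s \<in> generic" for t s
  proof -
    have a: "Btilde_action (Btilde_class \<alpha> \<beta> \<gamma>) t = frac_lin \<alpha> \<beta> t" if "index_pair \<alpha> \<beta>" "\<gamma> \<noteq> 0" for \<alpha> \<beta> \<gamma>
      unfolding Btilde_class_def
      by (rule Btilde_action_eqI[OF Btilde_homog[OF that] _ t])
        (use that t image_Ik_01_Btilde[of t \<alpha> \<beta> \<gamma> 0] in
          \<open>auto simp: Btilde_group_carrier Btilde_class_def[symmetric] zero_enat_def\<close>)
    have t': "t \<in> params" using t by simp
    show ?thesis
      unfolding Mor_low[OF k t' s] Btilde_group_carrier using a by blast
  qed
  then have "(\<lambda>t s. if t \<in> generic \<and> s \<in> generic then Mor (Grp (enat k)) t s else {}) =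
    (\<lambda>t s. {g \<in> carrier Btilde_group. t \<in> generic \<and> s \<in> generic \<and> Btilde_action g t = s})"
    by (intro ext) auto
  moreover have "Obj (Grp (enat k)) = params" "Comp (Grp (enat k)) = monoid.mult Btilde_group"
    by (simp_all add: Grp_def Btilde_group_def)
  ultimately show ?thesis
    unfolding restrict_groupoid_def action_groupoid_def by auto
qed

section \<open>The ideal of the first Yau algebra\<close>

lemma ord_ge_decompose:
  assumes "ord_ge (Suc n) f"
  obtains f1 f2 f3 where "f = varX * f1 + varY * f2 + varZ * f3" "ord_ge n f1" "ord_ge n f2" "ord_ge n f3"
proof
  let ?f1 = "Abs3 (\<lambda>i j k. if j = 0 \<and> k = 0 then coeff3 f (Suc i) 0 0 else 0)"
  let ?f2 = "Abs3 (\<lambda>i j k. if k = 0 then coeff3 f i (Suc j) 0 else 0)"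
  let ?f3 = "Abs3 (\<lambda>i j k. coeff3 f i j (Suc k))"
  show "f = varX * ?f1 + varY * ?f2 + varZ * ?f3"
    using assms by (intro cps_eqI) (auto simp: ord_ge_def)
  show "ord_ge n ?f1" "ord_ge n ?f2" "ord_ge n ?f3"
    using assms by (auto simp: ord_ge_def)
qed

lemma jac_combinations:
  fixes x y t c :: "'a::idom"
  shows "(16 - 4 * t\<^sup>2) * (x ^ 3 * y) =
      4 * (y * (4 * x ^ 3 + 2 * t * (x * y\<^sup>2))) - 2 * t * (x * (4 * y ^ 3 + 2 * t * (x\<^sup>2 * y)))"
    and "(16 - 4 * t\<^sup>2) * (x * y ^ 3) =
      4 * (x * (4 * y ^ 3 + 2 * t * (x\<^sup>2 * y))) - 2 * t * (y * (4 * x ^ 3 + 2 * t * (x * y\<^sup>2)))"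
    and "2 * (2 * x ^ 4 + t * (x\<^sup>2 * y\<^sup>2)) = x * (4 * x ^ 3 + 2 * t * (x * y\<^sup>2))"
    and "2 * (2 * y ^ 4 + t * (x\<^sup>2 * y\<^sup>2)) = y * (4 * y ^ 3 + 2 * t * (x\<^sup>2 * y))"
    and "c * x ^ 5 = x * (c * x ^ 4 + t * (x\<^sup>2 * y\<^sup>2)) - t * (x ^ 3 * y\<^sup>2)"
    and "c * y ^ 5 = y * (c * y ^ 4 + t * (x\<^sup>2 * y\<^sup>2)) - t * (x\<^sup>2 * y ^ 3)"
  by Groebner_Basis.algebra+

context
  fixes t :: complex
  assumes t: "t \<in> params"
begin

lemma Ik1_prod: "coeff3 v 0 0 0 = 0 \<Longrightarrow> w \<in> jac t \<Longrightarrow> v * w \<in> Ik 1 t"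
proof -
  assume v: "coeff3 v 0 0 0 = 0" and w: "w \<in> jac t"
  have "v * 1 \<in> max_ideal \<cdot>\<^bsub>\<O>\<^esub> UNIV"
    using v by (intro ideal_prod_O_I) (simp_all add: max_ideal_iff)
  then show ?thesis using prod_in_Ik[of v 1 w t] w by (simp add: one_enat_def)
qed

lemma ideal_Ik1: "ideal (Ik 1 t) \<O>"
  by (rule ideal_Ik)

lemma cst_cancel_Ik1: "cst c * f \<in> Ik 1 t \<Longrightarrow> c \<noteq> 0 \<Longrightarrow> f \<in> Ik 1 t"
  using ideal_O_D(3)[OF ideal_Ik1, of "cst c * f" "cst (1 / c)"]
  by (simp add: mult.assoc[symmetric] cst_mult[symmetric])

lemma cst_cancel_eq: "cst c * f = g \<Longrightarrow> g \<in> Ik 1 t \<Longrightarrow> c \<noteq> 0 \<Longrightarrow> f \<in> Ik 1 t"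
  using cst_cancel_Ik1 by blast

lemma Z_in_jac: "varZ \<in> jac t"
  using ideal_O_D(3)[OF ideal_jac deriv_in_jac(3), of "cst (1/2)" t]
  by (simp add: deriv_fam mult.assoc[symmetric] cst_mult[symmetric])

lemma mult_Z_Ik1: "coeff3 v 0 0 0 = 0 \<Longrightarrow> v * varZ \<in> Ik 1 t"
  by (rule Ik1_prod[OF _ Z_in_jac])

text \<open>
  The products of $x, y$ with $\partial_xf_t, \partial_yf_t$ span a space of quartics of dimension
  four exactly if \<open>t\<^sup>2 \<noteq> 4\<close>; the factor
  \<open>16 - 4 * t\<^sup>2\<close> is the determinant of the elimination of $x^3y$ and $xy^3$.
\<close>

lemma quartics_Ik1:
  "varX ^ 3 * varY \<in> Ik 1 t" "varX * varY ^ 3 \<in> Ik 1 t"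
  "cst 2 * varX ^ 4 + cst t * (varX\<^sup>2 * varY\<^sup>2) \<in> Ik 1 t"
  "cst 2 * varY ^ 4 + cst t * (varX\<^sup>2 * varY\<^sup>2) \<in> Ik 1 t"
proof -
  have p: "varX * dx (fam t) \<in> Ik 1 t" "varY * dx (fam t) \<in> Ik 1 t"
    "varX * dy (fam t) \<in> Ik 1 t" "varY * dy (fam t) \<in> Ik 1 t"
    by (intro Ik1_prod deriv_in_jac; simp add: coeff3_var)+
  have 16: "16 - 4 * t\<^sup>2 \<noteq> 0" using t by (auto simp: params_def)
  have "cst (16 - 4 * t\<^sup>2) * (varX ^ 3 * varY) =
      cst 4 * (varY * dx (fam t)) - cst (2 * t) * (varX * dy (fam t))"
    unfolding deriv_fam cst_hom by (rule jac_combinations(1))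
  also have "\<dots> \<in> Ik 1 t" by (intro ideal_O_D(3,6)[OF ideal_Ik1] p)
  finally show "varX ^ 3 * varY \<in> Ik 1 t" using 16 by (rule cst_cancel_Ik1)
  have "cst (16 - 4 * t\<^sup>2) * (varX * varY ^ 3) =
      cst 4 * (varX * dy (fam t)) - cst (2 * t) * (varY * dx (fam t))"
    unfolding deriv_fam cst_hom by (rule jac_combinations(2))
  also have "\<dots> \<in> Ik 1 t" by (intro ideal_O_D(3,6)[OF ideal_Ik1] p)
  finally show "varX * varY ^ 3 \<in> Ik 1 t" using 16 by (rule cst_cancel_Ik1)
  have "cst 2 * (cst 2 * varX ^ 4 + cst t * (varX\<^sup>2 * varY\<^sup>2)) = varX * dx (fam t)"
    unfolding deriv_fam cst_hom by (rule jac_combinations(3))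
  then show "cst 2 * varX ^ 4 + cst t * (varX\<^sup>2 * varY\<^sup>2) \<in> Ik 1 t"
    by (rule cst_cancel_eq[OF _ p(1)]) simp
  have "cst 2 * (cst 2 * varY ^ 4 + cst t * (varX\<^sup>2 * varY\<^sup>2)) = varY * dy (fam t)"
    unfolding deriv_fam cst_hom by (rule jac_combinations(4))
  then show "cst 2 * varY ^ 4 + cst t * (varX\<^sup>2 * varY\<^sup>2) \<in> Ik 1 t"
    by (rule cst_cancel_eq[OF _ p(4)]) simp
qed

lemma quintics_Ik1:
  assumes "a + b = 5"
  shows "varX ^ a * varY ^ b \<in> Ik 1 t"
proof -
  note I = ideal_O_D[OF ideal_Ik1]
  have mid: "varX ^ 4 * varY \<in> Ik 1 t" "varX ^ 3 * varY\<^sup>2 \<in> Ik 1 t" "varX\<^sup>2 * varY ^ 3 \<in> Ik 1 t" "varX * varY ^ 4 \<in> Ik 1 t"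
    using I(3)[OF quartics_Ik1(1), of varX] I(3)[OF quartics_Ik1(1), of varY]
      I(3)[OF quartics_Ik1(2), of varX] I(3)[OF quartics_Ik1(2), of varY]
    by (simp_all add: eval_nat_numeral ac_simps)
  have "cst 2 * varX ^ 5 = varX * (cst 2 * varX ^ 4 + cst t * (varX\<^sup>2 * varY\<^sup>2)) - cst t * (varX ^ 3 * varY\<^sup>2)"
    by (rule jac_combinations(5))
  also have "\<dots> \<in> Ik 1 t" by (intro I(3,6) quartics_Ik1 mid)
  finally have x5: "varX ^ 5 \<in> Ik 1 t" by (rule cst_cancel_Ik1) simp
  have "cst 2 * varY ^ 5 = varY * (cst 2 * varY ^ 4 + cst t * (varX\<^sup>2 * varY\<^sup>2)) - cst t * (varX\<^sup>2 * varY ^ 3)"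
    by (rule jac_combinations(6))
  also have "\<dots> \<in> Ik 1 t" by (intro I(3,6) quartics_Ik1 mid)
  finally have y5: "varY ^ 5 \<in> Ik 1 t" by (rule cst_cancel_Ik1) simp
  from assms consider "a = 0" "b = 5" | "a = 1" "b = 4" | "a = 2" "b = 3" | "a = 3" "b = 2" | "a = 4" "b = 1" | "a = 5" "b = 0"
    by linarith
  then show ?thesis by cases (use mid x5 y5 in simp_all)
qed

text \<open>
  Modulo the ideal, multiples of $z$ by non-units vanish, the partial derivatives express every quartic monomial by
  $x^2y^2$, and the monomials of degree five vanish.
\<close>

lemma order_four_Ik1:
  assumes "a + b + n = 4" "ord_ge n g"
  shows "\<exists>c. varX ^ a * varY ^ b * g - cst c * (varX\<^sup>2 * varY\<^sup>2) \<in> Ik 1 t"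
  using assms
proof (induction n arbitrary: a b g)
  case 0
  note I = ideal_O_D[OF ideal_Ik1]
  let ?m = "varX ^ a * varY ^ b" and ?h = "varX\<^sup>2 * varY\<^sup>2"
  have ab: "a + b = 4" using 0 by simp
  have "\<exists>c. ?m - cst c * ?h \<in> Ik 1 t"
  proof -
    from ab consider "a = 0" "b = 4" | "a = 1" "b = 3" | "a = 2" "b = 2" | "a = 3" "b = 1" | "a = 4" "b = 0"
      by linarith
    then show ?thesis
    proof cases
      case 1
      have "cst 2 * (varY ^ 4 - cst (- t / 2) * ?h) = cst 2 * varY ^ 4 + cst t * ?h"
        by (simp add: cst_hom[symmetric] mult.assoc[symmetric] right_diff_distrib) (simp add: cst_hom mult.assoc)
      then have "varY ^ 4 - cst (- t / 2) * ?h \<in> Ik 1 t"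
        by (rule cst_cancel_eq[OF _ quartics_Ik1(4)]) simp
      then show ?thesis using 1 by auto
    next
      case 2
      then show ?thesis using quartics_Ik1(2) by (intro exI[of _ 0]) simp
    next
      case 3
      then show ?thesis using I(1) by (intro exI[of _ 1]) simp
    next
      case 4
      then show ?thesis using quartics_Ik1(1) by (intro exI[of _ 0]) simp
    next
      case 5
      have "cst 2 * (varX ^ 4 - cst (- t / 2) * ?h) = cst 2 * varX ^ 4 + cst t * ?h"
        by (simp add: cst_hom[symmetric] mult.assoc[symmetric] right_diff_distrib) (simp add: cst_hom mult.assoc)
      then have "varX ^ 4 - cst (- t / 2) * ?h \<in> Ik 1 t"
        by (rule cst_cancel_eq[OF _ quartics_Ik1(3)]) simp
      then show ?thesis using 5 by auto
    qed
  qed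
  then obtain c where c: "?m - cst c * ?h \<in> Ik 1 t" by blast
  obtain g1 g2 g3 where g: "g = cst (coeff3 g 0 0 0) + varX * g1 + varY * g2 + varZ * g3"
    by (rule decompose)
  define e where "e = coeff3 g 0 0 0"
  have m0: "coeff3 ?m 0 0 0 = 0"
    using ab coeff3_monomial[of a b 0 0 0 0] by auto
  have "varX ^ a * varY ^ b * g - cst (e * c) * ?h = cst e * (?m - cst c * ?h) +
      (varX ^ Suc a * varY ^ b) * g1 + (varX ^ a * varY ^ Suc b) * g2 + (?m * varZ) * g3"
    by (subst g) (simp add: e_def[symmetric] cst_mult algebra_simps)
  also have "\<dots> \<in> Ik 1 t"
    using ab by (intro I(2) I(3)[of "?m - cst c * ?h"] I(4) c quintics_Ik1 mult_Z_Ik1 m0) simp_all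
  finally show ?case by blast
next
  case (Suc n)
  note I = ideal_O_D[OF ideal_Ik1]
  let ?m = "varX ^ a * varY ^ b" and ?h = "varX\<^sup>2 * varY\<^sup>2"
  obtain g1 g2 g3 where g: "g = varX * g1 + varY * g2 + varZ * g3" "ord_ge n g1" "ord_ge n g2" "ord_ge n g3"
    by (rule ord_ge_decompose[OF Suc.prems(2)])
  obtain c1 where c1: "varX ^ Suc a * varY ^ b * g1 - cst c1 * ?h \<in> Ik 1 t"
    using Suc.IH[of "Suc a" b g1] Suc.prems(1) g by auto
  obtain c2 where c2: "varX ^ a * varY ^ Suc b * g2 - cst c2 * ?h \<in> Ik 1 t"
    using Suc.IH[of a "Suc b" g2] Suc.prems(1) g by auto
  have z: "coeff3 (?m * g3) 0 0 0 = 0"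
  proof (cases n)
    case 0
    then show ?thesis using Suc.prems(1) coeff3_monomial[of a b 0 0 0 0] by (auto simp: coeff3_mult)
  next
    case (Suc m)
    then show ?thesis using g(4) by (simp add: coeff3_mult ord_ge_def)
  qed
  have "?m * g - cst (c1 + c2) * ?h = (varX ^ Suc a * varY ^ b * g1 - cst c1 * ?h) +
      (varX ^ a * varY ^ Suc b * g2 - cst c2 * ?h) + (?m * g3) * varZ"
    by (simp add: g(1) cst_add algebra_simps)
  also have "\<dots> \<in> Ik 1 t" by (intro I(2) c1 c2 mult_Z_Ik1 z)
  finally show ?case by blast
qed

text \<open>
  An element of \<open>bound1\<close> is congruent to some $cx^2y^2$ modulo the ideal, and the
  functional takes the value $-2c$ there, so $c = 0$.
\<close>

lemma Ik1_eq: "Ik 1 t = bound1 t"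
proof
  show sub: "Ik 1 t \<subseteq> bound1 t" using Ik_1_bound[of t] by (simp add: one_enat_def)
  note I = ideal_O_D[OF ideal_Ik1] and B = ideal_O_D[OF ideal_bound1]
  show "bound1 t \<subseteq> Ik 1 t"
  proof
    fix f assume f: "f \<in> bound1 t"
    define f3 where "f3 = Abs3 (\<lambda>i j k. coeff3 f i j (Suc k))"
    define p where "p = f - f3 * varZ"
    have f3: "f3 * varZ \<in> Ik 1 t"
      using f by (intro mult_Z_Ik1) (simp add: f3_def bound1_def)
    have p: "p \<in> bound1 t" unfolding p_def using f f3 sub by (intro B(6)) auto
    have pk: "coeff3 p i j (Suc k) = 0" for i j k
      by (simp add: p_def f3_def mult.commute[of _ varZ])
    have "ord_ge 4 p"
      unfolding ord_ge_def
    proof (intro allI impI)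
      fix i j k :: nat assume *: "i + j + k < 4"
      show "coeff3 p i j k = 0"
      proof (cases k)
        case 0
        have i: "i = 0 \<or> i = 1 \<or> i = 2 \<or> i = 3" and j: "j = 0 \<or> j = 1 \<or> j = 2 \<or> j = 3"
          using * by arith+
        from i j * show ?thesis
          using p 0 by (elim disjE) (simp_all add: bound1_def)
      qed (simp add: pk)
    qed
    then obtain c where c: "p - cst c * (varX\<^sup>2 * varY\<^sup>2) \<in> Ik 1 t"
      using order_four_Ik1[of 0 0 4 p] by auto
    then have "p - cst c * (varX\<^sup>2 * varY\<^sup>2) \<in> bound1 t" using sub by blast
    with p have "t * coeff3 p 4 0 0 - (2 * coeff3 p 2 2 0 - 2 * c) + t * coeff3 p 0 4 0 = 0"
      "apolar t p = 0"
      by (simp_all add: bound1_def coeff3_eval)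
    then have "2 * c = 0" by Groebner_Basis.algebra
    then have "c = 0" by simp
    then have "p \<in> Ik 1 t" using c by simp
    then have "p + f3 * varZ \<in> Ik 1 t" using f3 by (rule I(2))
    then show "f \<in> Ik 1 t" by (simp add: p_def)
  qed
qed

end

section \<open>Derivations of the quotient\<close>

definition vfield :: "cps \<Rightarrow> cps \<Rightarrow> cps \<Rightarrow> cps \<Rightarrow> cps" where
  "vfield \<xi> \<eta> \<zeta> f = \<xi> * dx f + \<eta> * dy f + \<zeta> * dz f"

lemma vfield_var: "vfield \<xi> \<eta> \<zeta> varX = \<xi>" "vfield \<xi> \<eta> \<zeta> varY = \<eta>" "vfield \<xi> \<eta> \<zeta> varZ = \<zeta>"
  and vfield_cst: "vfield \<xi> \<eta> \<zeta> (cst c) = 0"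
  and vfield_add: "vfield \<xi> \<eta> \<zeta> (f + g) = vfield \<xi> \<eta> \<zeta> f + vfield \<xi> \<eta> \<zeta> g"
  and vfield_diff: "vfield \<xi> \<eta> \<zeta> (f - g) = vfield \<xi> \<eta> \<zeta> f - vfield \<xi> \<eta> \<zeta> g"
  and vfield_mult: "vfield \<xi> \<eta> \<zeta> (f * g) = vfield \<xi> \<eta> \<zeta> f * g + f * vfield \<xi> \<eta> \<zeta> g"
  by (simp_all add: vfield_def deriv_simps algebra_simps)

lemma vfield_commutator:
  "vfield a b c (vfield a' b' c' f) - vfield a' b' c' (vfield a b c f) =
   vfield (vfield a b c a' - vfield a' b' c' a) (vfield a b c b' - vfield a' b' c' b)
     (vfield a b c c' - vfield a' b' c' c) f"
proof -
  have comm: "dy (dx f) = dx (dy f)" "dz (dx f) = dx (dz f)" "dz (dy f) = dy (dz f)"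
    by (rule cps_eqI; simp add: algebra_simps)+
  show ?thesis
    by (simp add: vfield_def deriv_simps comm algebra_simps)
qed

abbreviation proj :: "complex \<Rightarrow> cps \<Rightarrow> cps set" where
  "proj t f \<equiv> Ik 1 t +>\<^bsub>\<O>\<^esub> f"

lemma proj_eq_iff: "proj t f = proj t g \<longleftrightarrow> f - g \<in> Ik 1 t"
  using ring.quotient_eq_iff_same_a_r_cos[OF ring_O ideal_Ik[of 1 t], of f g] by auto

lemma Alg_carrier: "carrier (Alg 1 t) = range (proj t)"
proof -
  have "carrier (Alg 1 t) = a_rcosets\<^bsub>\<O>\<^esub> (Ik 1 t)" by (simp add: Alg_def FactRing_def)
  also have "\<dots> = range (proj t)" by (auto simp: A_RCOSETS_def')
  finally show ?thesis .
qed

lemma proj_add: "proj t f \<oplus>\<^bsub>Alg 1 t\<^esub> proj t g = proj t (f + g)"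
  using ring_hom_add[OF ideal.rcos_ring_hom[OF ideal_Ik[of 1 t]], of f g] by (simp add: Alg_def)

lemma proj_mult: "proj t f \<otimes>\<^bsub>Alg 1 t\<^esub> proj t g = proj t (f * g)"
  using ring_hom_mult[OF ideal.rcos_ring_hom[OF ideal_Ik[of 1 t]], of f g] by (simp add: Alg_def)

lemma ring_Alg: "ring (Alg 1 t)"
  unfolding Alg_def by (rule ideal.quotient_is_ring[OF ideal_Ik])

lemma proj_diff: "proj t f \<ominus>\<^bsub>Alg 1 t\<^esub> proj t g = proj t (f - g)"
proof -
  interpret ring "Alg 1 t" by (rule ring_Alg)
  have c: "proj t h \<in> carrier (Alg 1 t)" for h by (simp add: Alg_carrier)
  have "proj t (f - g) \<oplus>\<^bsub>Alg 1 t\<^esub> proj t g = proj t f" by (simp add: proj_add)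
  then have "proj t f \<ominus>\<^bsub>Alg 1 t\<^esub> proj t g = (proj t (f - g) \<oplus>\<^bsub>Alg 1 t\<^esub> proj t g) \<ominus>\<^bsub>Alg 1 t\<^esub> proj t g"
    by simp
  also have "\<dots> = proj t (f - g)" using c by (simp add: minus_eq a_assoc r_neg)
  finally show ?thesis .
qed

text \<open>
  The choice of a representative is immaterial for vector fields that preserve the ideal.
\<close>

definition coset_deriv :: "complex \<Rightarrow> cps \<Rightarrow> cps \<Rightarrow> cps \<Rightarrow> cps set \<Rightarrow> cps set" where
  "coset_deriv t \<xi> \<eta> \<zeta> = (\<lambda>a \<in> carrier (Alg 1 t). proj t (vfield \<xi> \<eta> \<zeta> (SOME f. a = proj t f)))"

lemma coset_deriv_proj:
  assumes "\<And>f. f \<in> Ik 1 t \<Longrightarrow> vfield \<xi> \<eta> \<zeta> f \<in> Ik 1 t"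
  shows "coset_deriv t \<xi> \<eta> \<zeta> (proj t f) = proj t (vfield \<xi> \<eta> \<zeta> f)"
proof -
  define g where "g = (SOME g. proj t f = proj t g)"
  have "proj t f = proj t g" unfolding g_def by (rule someI[of _ f]) simp
  then have "vfield \<xi> \<eta> \<zeta> g - vfield \<xi> \<eta> \<zeta> f \<in> Ik 1 t"
    using assms[of "g - f"] by (simp add: vfield_diff proj_eq_iff[of t g f, symmetric])
  then have *: "proj t (vfield \<xi> \<eta> \<zeta> g) = proj t (vfield \<xi> \<eta> \<zeta> f)" by (simp add: proj_eq_iff)
  have "coset_deriv t \<xi> \<eta> \<zeta> (proj t f) = proj t (vfield \<xi> \<eta> \<zeta> (SOME g. proj t f = proj t g))"
    by (simp add: coset_deriv_def Alg_carrier)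
  then show ?thesis unfolding g_def[symmetric] * .
qed

lemma coset_deriv_derivation:
  assumes "\<And>f. f \<in> Ik 1 t \<Longrightarrow> vfield \<xi> \<eta> \<zeta> f \<in> Ik 1 t"
  shows "coset_deriv t \<xi> \<eta> \<zeta> \<in> lie_carrier (Yau_algebra 1 t)"
proof -
  have "coset_deriv t \<xi> \<eta> \<zeta> \<in> carrier (Alg 1 t) \<rightarrow>\<^sub>E carrier (Alg 1 t)"
    by (auto simp: coset_deriv_def Alg_carrier)
  then show ?thesis
    by (auto simp: Yau_algebra_def Der_def derivations_def Alg_carrier proj_add proj_mult
        coset_deriv_proj[OF assms] vfield_add vfield_mult vfield_cst)
qed

text \<open>
  A derivation of the quotient is induced by the vector field formed from any lifts of its values
  on the variables: the difference kills the generators, so its values lie in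
  arbitrarily high powers of the maximal ideal, which vanish in the quotient.
\<close>

lemma derivation_lift:
  assumes t: "t \<in> params" and D: "D \<in> lie_carrier (Yau_algebra 1 t)"
    and X: "D (proj t varX) = proj t \<xi>" and Y: "D (proj t varY) = proj t \<eta>" and Z: "D (proj t varZ) = proj t \<zeta>"
  shows "D (proj t f) = proj t (vfield \<xi> \<eta> \<zeta> f)"
proof -
  let ?I = "Ik 1 t"
  note I = ideal_O_D[OF ideal_Ik[of 1 t]]
  have Dc: "D (proj t f) \<in> range (proj t)" for f
    using D by (auto simp: Yau_algebra_def Der_def derivations_def Alg_carrier)
  have Dadd: "D (proj t (f + g)) = D (proj t f) \<oplus>\<^bsub>Alg 1 t\<^esub> D (proj t g)" for f g
    using D by (auto simp: Yau_algebra_def Der_def derivations_def Alg_carrier proj_add[symmetric])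
  have Dmult: "D (proj t (f * g)) = (D (proj t f) \<otimes>\<^bsub>Alg 1 t\<^esub> proj t g) \<oplus>\<^bsub>Alg 1 t\<^esub> (proj t f \<otimes>\<^bsub>Alg 1 t\<^esub> D (proj t g))" for f g
    using D by (auto simp: Yau_algebra_def Der_def derivations_def Alg_carrier proj_mult[symmetric])
  have Dcst: "D (proj t (cst c * f)) = proj t (cst c) \<otimes>\<^bsub>Alg 1 t\<^esub> D (proj t f)" for c f
    using D by (auto simp: Yau_algebra_def Der_def derivations_def Alg_carrier proj_mult[symmetric])
  define r where "r f = (SOME h. D (proj t f) = proj t h)" for f
  have r: "D (proj t f) = proj t (r f)" for f
    unfolding r_def using Dc[of f] by (metis (mono_tags, lifting) rangeE someI_ex)
  have radd: "r (f + g) - (r f + r g) \<in> ?I" for f g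
    using Dadd[of f g] by (simp add: r proj_add proj_eq_iff)
  have rmult: "r (f * g) - (r f * g + f * r g) \<in> ?I" for f g
    using Dmult[of f g] by (simp add: r proj_add proj_mult proj_eq_iff)
  have rcst: "r (cst c) \<in> ?I" for c
  proof -
    have "r 1 - (r 1 + r 1) \<in> ?I" using rmult[of 1 1] by simp
    from I(5)[OF this] have "r 1 \<in> ?I" by simp
    moreover have "r (cst c * 1) - cst c * r 1 \<in> ?I"
      using Dcst[of c 1] by (simp only: r proj_mult proj_eq_iff)
    ultimately have "(r (cst c * 1) - cst c * r 1) + cst c * r 1 \<in> ?I" by (intro I(2,3))
    then show ?thesis by simp
  qed
  define e where "e f = r f - vfield \<xi> \<eta> \<zeta> f" for f
  have eadd: "e (f + g) - (e f + e g) \<in> ?I" for f g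
    using radd[of f g] by (simp add: e_def vfield_add algebra_simps)
  have emult: "e (f * g) - (e f * g + f * e g) \<in> ?I" for f g
    using rmult[of f g] by (simp add: e_def vfield_mult algebra_simps)
  have evar: "e varX \<in> ?I" "e varY \<in> ?I" "e varZ \<in> ?I"
    using X Y Z by (simp_all add: e_def r proj_eq_iff vfield_var)
  have ecst: "e (cst c) \<in> ?I" for c
    using rcst by (simp add: e_def vfield_cst)
  have evm: "e (v * f) - v * e f \<in> ?I" if "e v \<in> ?I" for v f
  proof -
    have "(e (v * f) - (e v * f + v * e f)) + e v * f \<in> ?I"
      using emult that by (intro I(2,4))
    then show ?thesis by (simp add: algebra_simps)
  qed
  have high: "\<exists>h. ord_ge n h \<and> e f - h \<in> ?I" for n f
  proof (induction n arbitrary: f)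
    case 0
    then show ?case using I(1) by (intro exI[of _ "e f"]) simp
  next
    case (Suc n)
    obtain f1 f2 f3 where f: "f = cst (coeff3 f 0 0 0) + varX * f1 + varY * f2 + varZ * f3"
      by (rule decompose)
    define c where "c = coeff3 f 0 0 0"
    obtain h1 h2 h3 where h: "ord_ge n h1" "e f1 - h1 \<in> ?I" "ord_ge n h2" "e f2 - h2 \<in> ?I" "ord_ge n h3" "e f3 - h3 \<in> ?I"
      using Suc.IH by metis
    let ?h = "varX * h1 + varY * h2 + varZ * h3"
    have "e f - ?h =
        (e (cst c + varX * f1 + varY * f2 + varZ * f3) - (e (cst c + varX * f1 + varY * f2) + e (varZ * f3)))
      + (e (cst c + varX * f1 + varY * f2) - (e (cst c + varX * f1) + e (varY * f2)))
      + (e (cst c + varX * f1) - (e (cst c) + e (varX * f1))) + e (cst c)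
      + (e (varX * f1) - varX * e f1) + (e (varY * f2) - varY * e f2) + (e (varZ * f3) - varZ * e f3)
      + varX * (e f1 - h1) + varY * (e f2 - h2) + varZ * (e f3 - h3)"
      by (subst f) (simp add: c_def algebra_simps)
    also have "\<dots> \<in> ?I"
      by (intro I(2) I(3)[of "e f1 - h1"] I(3)[of "e f2 - h2"] I(3)[of "e f3 - h3"] eadd evm evar ecst h)
    finally have "e f - ?h \<in> ?I" .
    moreover have "ord_ge (1 + n) ?h"
      by (intro ord_ge_add ord_ge_mult ord_ge_var h)
    ultimately show ?case by auto
  qed
  obtain h where h: "ord_ge 5 h" "e f - h \<in> ?I" using high by blast
  have "h \<in> bound1 t" using h(1) by (simp add: bound1_def ord_ge_def)
  then have "h \<in> ?I" by (simp add: Ik1_eq[OF t])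
  then have "(e f - h) + h \<in> ?I" using h(2) by (intro I(2))
  then show ?thesis by (simp add: r proj_eq_iff e_def)
qed

section \<open>An explicit model of the first Yau algebra\<close>

text \<open>
  Normal forms of the vector fields that represent the derivations. Put $h = -x^2y^2/2$, a
  generator of the part of degree four of the quotient, normalized such that the functional
  \<open>apolar t\<close> takes the value 1 on it. The 23 fields are, in this order, the
  coefficients of: the Euler field $x\partial_x+y\partial_y$; $z\partial_z$; $z\partial_x$ and
  $z\partial_y$; $x^2, xy, y^2$ times $\partial_x$, then times $\partial_y$;
  $x^3, x^2y, xy^2, y^3$ times $\partial_x$, then times $\partial_y$; $h\partial_x$ and
  $h\partial_y$; the half partial derivatives $2x^3+txy^2$ and $2y^3+tx^2y$ of the equation times
  $\partial_z$; $h\partial_z$.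
\<close>

datatype cvf = CVF complex complex complex complex complex complex complex complex complex complex complex complex complex complex complex complex complex complex complex complex complex complex complex

text \<open>
  A series with no constant term and no other coefficients than those at $z$; $x, y$;
  $x^2, xy, y^2$; the four cubic monomials; and $x^2y^2$, in this order. The last one is measured
  by the functional \<open>apolar\<close>, whence the factor $-1/2$.
\<close>

definition nf :: "complex \<Rightarrow> complex \<Rightarrow> complex \<Rightarrow> complex \<Rightarrow> complex \<Rightarrow> complex \<Rightarrow> complex \<Rightarrow>
    complex \<Rightarrow> complex \<Rightarrow> complex \<Rightarrow> complex \<Rightarrow> cps" where
  "nf z x y q0 q1 q2 c0 c1 c2 c3 g = Abs3 (\<lambda>i j k.
     if k = 1 \<and> i = 0 \<and> j = 0 then z
     else if k = 0 then
       (if i = 1 \<and> j = 0 then x else if i = 0 \<and> j = 1 then y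
        else if i = 2 \<and> j = 0 then q0 else if i = 1 \<and> j = 1 then q1 else if i = 0 \<and> j = 2 then q2
        else if i = 3 \<and> j = 0 then c0 else if i = 2 \<and> j = 1 then c1 else if i = 1 \<and> j = 2 then c2
        else if i = 0 \<and> j = 3 then c3 else if i = 2 \<and> j = 2 then - g / 2 else 0)
     else 0)"

fun xi :: "cvf \<Rightarrow> cps" where
  "xi (CVF e f v1 v2 a1 a2 a3 b1 b2 b3 c0 c1 c2 c3 d0 d1 d2 d3 g1 g2 k1 k2 m) =
     nf v1 e 0 a1 a2 a3 c0 c1 c2 c3 g1"

fun eta :: "cvf \<Rightarrow> cps" where
  "eta (CVF e f v1 v2 a1 a2 a3 b1 b2 b3 c0 c1 c2 c3 d0 d1 d2 d3 g1 g2 k1 k2 m) =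
     nf v2 0 e b1 b2 b3 d0 d1 d2 d3 g2"

fun zeta :: "complex \<Rightarrow> cvf \<Rightarrow> cps" where
  "zeta t (CVF e f v1 v2 a1 a2 a3 b1 b2 b3 c0 c1 c2 c3 d0 d1 d2 d3 g1 g2 k1 k2 m) =
     nf f 0 0 0 0 0 (2 * k1) (t * k2) (t * k1) (2 * k2) m"

text \<open>
  The coefficients at $x^3, x^2y, xy^2, y^3$ of $a\partial_xp + b\partial_yp$ for the quadratic
  forms $a, b, p$ with coefficients \<open>a1, a2, a3\<close> etc.
\<close>

definition quad_act0 :: "complex \<Rightarrow> complex \<Rightarrow> complex \<Rightarrow> complex \<Rightarrow> complex \<Rightarrow> complex \<Rightarrow> complex \<Rightarrow> complex \<Rightarrow> complex \<Rightarrow> complex" where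
  "quad_act0 a1 a2 a3 b1 b2 b3 p1 p2 p3 = 2 * a1 * p1 + b1 * p2"
definition quad_act1 :: "complex \<Rightarrow> complex \<Rightarrow> complex \<Rightarrow> complex \<Rightarrow> complex \<Rightarrow> complex \<Rightarrow> complex \<Rightarrow> complex \<Rightarrow> complex \<Rightarrow> complex" where
  "quad_act1 a1 a2 a3 b1 b2 b3 p1 p2 p3 = a1 * p2 + 2 * a2 * p1 + 2 * b1 * p3 + b2 * p2"
definition quad_act2 :: "complex \<Rightarrow> complex \<Rightarrow> complex \<Rightarrow> complex \<Rightarrow> complex \<Rightarrow> complex \<Rightarrow> complex \<Rightarrow> complex \<Rightarrow> complex \<Rightarrow> complex" where
  "quad_act2 a1 a2 a3 b1 b2 b3 p1 p2 p3 = a2 * p2 + 2 * a3 * p1 + 2 * b2 * p3 + b3 * p2"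
definition quad_act3 :: "complex \<Rightarrow> complex \<Rightarrow> complex \<Rightarrow> complex \<Rightarrow> complex \<Rightarrow> complex \<Rightarrow> complex \<Rightarrow> complex \<Rightarrow> complex \<Rightarrow> complex" where
  "quad_act3 a1 a2 a3 b1 b2 b3 p1 p2 p3 = a3 * p2 + 2 * b3 * p3"

lemmas quad_act_defs = quad_act0_def quad_act1_def quad_act2_def quad_act3_def

text \<open>
  The functional \<open>apolar t\<close> evaluated at $a\partial_xc + b\partial_yc$ for quadratic
  forms $a, b$ and a cubic form $c$ (\<open>top_quad\<close>), and at
  $c\partial_xp + d\partial_yp$ for cubic forms $c, d$ and a quadratic form $p$
  (\<open>top_cubic\<close>).
\<close>

definition top_quad :: "complex \<Rightarrow> complex \<Rightarrow> complex \<Rightarrow> complex \<Rightarrow> complex \<Rightarrow> complex \<Rightarrow> complex \<Rightarrow> complex \<Rightarrow> complex \<Rightarrow> complex \<Rightarrow> complex \<Rightarrow> complex" where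
  "top_quad t a1 a2 a3 b1 b2 b3 c0 c1 c2 c3 =
     3 * t * a1 * c0 - 2 * (a1 * c2 + 2 * a2 * c1 + 3 * a3 * c0) + t * a3 * c2
     + t * b1 * c1 - 2 * (3 * b1 * c3 + 2 * b2 * c2 + b3 * c1) + 3 * t * b3 * c3"

definition top_cubic :: "complex \<Rightarrow> complex \<Rightarrow> complex \<Rightarrow> complex \<Rightarrow> complex \<Rightarrow> complex \<Rightarrow> complex \<Rightarrow> complex \<Rightarrow> complex \<Rightarrow> complex \<Rightarrow> complex \<Rightarrow> complex \<Rightarrow> complex" where
  "top_cubic t c0 c1 c2 c3 d0 d1 d2 d3 p1 p2 p3 =
     2 * p1 * (t * c0 - 2 * c2) + p2 * (t * c3 - 2 * c1) + p2 * (t * d0 - 2 * d2) + 2 * p3 * (t * d3 - 2 * d1)"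

text \<open>
  The commutator of vector fields, reduced modulo the ideal.
\<close>

fun br :: "complex \<Rightarrow> cvf \<Rightarrow> cvf \<Rightarrow> cvf" where
  "br t (CVF e f v1 v2 a1 a2 a3 b1 b2 b3 c0 c1 c2 c3 d0 d1 d2 d3 g1 g2 k1 k2 m)
     (CVF e' f' v1' v2' a1' a2' a3' b1' b2' b3' c0' c1' c2' c3' d0' d1' d2' d3' g1' g2' k1' k2' m') =
   CVF 0
     0
     ((f - e) * v1' - (f' - e') * v1)
     ((f - e) * v2' - (f' - e') * v2)
     (e * a1' - e' * a1)
     (e * a2' - e' * a2)
     (e * a3' - e' * a3)
     (e * b1' - e' * b1)
     (e * b2' - e' * b2)
     (e * b3' - e' * b3)
     (2 * (e * c0' - e' * c0) + quad_act0 a1 a2 a3 b1 b2 b3 a1' a2' a3' - quad_act0 a1' a2' a3' b1' b2' b3' a1 a2 a3 - v1 * (2 * k1') + v1' * (2 * k1))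
     (2 * (e * c1' - e' * c1) + quad_act1 a1 a2 a3 b1 b2 b3 a1' a2' a3' - quad_act1 a1' a2' a3' b1' b2' b3' a1 a2 a3 - v1 * (t * k2') + v1' * (t * k2))
     (2 * (e * c2' - e' * c2) + quad_act2 a1 a2 a3 b1 b2 b3 a1' a2' a3' - quad_act2 a1' a2' a3' b1' b2' b3' a1 a2 a3 - v1 * (t * k1') + v1' * (t * k1))
     (2 * (e * c3' - e' * c3) + quad_act3 a1 a2 a3 b1 b2 b3 a1' a2' a3' - quad_act3 a1' a2' a3' b1' b2' b3' a1 a2 a3 - v1 * (2 * k2') + v1' * (2 * k2))
     (2 * (e * d0' - e' * d0) + quad_act0 a1 a2 a3 b1 b2 b3 b1' b2' b3' - quad_act0 a1' a2' a3' b1' b2' b3' b1 b2 b3 - v2 * (2 * k1') + v2' * (2 * k1))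
     (2 * (e * d1' - e' * d1) + quad_act1 a1 a2 a3 b1 b2 b3 b1' b2' b3' - quad_act1 a1' a2' a3' b1' b2' b3' b1 b2 b3 - v2 * (t * k2') + v2' * (t * k2))
     (2 * (e * d2' - e' * d2) + quad_act2 a1 a2 a3 b1 b2 b3 b1' b2' b3' - quad_act2 a1' a2' a3' b1' b2' b3' b1 b2 b3 - v2 * (t * k1') + v2' * (t * k1))
     (2 * (e * d3' - e' * d3) + quad_act3 a1 a2 a3 b1 b2 b3 b1' b2' b3' - quad_act3 a1' a2' a3' b1' b2' b3' b1 b2 b3 - v2 * (2 * k2') + v2' * (2 * k2))
     (3 * (e * g1' - e' * g1) + top_quad t a1 a2 a3 b1 b2 b3 c0' c1' c2' c3' + top_cubic t c0 c1 c2 c3 d0 d1 d2 d3 a1' a2' a3' - top_quad t a1' a2' a3' b1' b2' b3' c0 c1 c2 c3 - top_cubic t c0' c1' c2' c3' d0' d1' d2' d3' a1 a2 a3 - v1 * m' + v1' * m)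
     (3 * (e * g2' - e' * g2) + top_quad t a1 a2 a3 b1 b2 b3 d0' d1' d2' d3' + top_cubic t c0 c1 c2 c3 d0 d1 d2 d3 b1' b2' b3' - top_quad t a1' a2' a3' b1' b2' b3' d0 d1 d2 d3 - top_cubic t c0' c1' c2' c3' d0' d1' d2' d3' b1 b2 b3 - v2 * m' + v2' * m)
     ((3 * e - f) * k1' - (3 * e' - f') * k1)
     ((3 * e - f) * k2' - (3 * e' - f') * k2)
     ((4 * e - f) * m' - (4 * e' - f') * m + top_quad t a1 a2 a3 b1 b2 b3 (2 * k1') (t * k2') (t * k1') (2 * k2') - top_quad t a1' a2' a3' b1' b2' b3' (2 * k1) (t * k2) (t * k1) (2 * k2))"

fun cvf_add :: "cvf \<Rightarrow> cvf \<Rightarrow> cvf" where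
  "cvf_add (CVF e f v1 v2 a1 a2 a3 b1 b2 b3 c0 c1 c2 c3 d0 d1 d2 d3 g1 g2 k1 k2 m)
     (CVF e' f' v1' v2' a1' a2' a3' b1' b2' b3' c0' c1' c2' c3' d0' d1' d2' d3' g1' g2' k1' k2' m') =
   CVF (e + e') (f + f') (v1 + v1') (v2 + v2') (a1 + a1') (a2 + a2') (a3 + a3') (b1 + b1') (b2 + b2') (b3 + b3') (c0 + c0') (c1 + c1') (c2 + c2') (c3 + c3') (d0 + d0') (d1 + d1') (d2 + d2') (d3 + d3') (g1 + g1') (g2 + g2') (k1 + k1') (k2 + k2') (m + m')"

fun cvf_smult :: "complex \<Rightarrow> cvf \<Rightarrow> cvf" where
  "cvf_smult r (CVF e f v1 v2 a1 a2 a3 b1 b2 b3 c0 c1 c2 c3 d0 d1 d2 d3 g1 g2 k1 k2 m) =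
   CVF (r * e) (r * f) (r * v1) (r * v2) (r * a1) (r * a2) (r * a3) (r * b1) (r * b2) (r * b3) (r * c0) (r * c1) (r * c2) (r * c3) (r * d0) (r * d1) (r * d2) (r * d3) (r * g1) (r * g2) (r * k1) (r * k2) (r * m)"

abbreviation cvf_field :: "complex \<Rightarrow> cvf \<Rightarrow> cps \<Rightarrow> cps" where
  "cvf_field t p \<equiv> vfield (xi p) (eta p) (zeta t p)"

lemma coeff3_nf:
  "coeff3 (nf z x y q0 q1 q2 c0 c1 c2 c3 g) i j k =
     (if k = 1 \<and> i = 0 \<and> j = 0 then z
     else if k = 0 then
       (if i = 1 \<and> j = 0 then x else if i = 0 \<and> j = 1 then y
        else if i = 2 \<and> j = 0 then q0 else if i = 1 \<and> j = 1 then q1 else if i = 0 \<and> j = 2 then q2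
        else if i = 3 \<and> j = 0 then c0 else if i = 2 \<and> j = 1 then c1 else if i = 1 \<and> j = 2 then c2
        else if i = 0 \<and> j = 3 then c3 else if i = 2 \<and> j = 2 then - g / 2 else 0)
     else 0)"
  by (simp add: nf_def)

text \<open>
  The list consists of the coefficients that membership in \<open>bound1\<close> depends on.
\<close>

lemma vfield_nf:
  fixes z x y q0 q1 q2 c0 c1 c2 c3 g z' x' y' q0' q1' q2' c0' c1' c2' c3' g' z'' c0'' c1'' c2'' c3'' g'' :: complex
    and f :: cps
  defines "h \<equiv> vfield (nf z x y q0 q1 q2 c0 c1 c2 c3 g) (nf z' x' y' q0' q1' q2' c0' c1' c2' c3' g')
     (nf z'' 0 0 0 0 0 c0'' c1'' c2'' c3'' g'') f"
  shows "coeff3 h 0 0 0 = 0"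
    and "coeff3 h 1 0 0 = x * coeff3 f 1 0 0 + x' * coeff3 f 0 1 0"
    and "coeff3 h 0 1 0 = y * coeff3 f 1 0 0 + y' * coeff3 f 0 1 0"
    and "coeff3 h 0 0 1 = z * coeff3 f 1 0 0 + z' * coeff3 f 0 1 0 + z'' * coeff3 f 0 0 1"
    and "coeff3 h 2 0 0 = 2 * x * coeff3 f 2 0 0 + q0 * coeff3 f 1 0 0 + x' * coeff3 f 1 1 0 + q0' * coeff3 f 0 1 0"
    and "coeff3 h 1 1 0 = x * coeff3 f 1 1 0 + 2 * y * coeff3 f 2 0 0 + q1 * coeff3 f 1 0 0 + 2 * x' * coeff3 f 0 2 0 + y' * coeff3 f 1 1 0 + q1' * coeff3 f 0 1 0"
    and "coeff3 h 0 2 0 = y * coeff3 f 1 1 0 + q2 * coeff3 f 1 0 0 + 2 * y' * coeff3 f 0 2 0 + q2' * coeff3 f 0 1 0"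
    and "coeff3 h 3 0 0 = 3 * x * coeff3 f 3 0 0 + 2 * q0 * coeff3 f 2 0 0 + c0 * coeff3 f 1 0 0 + x' * coeff3 f 2 1 0 + q0' * coeff3 f 1 1 0 + c0' * coeff3 f 0 1 0 + c0'' * coeff3 f 0 0 1"
    and "coeff3 h 2 1 0 = 2 * x * coeff3 f 2 1 0 + 3 * y * coeff3 f 3 0 0 + q0 * coeff3 f 1 1 0 + 2 * q1 * coeff3 f 2 0 0 + c1 * coeff3 f 1 0 0 + 2 * x' * coeff3 f 1 2 0 + y' * coeff3 f 2 1 0 + 2 * q0' * coeff3 f 0 2 0 + q1' * coeff3 f 1 1 0 + c1' * coeff3 f 0 1 0 + c1'' * coeff3 f 0 0 1"
    and "coeff3 h 1 2 0 = x * coeff3 f 1 2 0 + 2 * y * coeff3 f 2 1 0 + q1 * coeff3 f 1 1 0 + 2 * q2 * coeff3 f 2 0 0 + c2 * coeff3 f 1 0 0 + 3 * x' * coeff3 f 0 3 0 + 2 * y' * coeff3 f 1 2 0 + 2 * q1' * coeff3 f 0 2 0 + q2' * coeff3 f 1 1 0 + c2' * coeff3 f 0 1 0 + c2'' * coeff3 f 0 0 1"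
    and "coeff3 h 0 3 0 = y * coeff3 f 1 2 0 + q2 * coeff3 f 1 1 0 + c3 * coeff3 f 1 0 0 + 3 * y' * coeff3 f 0 3 0 + 2 * q2' * coeff3 f 0 2 0 + c3' * coeff3 f 0 1 0 + c3'' * coeff3 f 0 0 1"
    and "coeff3 h 4 0 0 = 4 * x * coeff3 f 4 0 0 + 3 * q0 * coeff3 f 3 0 0 + 2 * c0 * coeff3 f 2 0 0 + x' * coeff3 f 3 1 0 + q0' * coeff3 f 2 1 0 + c0' * coeff3 f 1 1 0 + c0'' * coeff3 f 1 0 1"
    and "coeff3 h 2 2 0 = 2 * x * coeff3 f 2 2 0 + 3 * y * coeff3 f 3 1 0 + q0 * coeff3 f 1 2 0 + 2 * q1 * coeff3 f 2 1 0 + 3 * q2 * coeff3 f 3 0 0 + c1 * coeff3 f 1 1 0 + 2 * c2 * coeff3 f 2 0 0 + (- g / 2) * coeff3 f 1 0 0 + 3 * x' * coeff3 f 1 3 0 + 2 * y' * coeff3 f 2 2 0 + 3 * q0' * coeff3 f 0 3 0 + 2 * q1' * coeff3 f 1 2 0 + q2' * coeff3 f 2 1 0 + 2 * c1' * coeff3 f 0 2 0 + c2' * coeff3 f 1 1 0 + (- g' / 2) * coeff3 f 0 1 0 + c1'' * coeff3 f 0 1 1 + c2'' * coeff3 f 1 0 1 + (- g'' / 2) * coeff3 f 0 0 1"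
    and "coeff3 h 0 4 0 = y * coeff3 f 1 3 0 + q2 * coeff3 f 1 2 0 + c3 * coeff3 f 1 1 0 + 4 * y' * coeff3 f 0 4 0 + 3 * q2' * coeff3 f 0 3 0 + 2 * c3' * coeff3 f 0 2 0 + c3'' * coeff3 f 0 1 1"
  unfolding h_def vfield_def
  by (simp_all add: coeff3_nf coeff3_mult_eval algebra_simps)

lemma cvf_field_preserves:
  assumes f: "f \<in> bound1 t"
  shows "cvf_field t p f \<in> bound1 t"
proof (cases p)
  case (CVF e f0 v1 v2 a1 a2 a3 b1 b2 b3 c0 c1 c2 c3 d0 d1 d2 d3 g1 g2 k1 k2 m)
  let ?h = "cvf_field t p f"
  have z: "coeff3 f 1 0 0 = 0" "coeff3 f 0 1 0 = 0" "coeff3 f 0 0 1 = 0" "coeff3 f 2 0 0 = 0"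
    "coeff3 f 1 1 0 = 0" "coeff3 f 0 2 0 = 0" "coeff3 f 3 0 0 = 0" "coeff3 f 2 1 0 = 0"
    "coeff3 f 1 2 0 = 0" "coeff3 f 0 3 0 = 0"
    and l: "apolar t f = 0"
    using f by (simp_all add: bound1_def)
  have "apolar t ?h =
      4 * e * (apolar t f)"
    unfolding CVF xi.simps eta.simps zeta.simps vfield_nf by (simp add: z z[unfolded One_nat_def] algebra_simps)
  then have "apolar t ?h = 0"
    unfolding l by simp
  moreover have "coeff3 ?h 0 0 0 = 0 \<and> coeff3 ?h 1 0 0 = 0 \<and> coeff3 ?h 0 1 0 = 0 \<and> coeff3 ?h 0 0 1 = 0 \<and>
     coeff3 ?h 2 0 0 = 0 \<and> coeff3 ?h 1 1 0 = 0 \<and> coeff3 ?h 0 2 0 = 0 \<and>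
     coeff3 ?h 3 0 0 = 0 \<and> coeff3 ?h 2 1 0 = 0 \<and> coeff3 ?h 1 2 0 = 0 \<and> coeff3 ?h 0 3 0 = 0"
    unfolding CVF xi.simps eta.simps zeta.simps vfield_nf by (simp add: z z[unfolded One_nat_def])
  ultimately show ?thesis unfolding bound1_def by blast
qed

lemma bound1I:
  assumes "apolar t f = 0"
    and "coeff3 f 0 0 0 = 0" "coeff3 f 1 0 0 = 0" "coeff3 f 0 1 0 = 0" "coeff3 f 0 0 1 = 0"
    "coeff3 f 2 0 0 = 0" "coeff3 f 1 1 0 = 0" "coeff3 f 0 2 0 = 0"
    "coeff3 f 3 0 0 = 0" "coeff3 f 2 1 0 = 0" "coeff3 f 1 2 0 = 0" "coeff3 f 0 3 0 = 0"
  shows "f \<in> bound1 t"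
  using assms by (simp add: bound1_def)

lemma cvf_field_bracket:
  "cvf_field t p (xi q) - cvf_field t q (xi p) - xi (br t p q) \<in> bound1 t"
  "cvf_field t p (eta q) - cvf_field t q (eta p) - eta (br t p q) \<in> bound1 t"
  "cvf_field t p (zeta t q) - cvf_field t q (zeta t p) - zeta t (br t p q) \<in> bound1 t"
proof -
  obtain e f v1 v2 a1 a2 a3 b1 b2 b3 c0 c1 c2 c3 d0 d1 d2 d3 g1 g2 k1 k2 m
    where p: "p = CVF e f v1 v2 a1 a2 a3 b1 b2 b3 c0 c1 c2 c3 d0 d1 d2 d3 g1 g2 k1 k2 m" by (cases p)
  obtain e' f' v1' v2' a1' a2' a3' b1' b2' b3' c0' c1' c2' c3' d0' d1' d2' d3' g1' g2' k1' k2' m'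
    where q: "q = CVF e' f' v1' v2' a1' a2' a3' b1' b2' b3' c0' c1' c2' c3' d0' d1' d2' d3' g1' g2' k1' k2' m'"
    by (cases q)
  note defs = coeff3_diff xi.simps eta.simps zeta.simps br.simps
  show "cvf_field t p (xi q) - cvf_field t q (xi p) - xi (br t p q) \<in> bound1 t"
    unfolding p q
    by (rule bound1I; unfold defs vfield_nf coeff3_nf top_quad_def top_cubic_def quad_act_defs)
      (simp_all, Groebner_Basis.algebra+)
  show "cvf_field t p (eta q) - cvf_field t q (eta p) - eta (br t p q) \<in> bound1 t"
    unfolding p q
    by (rule bound1I; unfold defs vfield_nf coeff3_nf top_quad_def top_cubic_def quad_act_defs)
      (simp_all, Groebner_Basis.algebra+)
  show "cvf_field t p (zeta t q) - cvf_field t q (zeta t p) - zeta t (br t p q) \<in> bound1 t"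
    unfolding p q
    by (rule bound1I; unfold defs vfield_nf coeff3_nf top_quad_def top_cubic_def quad_act_defs)
      (simp_all, Groebner_Basis.algebra+)
qed

definition nf_support :: "(nat \<times> nat \<times> nat) set" where
  "nf_support = {(0, 0, 1), (1, 0, 0), (0, 1, 0), (2, 0, 0), (1, 1, 0), (0, 2, 0),
     (3, 0, 0), (2, 1, 0), (1, 2, 0), (0, 3, 0), (2, 2, 0)}"

lemma coeff3_nf_0:
  assumes "(i, j, k) \<notin> nf_support"
  shows "coeff3 (nf z x y q0 q1 q2 c0 c1 c2 c3 g) i j k = 0"
proof -
  have "\<not> (k = 1 \<and> i = 0 \<and> j = 0)" "k = 0 \<Longrightarrow> \<not> (i = 1 \<and> j = 0)" "k = 0 \<Longrightarrow> \<not> (i = 0 \<and> j = 1)"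
    "k = 0 \<Longrightarrow> \<not> (i = 2 \<and> j = 0)" "k = 0 \<Longrightarrow> \<not> (i = 1 \<and> j = 1)" "k = 0 \<Longrightarrow> \<not> (i = 0 \<and> j = 2)"
    "k = 0 \<Longrightarrow> \<not> (i = 3 \<and> j = 0)" "k = 0 \<Longrightarrow> \<not> (i = 2 \<and> j = 1)" "k = 0 \<Longrightarrow> \<not> (i = 1 \<and> j = 2)"
    "k = 0 \<Longrightarrow> \<not> (i = 0 \<and> j = 3)" "k = 0 \<Longrightarrow> \<not> (i = 2 \<and> j = 2)"
    using assms by (auto simp: nf_support_def)
  then show ?thesis unfolding coeff3_nf by (simp only: if_False if_cancel cong: if_cong)
qed

lemma nf_eqI:
  assumes "\<And>i j k. (i, j, k) \<notin> nf_support \<Longrightarrow> coeff3 f i j k = 0"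
    and "coeff3 f 0 0 1 = z" "coeff3 f 1 0 0 = x" "coeff3 f 0 1 0 = y"
    "coeff3 f 2 0 0 = q0" "coeff3 f 1 1 0 = q1" "coeff3 f 0 2 0 = q2"
    "coeff3 f 3 0 0 = c0" "coeff3 f 2 1 0 = c1" "coeff3 f 1 2 0 = c2" "coeff3 f 0 3 0 = c3"
    "coeff3 f 2 2 0 = - g / 2"
  shows "f = nf z x y q0 q1 q2 c0 c1 c2 c3 g"
proof (rule cps_eqI)
  fix i j k
  show "coeff3 f i j k = coeff3 (nf z x y q0 q1 q2 c0 c1 c2 c3 g) i j k"
  proof (cases "(i, j, k) \<in> nf_support")
    case True
    then show ?thesis
      unfolding nf_support_def by (elim insertE emptyE) (simp_all add: coeff3_nf assms(2-) assms(2-)[unfolded One_nat_def])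
  next
    case False
    then show ?thesis by (simp add: assms(1) coeff3_nf_0)
  qed
qed

lemma nf_add:
  "nf z x y q0 q1 q2 c0 c1 c2 c3 g + nf z' x' y' q0' q1' q2' c0' c1' c2' c3' g' =
   nf (z + z') (x + x') (y + y') (q0 + q0') (q1 + q1') (q2 + q2') (c0 + c0') (c1 + c1') (c2 + c2') (c3 + c3') (g + g')"
  by (rule nf_eqI) (simp add: coeff3_nf_0, simp_all add: coeff3_nf diff_divide_distrib)

lemma nf_cst_mult:
  "cst r * nf z x y q0 q1 q2 c0 c1 c2 c3 g =
   nf (r * z) (r * x) (r * y) (r * q0) (r * q1) (r * q2) (r * c0) (r * c1) (r * c2) (r * c3) (r * g)"
  by (rule nf_eqI) (simp add: coeff3_nf_0, simp_all add: coeff3_nf)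

context
  fixes t :: complex
  assumes t: "t \<in> params"
begin

lemma cvf_field_Ik: "f \<in> Ik 1 t \<Longrightarrow> cvf_field t p f \<in> Ik 1 t"
  unfolding Ik1_eq[OF t] by (rule cvf_field_preserves)

lemma proj_eq_bound1: "proj t f = proj t g \<longleftrightarrow> f - g \<in> bound1 t"
  by (simp only: proj_eq_iff) (simp only: Ik1_eq[OF t])

definition cvf_deriv :: "cvf \<Rightarrow> cps set \<Rightarrow> cps set" where
  "cvf_deriv p = coset_deriv t (xi p) (eta p) (zeta t p)"

lemma cvf_deriv_proj: "cvf_deriv p (proj t f) = proj t (cvf_field t p f)"
  unfolding cvf_deriv_def by (rule coset_deriv_proj[OF cvf_field_Ik])

lemma cvf_deriv_carrier: "cvf_deriv p \<in> lie_carrier (Yau_algebra 1 t)"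
  unfolding cvf_deriv_def by (rule coset_deriv_derivation[OF cvf_field_Ik])

lemma cvf_deriv_eqI:
  assumes "D \<in> extensional (carrier (Alg 1 t))" "\<And>f. D (proj t f) = proj t (cvf_field t p f)"
  shows "cvf_deriv p = D"
proof (rule extensionalityI[of _ "carrier (Alg 1 t)"])
  show "cvf_deriv p \<in> extensional (carrier (Alg 1 t))"
    by (simp add: cvf_deriv_def coset_deriv_def)
  fix a assume "a \<in> carrier (Alg 1 t)"
  then show "cvf_deriv p a = D a" using assms(2) by (auto simp: Alg_carrier cvf_deriv_proj)
qed (rule assms(1))

lemma vfield_cong_Ik:
  assumes "a - a' \<in> Ik 1 t" "b - b' \<in> Ik 1 t" "c - c' \<in> Ik 1 t"
  shows "vfield a b c f - vfield a' b' c' f \<in> Ik 1 t"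
proof -
  note I = ideal_O_D[OF ideal_Ik[of 1 t]]
  have "vfield a b c f - vfield a' b' c' f = (a - a') * dx f + (b - b') * dy f + (c - c') * dz f"
    by (simp add: vfield_def algebra_simps)
  also have "\<dots> \<in> Ik 1 t" by (intro I(2,4) assms)
  finally show ?thesis .
qed

lemma cvf_deriv_add: "cvf_deriv (cvf_add p q) = lie_add (Yau_algebra 1 t) (cvf_deriv p) (cvf_deriv q)"
proof (rule cvf_deriv_eqI)
  show "lie_add (Yau_algebra 1 t) (cvf_deriv p) (cvf_deriv q) \<in> extensional (carrier (Alg 1 t))"
    by (simp add: Yau_algebra_def Der_def)
  have "xi (cvf_add p q) = xi p + xi q \<and> eta (cvf_add p q) = eta p + eta q \<and> zeta t (cvf_add p q) = zeta t p + zeta t q"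
    by (cases p; cases q) (simp add: nf_add distrib_left[of 2] distrib_left[of t])
  then have "cvf_field t (cvf_add p q) f = cvf_field t p f + cvf_field t q f" for f
    by (simp add: vfield_def algebra_simps)
  then show "lie_add (Yau_algebra 1 t) (cvf_deriv p) (cvf_deriv q) (proj t f) = proj t (cvf_field t (cvf_add p q) f)" for f
    by (simp add: Yau_algebra_def Der_def Alg_carrier cvf_deriv_proj proj_add)
qed

lemma cvf_deriv_smult: "cvf_deriv (cvf_smult r p) = lie_smult (Yau_algebra 1 t) r (cvf_deriv p)"
proof (rule cvf_deriv_eqI)
  show "lie_smult (Yau_algebra 1 t) r (cvf_deriv p) \<in> extensional (carrier (Alg 1 t))"
    by (simp add: Yau_algebra_def Der_def)
  have "xi (cvf_smult r p) = cst r * xi p \<and> eta (cvf_smult r p) = cst r * eta p \<and> zeta t (cvf_smult r p) = cst r * zeta t p"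
    by (cases p) (simp add: nf_cst_mult mult.left_commute)
  then have "cvf_field t (cvf_smult r p) f = cst r * cvf_field t p f" for f
    by (simp add: vfield_def algebra_simps)
  then show "lie_smult (Yau_algebra 1 t) r (cvf_deriv p) (proj t f) = proj t (cvf_field t (cvf_smult r p) f)" for f
    by (simp add: Yau_algebra_def Der_def Alg_carrier cvf_deriv_proj proj_mult)
qed

lemma cvf_deriv_bracket: "cvf_deriv (br t p q) = lie_bracket (Yau_algebra 1 t) (cvf_deriv p) (cvf_deriv q)"
proof (rule cvf_deriv_eqI)
  show "lie_bracket (Yau_algebra 1 t) (cvf_deriv p) (cvf_deriv q) \<in> extensional (carrier (Alg 1 t))"
    by (simp add: Yau_algebra_def Der_def)
  fix f
  have "lie_bracket (Yau_algebra 1 t) (cvf_deriv p) (cvf_deriv q) (proj t f) =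
      proj t (cvf_field t p (cvf_field t q f) - cvf_field t q (cvf_field t p f))"
    by (simp add: Yau_algebra_def Der_def Alg_carrier cvf_deriv_proj proj_diff)
  also have "\<dots> = proj t (cvf_field t (br t p q) f)"
    unfolding vfield_commutator proj_eq_iff
    by (intro vfield_cong_Ik) (unfold Ik1_eq[OF t], (rule cvf_field_bracket)+)
  finally show "lie_bracket (Yau_algebra 1 t) (cvf_deriv p) (cvf_deriv q) (proj t f) =
      proj t (cvf_field t (br t p q) f)" .
qed

lemma inj_cvf_deriv: "inj cvf_deriv"
proof (rule injI)
  fix p q assume "cvf_deriv p = cvf_deriv q"
  then have "proj t (cvf_field t p f) = proj t (cvf_field t q f)" for f
    unfolding cvf_deriv_proj[symmetric] by simp
  from this[of varX] this[of varY] this[of varZ]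
  have "xi p - xi q \<in> bound1 t" "eta p - eta q \<in> bound1 t" "zeta t p - zeta t q \<in> bound1 t"
    by (simp_all add: vfield_var proj_eq_bound1)
  then show "p = q"
    by (cases p; cases q) (simp add: bound1_def coeff3_nf)
qed

text \<open>
  A lift of a derivation must preserve the ideal. Testing this on $z^2$, $xz$, $yz$, $x^3y$,
  $xy^3$ and $2x^4+tx^2y^2$ yields all restrictions. The two quartics with mixed terms give a
  linear system of determinant $t^2-36$ for the off-diagonal linear terms, and the last one
  equates the diagonal ones because \<open>t \<noteq> 0\<close>.
\<close>

lemma cvf_deriv_surj:
  assumes t': "t \<notin> special" and D: "D \<in> lie_carrier (Yau_algebra 1 t)"
  shows "D \<in> range cvf_deriv"
proof -
  note I = ideal_O_D[OF ideal_Ik[of 1 t]]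
  have Dc: "D (proj t f) \<in> range (proj t)" for f
    using D by (auto simp: Yau_algebra_def Der_def derivations_def Alg_carrier)
  obtain \<xi> \<eta> \<zeta> where lift: "D (proj t varX) = proj t \<xi>" "D (proj t varY) = proj t \<eta>" "D (proj t varZ) = proj t \<zeta>"
    using Dc[of varX] Dc[of varY] Dc[of varZ] by blast
  note DL = derivation_lift[OF t D lift]
  let ?d = "vfield \<xi> \<eta> \<zeta>"
  have pres: "?d w \<in> bound1 t" if "w \<in> bound1 t" for w
  proof -
    have "proj t w = proj t 0" using that by (simp add: proj_eq_bound1)
    then have "proj t (?d w) = proj t (?d 0)" using DL[of w] DL[of 0] by simp
    moreover have "?d 0 = 0" using vfield_cst[of \<xi> \<eta> \<zeta> 0] by simp
    ultimately show ?thesis by (simp add: proj_eq_bound1)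
  qed
  have t0: "t \<noteq> 0" "t\<^sup>2 \<noteq> 36"
    using t' power2_eq_iff[of t 6] by (auto simp: special_def)
  have "?d (varZ * varZ) \<in> bound1 t"
    by (rule pres) (simp add: bound1_def coeff3_eval)
  moreover have "?d (varZ * varZ) = cst 2 * (varZ * \<zeta>)"
    by (simp add: vfield_mult vfield_var cst_numeral algebra_simps)
  ultimately have \<zeta>0: "coeff3 \<zeta> 0 0 0 = 0" by (simp add: bound1_def)
  have "?d (varX * varZ) \<in> bound1 t"
    by (rule pres) (simp add: bound1_def coeff3_eval)
  moreover have "?d (varX * varZ) = varZ * \<xi> + varX * \<zeta>"
    by (simp add: vfield_mult vfield_var algebra_simps)
  ultimately have XZ: "coeff3 \<xi> 0 0 0 = 0" "coeff3 \<zeta> 1 0 0 = 0" "coeff3 \<zeta> 0 1 0 = 0"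
    "coeff3 \<zeta> 2 0 0 = 0" "coeff3 \<zeta> 1 1 0 = 0" "coeff3 \<zeta> 0 2 0 = 0"
    "t * coeff3 \<zeta> 3 0 0 - 2 * coeff3 \<zeta> 1 2 0 = 0"
    by (simp_all add: bound1_def)
  have "?d (varY * varZ) \<in> bound1 t"
    by (rule pres) (simp add: bound1_def coeff3_eval)
  moreover have "?d (varY * varZ) = varZ * \<eta> + varY * \<zeta>"
    by (simp add: vfield_mult vfield_var algebra_simps)
  ultimately have YZ: "coeff3 \<eta> 0 0 0 = 0" "t * coeff3 \<zeta> 0 3 0 - 2 * coeff3 \<zeta> 2 1 0 = 0"
    by (simp_all add: bound1_def)
  have "?d (varX * (varX * (varX * varY))) \<in> bound1 t"
    by (rule pres) (simp add: bound1_def coeff3_eval)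
  moreover have "?d (varX * (varX * (varX * varY))) = cst 3 * (varX * (varX * (varY * \<xi>))) + varX * (varX * (varX * \<eta>))"
    by (simp add: vfield_mult vfield_var cst_numeral algebra_simps)
  ultimately have XY1: "t * coeff3 \<eta> 1 0 0 - 2 * (3 * coeff3 \<xi> 0 1 0) = 0"
    by (simp add: bound1_def)
  have "?d (varX * (varY * (varY * varY))) \<in> bound1 t"
    by (rule pres) (simp add: bound1_def coeff3_eval)
  moreover have "?d (varX * (varY * (varY * varY))) = varY * (varY * (varY * \<xi>)) + cst 3 * (varX * (varY * (varY * \<eta>)))"
    by (simp add: vfield_mult vfield_var cst_numeral algebra_simps)
  ultimately have XY2: "t * coeff3 \<xi> 0 1 0 - 2 * (3 * coeff3 \<eta> 1 0 0) = 0"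
    by (simp add: bound1_def)
  have "(t\<^sup>2 - 36) * coeff3 \<xi> 0 1 0 = 0" "(t\<^sup>2 - 36) * coeff3 \<eta> 1 0 0 = 0"
    using XY1 XY2 by Groebner_Basis.algebra+
  then have off: "coeff3 \<xi> 0 1 0 = 0" "coeff3 \<eta> 1 0 0 = 0" using t0 by auto
  have "?d (cst 2 * (varX * (varX * (varX * varX))) + cst t * (varX * (varX * (varY * varY)))) \<in> bound1 t"
    by (rule pres) (simp add: bound1_def coeff3_eval)
  moreover have "?d (cst 2 * (varX * (varX * (varX * varX))) + cst t * (varX * (varX * (varY * varY)))) =
      cst 8 * (varX * (varX * (varX * \<xi>))) + cst (2 * t) * (varX * (varY * (varY * \<xi>)))
      + cst (2 * t) * (varX * (varX * (varY * \<eta>)))"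
    by (simp add: vfield_mult vfield_add vfield_cst vfield_cst[of _ _ _ "numeral _", unfolded cst_numeral] vfield_var cst_mult cst_numeral algebra_simps)
  ultimately have "t * (8 * coeff3 \<xi> 1 0 0) - 2 * (2 * t * coeff3 \<xi> 1 0 0 + 2 * t * coeff3 \<eta> 0 1 0) = 0"
    by (simp add: bound1_def)
  then have "4 * t * (coeff3 \<xi> 1 0 0 - coeff3 \<eta> 0 1 0) = 0" by (simp add: algebra_simps)
  then have diag: "coeff3 \<eta> 0 1 0 = coeff3 \<xi> 1 0 0" using t0 by simp
  define p where "p = CVF (coeff3 \<xi> 1 0 0) (coeff3 \<zeta> 0 0 1) (coeff3 \<xi> 0 0 1) (coeff3 \<eta> 0 0 1)
     (coeff3 \<xi> 2 0 0) (coeff3 \<xi> 1 1 0) (coeff3 \<xi> 0 2 0) (coeff3 \<eta> 2 0 0) (coeff3 \<eta> 1 1 0) (coeff3 \<eta> 0 2 0)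
     (coeff3 \<xi> 3 0 0) (coeff3 \<xi> 2 1 0) (coeff3 \<xi> 1 2 0) (coeff3 \<xi> 0 3 0)
     (coeff3 \<eta> 3 0 0) (coeff3 \<eta> 2 1 0) (coeff3 \<eta> 1 2 0) (coeff3 \<eta> 0 3 0)
     (apolar t \<xi>) (apolar t \<eta>) (coeff3 \<zeta> 3 0 0 / 2) (coeff3 \<zeta> 0 3 0 / 2) (apolar t \<zeta>)"
  have "\<xi> - xi p \<in> bound1 t"
    by (rule bound1I; simp add: p_def coeff3_nf XZ off off[unfolded One_nat_def]; simp add: field_simps)
  moreover have "\<eta> - eta p \<in> bound1 t"
    by (rule bound1I; simp add: p_def coeff3_nf YZ off off[unfolded One_nat_def] diag diag[unfolded One_nat_def]; simp add: field_simps)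
  moreover have "\<zeta> - zeta t p \<in> bound1 t"
    using XZ(7) YZ(2) by (intro bound1I; simp add: p_def coeff3_nf XZ XZ(2-6)[unfolded One_nat_def] \<zeta>0; simp add: field_simps)
  ultimately have "D (proj t varX) = proj t (xi p)" "D (proj t varY) = proj t (eta p)" "D (proj t varZ) = proj t (zeta t p)"
    unfolding lift proj_eq_bound1 by simp_all
  note DL' = derivation_lift[OF t D this]
  have "D \<in> extensional (carrier (Alg 1 t))"
    using D by (auto simp: Yau_algebra_def Der_def derivations_def PiE_def)
  then have "cvf_deriv p = D" by (rule cvf_deriv_eqI[OF _ DL'])
  then show ?thesis by blast
qed

end

definition Yau_model :: "complex \<Rightarrow> cvf lie_alg" where
  "Yau_model t = \<lparr>lie_carrier = UNIV, lie_add = cvf_add, lie_smult = cvf_smult, lie_bracket = br t\<rparr>"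

theorem Yau_model_isomorphic:
  assumes "t \<in> params" "t \<notin> special"
  shows "lie_isomorphic (Yau_model t) (Yau_algebra 1 t)"
  unfolding lie_isomorphic_def
proof (intro exI[of _ "cvf_deriv t"] conjI)
  show "bij_betw (cvf_deriv t) (lie_carrier (Yau_model t)) (lie_carrier (Yau_algebra 1 t))"
    using inj_cvf_deriv[OF assms(1)] cvf_deriv_surj[OF assms] cvf_deriv_carrier[OF assms(1)]
    by (auto simp: bij_betw_def Yau_model_def)
qed (simp_all add: Yau_model_def cvf_deriv_add[OF assms(1)] cvf_deriv_smult[OF assms(1)] cvf_deriv_bracket[OF assms(1)])

lemma lie_isomorphic_trans:
  assumes "lie_isomorphic L M" "lie_isomorphic M N"
  shows "lie_isomorphic L N"
proof -
  obtain F where F: "bij_betw F (lie_carrier L) (lie_carrier M)"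
    "\<And>D E. D \<in> lie_carrier L \<Longrightarrow> E \<in> lie_carrier L \<Longrightarrow>
      F (lie_add L D E) = lie_add M (F D) (F E) \<and> F (lie_bracket L D E) = lie_bracket M (F D) (F E)"
    "\<And>c D. D \<in> lie_carrier L \<Longrightarrow> F (lie_smult L c D) = lie_smult M c (F D)"
    using assms(1) unfolding lie_isomorphic_def by blast
  obtain G where G: "bij_betw G (lie_carrier M) (lie_carrier N)"
    "\<And>D E. D \<in> lie_carrier M \<Longrightarrow> E \<in> lie_carrier M \<Longrightarrow>
      G (lie_add M D E) = lie_add N (G D) (G E) \<and> G (lie_bracket M D E) = lie_bracket N (G D) (G E)"
    "\<And>c D. D \<in> lie_carrier M \<Longrightarrow> G (lie_smult M c D) = lie_smult N c (G D)"
    using assms(2) unfolding lie_isomorphic_def by blast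
  have Fc: "F D \<in> lie_carrier M" if "D \<in> lie_carrier L" for D
    using F(1) that by (auto simp: bij_betw_def)
  show ?thesis
    unfolding lie_isomorphic_def
    by (intro exI[of _ "G \<circ> F"] conjI bij_betw_trans[OF F(1) G(1)]) (simp_all add: F G Fc)
qed

lemma lie_isomorphic_sym:
  assumes "lie_isomorphic L M" and "lie_carrier L = UNIV"
  shows "lie_isomorphic M L"
proof -
  obtain F where F: "bij_betw F UNIV (lie_carrier M)"
    "\<And>D E. F (lie_add L D E) = lie_add M (F D) (F E) \<and> F (lie_bracket L D E) = lie_bracket M (F D) (F E)"
    "\<And>c D. F (lie_smult L c D) = lie_smult M c (F D)"
    using assms unfolding lie_isomorphic_def by auto
  let ?G = "inv_into UNIV F"
  have inj: "?G (F D) = D" for D using F(1) by (simp add: bij_betw_def inv_f_f)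
  have G: "bij_betw ?G (lie_carrier M) UNIV" by (rule bij_betw_inv_into[OF F(1)])
  have rep: "\<exists>D'. D = F D'" if "D \<in> lie_carrier M" for D
    using that F(1) by (auto simp: bij_betw_def)
  show ?thesis
    unfolding lie_isomorphic_def
  proof (intro exI[of _ ?G] conjI ballI allI)
    show "bij_betw ?G (lie_carrier M) (lie_carrier L)" using G assms(2) by simp
    fix D E assume "D \<in> lie_carrier M" "E \<in> lie_carrier M"
    then obtain D' E' where "D = F D'" "E = F E'" using rep by blast
    then show "?G (lie_add M D E) = lie_add L (?G D) (?G E)"
      "?G (lie_bracket M D E) = lie_bracket L (?G D) (?G E)"
      using F(2)[of D' E'] inj by metis+
  next
    fix c D assume "D \<in> lie_carrier M"
    then obtain D' where "D = F D'" using rep by blast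
    then show "?G (lie_smult M c D) = lie_smult L c (?G D)"
      using F(3)[of c D'] inj by metis
  qed
qed

section \<open>Invariants of the Lie algebra\<close>

definition cvf_zero :: cvf where
  "cvf_zero = CVF 0 0 0 0 0 0 0 0 0 0 0 0 0 0 0 0 0 0 0 0 0 0 0"

abbreviation z_vec :: "complex \<Rightarrow> complex \<Rightarrow> complex \<Rightarrow> complex \<Rightarrow> complex \<Rightarrow> cvf" where
  "z_vec v1 v2 k1 k2 m \<equiv> CVF 0 0 v1 v2 0 0 0 0 0 0 0 0 0 0 0 0 0 0 0 0 k1 k2 m"
abbreviation quad_vec :: "complex \<Rightarrow> complex \<Rightarrow> complex \<Rightarrow> complex \<Rightarrow> complex \<Rightarrow> complex \<Rightarrow> cvf" where
  "quad_vec a1 a2 a3 b1 b2 b3 \<equiv> CVF 0 0 0 0 a1 a2 a3 b1 b2 b3 0 0 0 0 0 0 0 0 0 0 0 0 0"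
abbreviation cubic_vec :: "complex \<Rightarrow> complex \<Rightarrow> complex \<Rightarrow> complex \<Rightarrow> complex \<Rightarrow> complex \<Rightarrow> complex \<Rightarrow> complex \<Rightarrow> cvf" where
  "cubic_vec c0 c1 c2 c3 d0 d1 d2 d3 \<equiv> CVF 0 0 0 0 0 0 0 0 0 0 c0 c1 c2 c3 d0 d1 d2 d3 0 0 0 0 0"
abbreviation top_vec :: "complex \<Rightarrow> complex \<Rightarrow> cvf" where
  "top_vec x y \<equiv> CVF 0 0 0 0 0 0 0 0 0 0 0 0 0 0 0 0 0 0 x y 0 0 0"

text \<open>
  The following sets are defined by the bracket and hence preserved by isomorphisms. In the model,
  \<open>nil_part\<close> consists of the fields without components along the Euler field and
  $z\partial_z$ (single brackets suffice, as the Euler field acts with nonzero eigenvalues);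
  \<open>first_centre\<close> is spanned by $x^2y^2\partial_x$ and $x^2y^2\partial_y$;
  \<open>second_centre\<close> adds the cubic fields and $x^2y^2\partial_z$; and
  \<open>centralizer\<close> adds the half partial derivatives times $\partial_z$. An element of
  \<open>transporter\<close> has no component along $z\partial_x$ and $z\partial_y$, so that it
  acts from the second to the first centre through its quadratic part. The vectors in
  \<open>rank_one_values\<close> span the images of such actions of rank one.
\<close>

definition nil_part :: "(cvf \<Rightarrow> cvf \<Rightarrow> cvf) \<Rightarrow> cvf set" where
  "nil_part B = {B x y | x y. True}"

definition first_centre :: "(cvf \<Rightarrow> cvf \<Rightarrow> cvf) \<Rightarrow> cvf set" where
  "first_centre B = {x \<in> nil_part B. \<forall>y \<in> nil_part B. B x y = cvf_zero}"

definition second_centre :: "(cvf \<Rightarrow> cvf \<Rightarrow> cvf) \<Rightarrow> cvf set" where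
  "second_centre B = {x \<in> nil_part B. \<forall>y \<in> nil_part B. B x y \<in> first_centre B}"

definition centralizer :: "(cvf \<Rightarrow> cvf \<Rightarrow> cvf) \<Rightarrow> cvf set" where
  "centralizer B = {x \<in> nil_part B. \<forall>y \<in> second_centre B. B x y = cvf_zero}"

definition transporter :: "(cvf \<Rightarrow> cvf \<Rightarrow> cvf) \<Rightarrow> cvf set" where
  "transporter B = {x \<in> nil_part B. \<forall>y \<in> centralizer B. B x y \<in> first_centre B}"

definition rank_one_values :: "(cvf \<Rightarrow> cvf \<Rightarrow> cvf) \<Rightarrow> cvf set" where
  "rank_one_values B = {w \<in> first_centre B. \<exists>x \<in> transporter B.
     (\<forall>y \<in> second_centre B. \<exists>c. B x y = cvf_smult c w) \<and> (\<exists>y \<in> second_centre B. B x y \<noteq> cvf_zero)}"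

lemma invariants_image:
  assumes bij: "bij F" and hom: "\<And>x y. F (B x y) = B' (F x) (F y)"
    and zero: "F cvf_zero = cvf_zero" and smult: "\<And>c x. F (cvf_smult c x) = cvf_smult c (F x)"
  shows "F x \<in> first_centre B' \<longleftrightarrow> x \<in> first_centre B"
    and "x \<in> rank_one_values B \<Longrightarrow> F x \<in> rank_one_values B'"
proof -
  have inj: "F x = F y \<longleftrightarrow> x = y" for x y using bij_is_inj[OF bij] by (auto simp: inj_def)
  have surj: "\<exists>x. y = F x" for y using bij_is_surj[OF bij] by (metis surjD)
  have zero': "F x = cvf_zero \<longleftrightarrow> x = cvf_zero" for x using inj[of x cvf_zero] zero by simp
  have ball: "(\<forall>y. y \<in> S' \<longrightarrow> Q y) \<longleftrightarrow> (\<forall>y. y \<in> S \<longrightarrow> Q (F y))"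
    if "\<And>x. F x \<in> S' \<longleftrightarrow> x \<in> S" for S S' Q
    using that surj by metis
  have N: "F x \<in> nil_part B' \<longleftrightarrow> x \<in> nil_part B" for x
    unfolding nil_part_def mem_Collect_eq using surj hom inj by metis
  show Z1: "F x \<in> first_centre B' \<longleftrightarrow> x \<in> first_centre B" for x
    unfolding first_centre_def mem_Collect_eq Ball_def ball[OF N] by (simp add: N hom[symmetric] zero')
  have Z2: "F x \<in> second_centre B' \<longleftrightarrow> x \<in> second_centre B" for x
    unfolding second_centre_def mem_Collect_eq Ball_def ball[OF N] by (simp add: N hom[symmetric] Z1)
  have C: "F x \<in> centralizer B' \<longleftrightarrow> x \<in> centralizer B" for x
    unfolding centralizer_def mem_Collect_eq Ball_def ball[OF Z2] by (simp add: N hom[symmetric] zero')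
  have T: "F x \<in> transporter B' \<longleftrightarrow> x \<in> transporter B" for x
    unfolding transporter_def mem_Collect_eq Ball_def ball[OF C] by (simp add: N hom[symmetric] Z1)
  assume x: "x \<in> rank_one_values B"
  then obtain y where y: "y \<in> transporter B" "\<forall>z \<in> second_centre B. \<exists>c. B y z = cvf_smult c x"
    "\<exists>z \<in> second_centre B. B y z \<noteq> cvf_zero" and x1: "x \<in> first_centre B"
    unfolding rank_one_values_def by blast
  have "\<forall>z \<in> second_centre B'. \<exists>c. B' (F y) z = cvf_smult c (F x)"
    unfolding Ball_def ball[OF Z2] using y(2) by (metis hom smult)
  moreover have "\<exists>z \<in> second_centre B'. B' (F y) z \<noteq> cvf_zero"
    using y(3) by (metis Z2 hom zero')
  ultimately show "F x \<in> rank_one_values B'"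
    unfolding rank_one_values_def using x1 y(1) Z1[of x] T[of y] by blast
qed

lemma nil_part_br:
  "CVF e f v1 v2 a1 a2 a3 b1 b2 b3 c0 c1 c2 c3 d0 d1 d2 d3 g1 g2 k1 k2 m \<in> nil_part (br t) \<longleftrightarrow>
    e = 0 \<and> f = 0" (is "?x \<in> _ \<longleftrightarrow> ?R")
proof
  assume "?x \<in> nil_part (br t)"
  then obtain x y where xy: "?x = br t x y" unfolding nil_part_def by blast
  then show ?R by (cases x; cases y) simp
next
  \<comment> \<open>The Euler field acts on the graded pieces by multiplication with the divisors below.\<close>
  assume ?R
  then have "?x = br t (CVF 1 0 0 0 0 0 0 0 0 0 0 0 0 0 0 0 0 0 0 0 0 0 0)
      (CVF 0 0 (- v1) (- v2) a1 a2 a3 b1 b2 b3 (c0 / 2) (c1 / 2) (c2 / 2) (c3 / 2) (d0 / 2) (d1 / 2) (d2 / 2) (d3 / 2)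
        (g1 / 3) (g2 / 3) (k1 / 3) (k2 / 3) (m / 4))"
    by (simp add: quad_act_defs top_quad_def top_cubic_def)
  then show "?x \<in> nil_part (br t)" unfolding nil_part_def by blast
qed

lemma top_quad_eq:
  "top_quad t a1 a2 a3 b1 b2 b3 c0 c1 c2 c3 =
     3 * (t * a1 - 2 * a3) * c0 + (t * b1 - 2 * b3 - 4 * a2) * c1 + (t * a3 - 2 * a1 - 4 * b2) * c2
     + 3 * (t * b3 - 2 * b1) * c3"
  unfolding top_quad_def by Groebner_Basis.algebra

lemmas br_eval = quad_act_defs top_quad_def top_cubic_def

context
  fixes t :: complex
  assumes t: "t \<in> params" and t': "t \<notin> special"
begin

lemma t_nonzero: "t \<noteq> 0" "t\<^sup>2 - 4 \<noteq> 0"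
  using t t' by (auto simp: params_def special_def)

text \<open>
  The functional \<open>top_quad\<close> and the action on cubic fields see every coefficient of a
  quadratic field, provided \<open>t \<noteq> 0\<close> and \<open>t\<^sup>2 \<noteq> 4\<close>.
\<close>

lemma quadratic_faithful:
  assumes "\<And>c0' c1' c2' c3' d0' d1' d2' d3'. br t
      (CVF 0 0 v1 v2 a1 a2 a3 b1 b2 b3 c0 c1 c2 c3 d0 d1 d2 d3 g1 g2 k1 k2 m)
      (cubic_vec c0' c1' c2' c3' d0' d1' d2' d3') = cvf_zero"
  shows "a1 = 0 \<and> a2 = 0 \<and> a3 = 0 \<and> b1 = 0 \<and> b2 = 0 \<and> b3 = 0"
  using assms[of 1 0 0 0 0 0 0 0] assms[of 0 1 0 0 0 0 0 0] assms[of 0 0 0 0 1 0 0 0] assms[of 0 0 0 0 0 0 0 1]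
    t_nonzero by (auto simp: br_eval cvf_zero_def algebra_simps)

lemma cubic_faithful:
  assumes "\<And>a1' a2' a3' b1' b2' b3'. br t (CVF 0 0 0 0 0 0 0 0 0 0 c0 c1 c2 c3 d0 d1 d2 d3 g1 g2 0 0 0) (quad_vec a1' a2' a3' b1' b2' b3') = cvf_zero"
  shows "c0 = 0 \<and> c1 = 0 \<and> c2 = 0 \<and> c3 = 0 \<and> d0 = 0 \<and> d1 = 0 \<and> d2 = 0 \<and> d3 = 0"
proof -
  note i = assms[of 1 0 0 0 0 0] assms[of 0 1 0 0 0 0] assms[of 0 0 1 0 0 0]
    assms[of 0 0 0 1 0 0] assms[of 0 0 0 0 1 0] assms[of 0 0 0 0 0 1]
  have "d1 = 0" using i(2) by (simp add: br_eval cvf_zero_def)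
  have "c2 = 0" using i(5) by (simp add: br_eval cvf_zero_def)
  have "t * c0 = 0" using i(1) \<open>c2 = 0\<close> by (auto simp: br_eval cvf_zero_def)
  have "3 * t * d0 - 2 * d2 = 0" using i(1) by (simp add: br_eval cvf_zero_def)
  moreover have "6 * d0 - t * d2 = 0" using i(3) by (simp add: br_eval cvf_zero_def)
  ultimately have "(t\<^sup>2 - 4) * d2 = 0" "(t\<^sup>2 - 4) * d0 = 0" by Groebner_Basis.algebra+
  have "t * c1 - 6 * c3 = 0" using i(4) by (simp add: br_eval cvf_zero_def)
  moreover have "2 * c1 - 3 * t * c3 = 0" using i(6) by (simp add: br_eval cvf_zero_def)
  ultimately have "(t\<^sup>2 - 4) * c1 = 0" "(t\<^sup>2 - 4) * c3 = 0" by Groebner_Basis.algebra+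
  have "t * d3 = 0" using i(3) \<open>d1 = 0\<close> \<open>c2 = 0\<close> \<open>t * c0 = 0\<close> t_nonzero
    by (simp add: br_eval cvf_zero_def)
  show ?thesis
    using t_nonzero \<open>d1 = 0\<close> \<open>c2 = 0\<close> \<open>t * c0 = 0\<close> \<open>(t\<^sup>2 - 4) * d2 = 0\<close> \<open>(t\<^sup>2 - 4) * d0 = 0\<close>
      \<open>(t\<^sup>2 - 4) * c1 = 0\<close> \<open>(t\<^sup>2 - 4) * c3 = 0\<close> \<open>t * d3 = 0\<close> by simp
qed

text \<open>
  Testing commutation on $z\partial_x$ removes the components along $\partial_z$, testing on a
  cubic multiple of $\partial_z$ removes $z\partial_x$ and $z\partial_y$, and the quadratic and
  cubic parts detect each other.
\<close>

lemma first_centre_br: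
  "CVF e f v1 v2 a1 a2 a3 b1 b2 b3 c0 c1 c2 c3 d0 d1 d2 d3 g1 g2 k1 k2 m \<in> first_centre (br t) \<longleftrightarrow>
    e = 0 \<and> f = 0 \<and> v1 = 0 \<and> v2 = 0 \<and> a1 = 0 \<and> a2 = 0 \<and> a3 = 0 \<and> b1 = 0 \<and> b2 = 0 \<and> b3 = 0 \<and> c0 = 0 \<and> c1 = 0 \<and> c2 = 0 \<and> c3 = 0 \<and> d0 = 0 \<and> d1 = 0 \<and> d2 = 0 \<and> d3 = 0 \<and> k1 = 0 \<and> k2 = 0 \<and> m = 0" (is "?x \<in> _ \<longleftrightarrow> ?R")
proof
  assume x: "?x \<in> first_centre (br t)"
  then have ef: "e = 0" "f = 0" by (simp_all add: first_centre_def nil_part_br)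
  have c: "br t (CVF 0 0 v1 v2 a1 a2 a3 b1 b2 b3 c0 c1 c2 c3 d0 d1 d2 d3 g1 g2 k1 k2 m) y = cvf_zero" if "y \<in> nil_part (br t)" for y
    using x that ef by (auto simp: first_centre_def)
  have k: "k1 = 0" "k2 = 0" "m = 0"
    using c[of "z_vec 1 0 0 0 0"] t_nonzero by (simp_all add: nil_part_br br_eval cvf_zero_def)
  have v: "v1 = 0" "v2 = 0"
    using c[of "z_vec 0 0 1 0 0"] by (simp_all add: nil_part_br br_eval cvf_zero_def)
  have q: "a1 = 0 \<and> a2 = 0 \<and> a3 = 0 \<and> b1 = 0 \<and> b2 = 0 \<and> b3 = 0"
    by (rule quadratic_faithful; rule c; simp add: nil_part_br)
  have "c0 = 0 \<and> c1 = 0 \<and> c2 = 0 \<and> c3 = 0 \<and> d0 = 0 \<and> d1 = 0 \<and> d2 = 0 \<and> d3 = 0"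
  proof (rule cubic_faithful)
    fix a1' a2' a3' b1' b2' b3'
    show "br t (CVF 0 0 0 0 0 0 0 0 0 0 c0 c1 c2 c3 d0 d1 d2 d3 g1 g2 0 0 0) (quad_vec a1' a2' a3' b1' b2' b3') = cvf_zero"
      using c[of "quad_vec a1' a2' a3' b1' b2' b3'"] k v q by (simp add: nil_part_br)
  qed
  then show ?R using ef k v q by simp
next
  assume z: ?R
  show "?x \<in> first_centre (br t)"
    unfolding first_centre_def
  proof (intro CollectI conjI ballI)
    show "?x \<in> nil_part (br t)" using z by (simp add: nil_part_br)
    fix y assume "y \<in> nil_part (br t)"
    then show "br t ?x y = cvf_zero"
      using z by (cases y) (simp add: nil_part_br br_eval cvf_zero_def)
  qed
qed

lemma second_centre_br:
  "CVF e f v1 v2 a1 a2 a3 b1 b2 b3 c0 c1 c2 c3 d0 d1 d2 d3 g1 g2 k1 k2 m \<in> second_centre (br t) \<longleftrightarrow>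
    e = 0 \<and> f = 0 \<and> v1 = 0 \<and> v2 = 0 \<and> a1 = 0 \<and> a2 = 0 \<and> a3 = 0 \<and> b1 = 0 \<and> b2 = 0 \<and> b3 = 0 \<and> k1 = 0 \<and> k2 = 0" (is "?x \<in> _ \<longleftrightarrow> ?R")
proof
  assume x: "?x \<in> second_centre (br t)"
  then have ef: "e = 0" "f = 0" by (simp_all add: second_centre_def nil_part_br)
  have c: "br t (CVF 0 0 v1 v2 a1 a2 a3 b1 b2 b3 c0 c1 c2 c3 d0 d1 d2 d3 g1 g2 k1 k2 m) y \<in> first_centre (br t)" if "y \<in> nil_part (br t)" for y
    using x that ef by (auto simp: second_centre_def)
  have k: "k1 = 0" "k2 = 0"
    using c[of "z_vec 1 0 0 0 0"] t_nonzero by (simp_all add: nil_part_br br_eval first_centre_br)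
  have v: "v1 = 0" "v2 = 0"
    using c[of "z_vec 0 0 1 0 0"] by (simp_all add: nil_part_br br_eval first_centre_br)
  have "a1 = 0 \<and> a2 = 0 \<and> a3 = 0 \<and> b1 = 0 \<and> b2 = 0 \<and> b3 = 0"
    using c[of "quad_vec 0 0 1 0 0 0"] c[of "quad_vec 0 0 0 1 0 0"] by (auto simp: nil_part_br br_eval first_centre_br)
  then show ?R using ef k v by simp
next
  assume z: ?R
  show "?x \<in> second_centre (br t)"
    unfolding second_centre_def
  proof (intro CollectI conjI ballI)
    show "?x \<in> nil_part (br t)" using z by (simp add: nil_part_br)
    fix y assume "y \<in> nil_part (br t)"
    then show "br t ?x y \<in> first_centre (br t)"
      using z by (cases y) (simp add: nil_part_br br_eval first_centre_br)
  qed
qed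

lemma centralizer_br:
  "CVF e f v1 v2 a1 a2 a3 b1 b2 b3 c0 c1 c2 c3 d0 d1 d2 d3 g1 g2 k1 k2 m \<in> centralizer (br t) \<longleftrightarrow>
    e = 0 \<and> f = 0 \<and> v1 = 0 \<and> v2 = 0 \<and> a1 = 0 \<and> a2 = 0 \<and> a3 = 0 \<and> b1 = 0 \<and> b2 = 0 \<and> b3 = 0" (is "?x \<in> _ \<longleftrightarrow> ?R")
proof
  assume x: "?x \<in> centralizer (br t)"
  then have ef: "e = 0" "f = 0" by (simp_all add: centralizer_def nil_part_br)
  have c: "br t (CVF 0 0 v1 v2 a1 a2 a3 b1 b2 b3 c0 c1 c2 c3 d0 d1 d2 d3 g1 g2 k1 k2 m) y = cvf_zero" if "y \<in> second_centre (br t)" for y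
    using x that ef by (auto simp: centralizer_def)
  have v: "v1 = 0" "v2 = 0"
    using c[of "z_vec 0 0 0 0 1"] by (simp_all add: second_centre_br br_eval cvf_zero_def)
  have "a1 = 0 \<and> a2 = 0 \<and> a3 = 0 \<and> b1 = 0 \<and> b2 = 0 \<and> b3 = 0"
    by (rule quadratic_faithful; rule c; simp add: second_centre_br)
  then show ?R using ef v by simp
next
  assume z: ?R
  show "?x \<in> centralizer (br t)"
    unfolding centralizer_def
  proof (intro CollectI conjI ballI)
    show "?x \<in> nil_part (br t)" using z by (simp add: nil_part_br)
    fix y assume "y \<in> second_centre (br t)"
    then show "br t ?x y = cvf_zero"
      using z by (cases y) (simp add: second_centre_br br_eval cvf_zero_def)
  qed
qed

lemma transporter_brD:
  assumes "CVF e f v1 v2 a1 a2 a3 b1 b2 b3 c0 c1 c2 c3 d0 d1 d2 d3 g1 g2 k1 k2 m \<in> transporter (br t)"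
  shows "e = 0 \<and> f = 0 \<and> v1 = 0 \<and> v2 = 0"
proof -
  have ef: "e = 0" "f = 0" using assms by (simp_all add: transporter_def nil_part_br)
  have "br t (CVF 0 0 v1 v2 a1 a2 a3 b1 b2 b3 c0 c1 c2 c3 d0 d1 d2 d3 g1 g2 k1 k2 m) (z_vec 0 0 1 0 0) \<in> first_centre (br t)"
  proof -
    have "z_vec 0 0 1 0 0 \<in> centralizer (br t)" by (simp add: centralizer_br)
    then show ?thesis using assms[unfolded ef] unfolding transporter_def by blast
  qed
  then have "v1 = 0" "v2 = 0" by (simp_all add: br_eval first_centre_br)
  then show ?thesis using ef by simp
qed

lemma transporter_brI:
  assumes "top_quad t a1 a2 a3 b1 b2 b3 2 0 t 0 = 0" "top_quad t a1 a2 a3 b1 b2 b3 0 t 0 2 = 0"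
  shows "quad_vec a1 a2 a3 b1 b2 b3 \<in> transporter (br t)"
  unfolding transporter_def
proof (intro CollectI conjI ballI)
  show "quad_vec a1 a2 a3 b1 b2 b3 \<in> nil_part (br t)" by (simp add: nil_part_br)
  fix y assume y: "y \<in> centralizer (br t)"
  have l: "top_quad t a1 a2 a3 b1 b2 b3 (2 * r) (t * s) (t * r) (2 * s) = 0" for r s
  proof -
    have "top_quad t a1 a2 a3 b1 b2 b3 (2 * r) (t * s) (t * r) (2 * s) =
        r * top_quad t a1 a2 a3 b1 b2 b3 2 0 t 0 + s * top_quad t a1 a2 a3 b1 b2 b3 0 t 0 2"
      unfolding top_quad_def by Groebner_Basis.algebra
    then show ?thesis by (simp add: assms)
  qed
  have "top_quad t 0 0 0 0 0 0 x y z w = 0" for x y z w by (simp add: top_quad_def)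
  then show "br t (quad_vec a1 a2 a3 b1 b2 b3) y \<in> first_centre (br t)"
    using y l by (cases y) (simp add: centralizer_br first_centre_br quad_act_defs)
qed

text \<open>
  Let $\ell$ be the functional \<open>apolar t\<close>, $\eta = ux+vy$, $a$ and $b$ the quadratic
  forms with the given coefficients, $r = ua+vb$ and $L(c) = \ell(a\partial_xc+b\partial_yc)$. The
  hypotheses are the instances at the cubic monomials $c$ of $uL(c) = \ell(c\partial_xr)$ and
  $vL(c) = \ell(c\partial_yr)$; they say that $(u,v)$ annihilates the image of the quadratic field
  on the cubic ones. Then $v\partial_xr = u\partial_yr$, so $r = \lambda\eta^2$ and
  $L(c) = 2\lambda\ell(c\eta)$. At $c = \eta^3$ this gives $2\lambda\ell(\eta^4)$, whereas the
  definition of $L$ gives $3\ell(\eta^2r) = 3\lambda\ell(\eta^4)$. Hence $\ell(\eta^4) = 0$ unless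
  $\lambda = 0$, and then $L$ and $r$ vanish, which forces the quadratic field to be zero.
\<close>

lemma rank_one_quartic:
  fixes u v :: complex
  assumes 1: "u * (3 * (t * a1 - 2 * a3)) = 2 * t * (u * a1 + v * b1)"
    and 2: "u * (t * b1 - 2 * b3 - 4 * a2) = - 2 * (u * a2 + v * b2)"
    and 3: "u * (t * a3 - 2 * a1 - 4 * b2) = - 4 * (u * a1 + v * b1)"
    and 4: "u * (3 * (t * b3 - 2 * b1)) = t * (u * a2 + v * b2)"
    and 5: "v * (3 * (t * a1 - 2 * a3)) = t * (u * a2 + v * b2)"
    and 6: "v * (t * b1 - 2 * b3 - 4 * a2) = - 4 * (u * a3 + v * b3)"
    and 7: "v * (t * a3 - 2 * a1 - 4 * b2) = - 2 * (u * a2 + v * b2)"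
    and 8: "v * (3 * (t * b3 - 2 * b1)) = 2 * t * (u * a3 + v * b3)"
    and uv: "u \<noteq> 0 \<or> v \<noteq> 0" and nz: "\<not> (a1 = 0 \<and> a2 = 0 \<and> a3 = 0 \<and> b1 = 0 \<and> b2 = 0 \<and> b3 = 0)"
  shows "t * (u ^ 4 + v ^ 4) - 12 * u\<^sup>2 * v\<^sup>2 = 0"
proof -
  define r1 where "r1 = u * a1 + v * b1"
  define r2 where "r2 = u * a2 + v * b2"
  define r3 where "r3 = u * a3 + v * b3"
  define l0 where "l0 = 3 * (t * a1 - 2 * a3)"
  define l1 where "l1 = t * b1 - 2 * b3 - 4 * a2"
  define l2 where "l2 = t * a3 - 2 * a1 - 4 * b2"
  define l3 where "l3 = 3 * (t * b3 - 2 * b1)"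
  note e = 1[folded r1_def l0_def] 2[folded r2_def l1_def] 3[folded r1_def l2_def] 4[folded r2_def l3_def]
    5[folded r2_def l0_def] 6[folded r3_def l1_def] 7[folded r2_def l2_def] 8[folded r3_def l3_def]
  \<comment> \<open>These two steps compare the coefficients in $v\partial_xr = u\partial_yr$.\<close>
  have "t * (2 * v * r1 - u * r2) = 0" using e(1,5) by Groebner_Basis.algebra
  then have p1: "2 * v * r1 = u * r2" using t_nonzero by simp
  have "2 * (v * r2 - 2 * u * r3) = 0" using e(2,6) by Groebner_Basis.algebra
  then have p2: "v * r2 = 2 * u * r3" by (simp add: ac_simps)
  obtain a where a: "r1 = a * u\<^sup>2" "r2 = 2 * a * u * v" "r3 = a * v\<^sup>2"
  proof (cases "u = 0")
    case False
    have r2: "r2 = 2 * v * r1 / u" using p1 False by (simp add: field_simps)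
    have r3: "r3 = v * r2 / (2 * u)" using p2 False by (simp add: field_simps)
    show thesis
      by (rule that[of "r1 / u\<^sup>2"]) (use False in \<open>simp_all add: r3 r2 field_simps power2_eq_square\<close>)
  next
    case True
    then have "v \<noteq> 0" using uv by simp
    then have "r1 = 0" "r2 = 0" using p1 p2 True by simp_all
    then show thesis
      by (intro that[of "r3 / v\<^sup>2"]) (use True \<open>v \<noteq> 0\<close> in simp_all)
  qed
  have cancel: "x = y" if "u * x = u * y" "v * x = v * y" for x y
    using that uv by auto
  have l: "l0 = 2 * t * a * u" "l1 = - 4 * a * v" "l2 = - 4 * a * u" "l3 = 2 * t * a * v"
    by (rule cancel; simp add: e a power2_eq_square)+
  \<comment> \<open>The left-hand side is $L(\eta^3)$.\<close>
  have "u^3 * l0 + 3 * u\<^sup>2 * v * l1 + 3 * u * v\<^sup>2 * l2 + v^3 * l3 =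
      3 * (t * u\<^sup>2 * r1 - 2 * (u\<^sup>2 * r3 + 2 * u * v * r2 + v\<^sup>2 * r1) + t * v\<^sup>2 * r3)"
    unfolding l0_def l1_def l2_def l3_def r1_def r2_def r3_def by Groebner_Basis.algebra
  then have "a * (t * (u ^ 4 + v ^ 4) - 12 * u\<^sup>2 * v\<^sup>2) = 0"
    unfolding l a by Groebner_Basis.algebra
  moreover have "a \<noteq> 0"
  proof
    assume a0: "a = 0"
    have z: "t * a1 - 2 * a3 = 0" "t * b1 - 2 * b3 - 4 * a2 = 0" "t * a3 - 2 * a1 - 4 * b2 = 0" "t * b3 - 2 * b1 = 0"
      using l unfolding a0 l0_def l1_def l2_def l3_def by (simp_all add: mult.commute)
    have r: "u * a1 + v * b1 = 0" "u * a2 + v * b2 = 0" "u * a3 + v * b3 = 0"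
      using a unfolding a0 r1_def r2_def r3_def by simp_all
    have "4 * b2 * u = 0" "4 * a2 * v = 0" using z r by Groebner_Basis.algebra+
    then have "b2 * u = 0" "a2 * v = 0" by simp_all
    then have ab2: "a2 = 0" "b2 = 0" using r(2) uv by auto
    then have "t * b1 - 2 * b3 = 0" "t * a3 - 2 * a1 = 0" using z by simp_all
    then have "(t\<^sup>2 - 4) * a1 = 0" "(t\<^sup>2 - 4) * a3 = 0" "(t\<^sup>2 - 4) * b1 = 0" "(t\<^sup>2 - 4) * b3 = 0"
      using z(1,4) by Groebner_Basis.algebra+
    then show False using nz ab2 t_nonzero by simp
  qed
  ultimately show ?thesis by simp
qed

text \<open>
  In the notation of \<open>rank_one_quartic\<close> and with $\lambda = 1$: solutions of
  $ua+vb = \eta^2$ are the multiple of the Euler field by $\eta$ plus $w(v\partial_x-u\partial_y)$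
  with an arbitrary quadratic form $w$. The condition on $L$ amounts to four linear equations for
  the three coefficients of $w$, which are compatible because $\ell(\eta^4) = 0$.
\<close>

lemma rank_one_exists:
  fixes u v :: complex
  assumes uv: "u \<noteq> 0" "v \<noteq> 0" and q: "t * (u ^ 4 + v ^ 4) - 12 * u\<^sup>2 * v\<^sup>2 = 0"
  obtains a1 a2 a3 b1 b2 b3 where
    "3 * (t * a1 - 2 * a3) = 2 * t * u" "t * b1 - 2 * b3 - 4 * a2 = - 4 * v"
    "t * a3 - 2 * a1 - 4 * b2 = - 4 * u" "3 * (t * b3 - 2 * b1) = 2 * t * v"
    "u * a1 + v * b1 = u\<^sup>2" "u * a2 + v * b2 = 2 * u * v" "u * a3 + v * b3 = v\<^sup>2"
proof -
  define p where "p = - t * u / (3 * v)"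
  define r where "r = t * v / (3 * u)"
  define w1 where "w1 = (t * p + 2 * r) / (t\<^sup>2 - 4)"
  define w3 where "w3 = (t * r + 2 * p) / (t\<^sup>2 - 4)"
  define w2 where "w2 = t * u\<^sup>2 / (12 * v\<^sup>2) - 1 / 2"
  have d: "(t\<^sup>2 - 4) * w1 = t * p + 2 * r" "(t\<^sup>2 - 4) * w3 = t * r + 2 * p"
    using t_nonzero by (simp_all add: w1_def w3_def)
  have "(t\<^sup>2 - 4) * (t * w1 - 2 * w3) = (t\<^sup>2 - 4) * p" "(t\<^sup>2 - 4) * (t * w3 - 2 * w1) = (t\<^sup>2 - 4) * r"
    using d by Groebner_Basis.algebra+
  then have pr: "t * w1 - 2 * w3 = p" "t * w3 - 2 * w1 = r" using t_nonzero by simp_all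
  have e1: "3 * v * (t * w1 - 2 * w3) = - t * u" "3 * u * (t * w3 - 2 * w1) = t * v"
    using uv unfolding pr by (simp_all add: p_def r_def)
  have e2: "12 * v\<^sup>2 * w2 = t * u\<^sup>2 - 6 * v\<^sup>2" using uv by (simp add: w2_def field_simps)
  have "v\<^sup>2 * (12 * u\<^sup>2 * w2) = v\<^sup>2 * (6 * u\<^sup>2 - t * v\<^sup>2)" using e2 q by Groebner_Basis.algebra
  then have e3: "12 * u\<^sup>2 * w2 = 6 * u\<^sup>2 - t * v\<^sup>2" using uv by simp
  have "3 * v * (t * (- u * w1) - 2 * (v - u * w3) - 4 * (v + v * w2)) = 3 * v * (- 4 * v)"
    using e1(1) e2 by Groebner_Basis.algebra
  then have f1: "t * (- u * w1) - 2 * (v - u * w3) - 4 * (v + v * w2) = - 4 * v"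
    by (subst (asm) mult_left_cancel) (use uv in simp_all)
  have "3 * u * (t * (v * w3) - 2 * (u + v * w1) - 4 * (u - u * w2)) = 3 * u * (- 4 * u)"
    using e1(2) e3 by Groebner_Basis.algebra
  then have f2: "t * (v * w3) - 2 * (u + v * w1) - 4 * (u - u * w2) = - 4 * u"
    by (subst (asm) mult_left_cancel) (use uv in simp_all)
  show thesis
  \<comment> \<open>The forms $a = \eta x + vw$ and $b = \eta y - uw$.\<close>
  proof (rule that[of "u + v * w1" "v * w3" "- u * w1" "v - u * w3" "v + v * w2" "u - u * w2"])
    show "3 * (t * (u + v * w1) - 2 * (v * w3)) = 2 * t * u" using e1(1) by Groebner_Basis.algebra
    show "3 * (t * (v - u * w3) - 2 * (- u * w1)) = 2 * t * v" using e1(2) by Groebner_Basis.algebra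
  qed (rule f1 f2 | Groebner_Basis.algebra)+
qed

lemma rank_one_values_brD:
  assumes "top_vec g1 g2 \<in> rank_one_values (br t)"
  shows "t * (g1 ^ 4 + g2 ^ 4) - 12 * g1\<^sup>2 * g2\<^sup>2 = 0"
proof -
  obtain x where x: "x \<in> transporter (br t)"
    and sm: "\<And>y. y \<in> second_centre (br t) \<Longrightarrow> \<exists>c. br t x y = cvf_smult c (top_vec g1 g2)"
    and nz: "\<exists>y \<in> second_centre (br t). br t x y \<noteq> cvf_zero"
    using assms unfolding rank_one_values_def by blast
  obtain e f v1 v2 a1 a2 a3 b1 b2 b3 c0 c1 c2 c3 d0 d1 d2 d3 h1 h2 k1 k2 m
    where x': "x = CVF e f v1 v2 a1 a2 a3 b1 b2 b3 c0 c1 c2 c3 d0 d1 d2 d3 h1 h2 k1 k2 m" by (cases x)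
  have z: "e = 0" "f = 0" "v1 = 0" "v2 = 0" using transporter_brD[OF x[unfolded x']] by simp_all
  have rel: "g2 * (top_quad t a1 a2 a3 b1 b2 b3 c0' c1' c2' c3' - top_cubic t c0' c1' c2' c3' d0' d1' d2' d3' a1 a2 a3) -
     g1 * (top_quad t a1 a2 a3 b1 b2 b3 d0' d1' d2' d3' - top_cubic t c0' c1' c2' c3' d0' d1' d2' d3' b1 b2 b3) = 0"
    for c0' c1' c2' c3' d0' d1' d2' d3'
  proof -
    have "cubic_vec c0' c1' c2' c3' d0' d1' d2' d3' \<in> second_centre (br t)"
      by (simp add: second_centre_br)
    from sm[OF this] obtain c where
      "br t x (cubic_vec c0' c1' c2' c3' d0' d1' d2' d3') = cvf_smult c (top_vec g1 g2)" by blast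
    moreover have "top_quad t 0 0 0 0 0 0 p q r s = 0" "top_cubic t c0 c1 c2 c3 d0 d1 d2 d3 0 0 0 = 0" for p q r s
      by (simp_all add: top_quad_def top_cubic_def)
    ultimately have e:
      "top_quad t a1 a2 a3 b1 b2 b3 c0' c1' c2' c3' - top_cubic t c0' c1' c2' c3' d0' d1' d2' d3' a1 a2 a3 = c * g1"
      "top_quad t a1 a2 a3 b1 b2 b3 d0' d1' d2' d3' - top_cubic t c0' c1' c2' c3' d0' d1' d2' d3' b1 b2 b3 = c * g2"
      by (simp_all add: x' z)
    show ?thesis unfolding e by (simp add: algebra_simps)
  qed
  have g: "g2 \<noteq> 0 \<or> - g1 \<noteq> 0"
  proof (rule ccontr)
    assume "\<not> (g2 \<noteq> 0 \<or> - g1 \<noteq> 0)"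
    then have "br t x y = cvf_zero" if "y \<in> second_centre (br t)" for y
      using sm[OF that] by (auto simp: cvf_zero_def)
    then show False using nz by blast
  qed
  have q: "\<not> (a1 = 0 \<and> a2 = 0 \<and> a3 = 0 \<and> b1 = 0 \<and> b2 = 0 \<and> b3 = 0)"
  proof
    assume "a1 = 0 \<and> a2 = 0 \<and> a3 = 0 \<and> b1 = 0 \<and> b2 = 0 \<and> b3 = 0"
    then have "br t x y = cvf_zero" if "y \<in> second_centre (br t)" for y
      using that z by (cases y) (simp add: x' second_centre_br br_eval cvf_zero_def)
    then show False using nz by blast
  qed
  have "t * (g2 ^ 4 + (- g1) ^ 4) - 12 * g2\<^sup>2 * (- g1)\<^sup>2 = 0"
  proof (rule rank_one_quartic[OF _ _ _ _ _ _ _ _ g q])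
    show "g2 * (3 * (t * a1 - 2 * a3)) = 2 * t * (g2 * a1 + - g1 * b1)"
      using rel[of 1 0 0 0 0 0 0 0] by (simp add: br_eval algebra_simps)
    show "g2 * (t * b1 - 2 * b3 - 4 * a2) = - 2 * (g2 * a2 + - g1 * b2)"
      using rel[of 0 1 0 0 0 0 0 0] by (simp add: br_eval algebra_simps)
    show "g2 * (t * a3 - 2 * a1 - 4 * b2) = - 4 * (g2 * a1 + - g1 * b1)"
      using rel[of 0 0 1 0 0 0 0 0] by (simp add: br_eval algebra_simps)
    show "g2 * (3 * (t * b3 - 2 * b1)) = t * (g2 * a2 + - g1 * b2)"
      using rel[of 0 0 0 1 0 0 0 0] by (simp add: br_eval algebra_simps)
    show "- g1 * (3 * (t * a1 - 2 * a3)) = t * (g2 * a2 + - g1 * b2)"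
      using rel[of 0 0 0 0 1 0 0 0] by (simp add: br_eval algebra_simps)
    show "- g1 * (t * b1 - 2 * b3 - 4 * a2) = - 4 * (g2 * a3 + - g1 * b3)"
      using rel[of 0 0 0 0 0 1 0 0] by (simp add: br_eval algebra_simps)
    show "- g1 * (t * a3 - 2 * a1 - 4 * b2) = - 2 * (g2 * a2 + - g1 * b2)"
      using rel[of 0 0 0 0 0 0 1 0] by (simp add: br_eval algebra_simps)
    show "- g1 * (3 * (t * b3 - 2 * b1)) = 2 * t * (g2 * a3 + - g1 * b3)"
      using rel[of 0 0 0 0 0 0 0 1] by (simp add: br_eval algebra_simps)
  qed
  then show ?thesis by (simp add: ac_simps)
qed

lemma rank_one_values_brI:
  assumes nz: "g1 \<noteq> 0 \<or> g2 \<noteq> 0" and q: "t * (g1 ^ 4 + g2 ^ 4) - 12 * g1\<^sup>2 * g2\<^sup>2 = 0"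
  shows "top_vec g1 g2 \<in> rank_one_values (br t)"
proof -
  have g: "g1 \<noteq> 0" "g2 \<noteq> 0" using nz q t_nonzero by auto
  have uv: "g2 \<noteq> 0" "- g1 \<noteq> 0" and q': "t * (g2 ^ 4 + (- g1) ^ 4) - 12 * g2\<^sup>2 * (- g1)\<^sup>2 = 0"
    using g q by (simp_all add: ac_simps)
  obtain a1 a2 a3 b1 b2 b3 where
    l: "3 * (t * a1 - 2 * a3) = 2 * t * g2" "t * b1 - 2 * b3 - 4 * a2 = - 4 * - g1"
    "t * a3 - 2 * a1 - 4 * b2 = - 4 * g2" "3 * (t * b3 - 2 * b1) = 2 * t * - g1"
    and r: "g2 * a1 + - g1 * b1 = g2\<^sup>2" "g2 * a2 + - g1 * b2 = 2 * g2 * - g1" "g2 * a3 + - g1 * b3 = (- g1)\<^sup>2"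
    using rank_one_exists[OF uv q'] by metis
  let ?x = "quad_vec a1 a2 a3 b1 b2 b3"
  have tq: "top_quad t a1 a2 a3 b1 b2 b3 p0 p1 p2 p3 = 2 * t * g2 * p0 + 4 * g1 * p1 - 4 * g2 * p2 - 2 * t * g1 * p3"
    for p0 p1 p2 p3
    unfolding top_quad_eq l by Groebner_Basis.algebra
  have x: "?x \<in> transporter (br t)"
    by (rule transporter_brI) (simp_all add: tq)
  have val: "br t ?x y = top_vec
      (top_quad t a1 a2 a3 b1 b2 b3 c0 c1 c2 c3 - top_cubic t c0 c1 c2 c3 d0 d1 d2 d3 a1 a2 a3)
      (top_quad t a1 a2 a3 b1 b2 b3 d0 d1 d2 d3 - top_cubic t c0 c1 c2 c3 d0 d1 d2 d3 b1 b2 b3)"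
    if "y = CVF 0 0 0 0 0 0 0 0 0 0 c0 c1 c2 c3 d0 d1 d2 d3 h1 h2 0 0 m" for y c0 c1 c2 c3 d0 d1 d2 d3 h1 h2 m
    by (simp add: that quad_act_defs) (simp add: top_quad_def top_cubic_def)
  have "\<exists>c. br t ?x y = cvf_smult c (top_vec g1 g2)" if y: "y \<in> second_centre (br t)" for y
  proof -
    obtain c0 c1 c2 c3 d0 d1 d2 d3 h1 h2 m where y': "y = CVF 0 0 0 0 0 0 0 0 0 0 c0 c1 c2 c3 d0 d1 d2 d3 h1 h2 0 0 m"
      using y by (cases y) (auto simp: second_centre_br)
    let ?G1 = "top_quad t a1 a2 a3 b1 b2 b3 c0 c1 c2 c3 - top_cubic t c0 c1 c2 c3 d0 d1 d2 d3 a1 a2 a3"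
    let ?G2 = "top_quad t a1 a2 a3 b1 b2 b3 d0 d1 d2 d3 - top_cubic t c0 c1 c2 c3 d0 d1 d2 d3 b1 b2 b3"
    have "g2 * ?G1 - g1 * ?G2 =
      g2 * (2 * t * g2 * c0 + 4 * g1 * c1 - 4 * g2 * c2 - 2 * t * g1 * c3)
      - g1 * (2 * t * g2 * d0 + 4 * g1 * d1 - 4 * g2 * d2 - 2 * t * g1 * d3)
      - (2 * (g2 * a1 + - g1 * b1) * (t * c0 - 2 * c2) + (g2 * a2 + - g1 * b2) * (t * c3 - 2 * c1)
         + (g2 * a2 + - g1 * b2) * (t * d0 - 2 * d2) + 2 * (g2 * a3 + - g1 * b3) * (t * d3 - 2 * d1))"
      unfolding tq top_cubic_def by Groebner_Basis.algebra
    also have "\<dots> = 0" unfolding r by Groebner_Basis.algebra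
    finally have "?G2 = ?G1 / g1 * g2" using g by (simp add: field_simps)
    then have "br t ?x y = cvf_smult (?G1 / g1) (top_vec g1 g2)"
      unfolding val[OF y'] using g by simp
    then show ?thesis by blast
  qed
  moreover have "\<exists>y \<in> second_centre (br t). br t ?x y \<noteq> cvf_zero"
  proof -
    have "a2 \<noteq> 0 \<or> b2 \<noteq> 0" using r(2) g by auto
    then have "br t ?x (cubic_vec 0 0 0 0 1 0 0 0) \<noteq> cvf_zero \<or> br t ?x (cubic_vec 0 0 0 1 0 0 0 0) \<noteq> cvf_zero"
      using t_nonzero by (auto simp: br_eval cvf_zero_def)
    moreover have "cubic_vec 0 0 0 0 1 0 0 0 \<in> second_centre (br t)" "cubic_vec 0 0 0 1 0 0 0 0 \<in> second_centre (br t)"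
      by (simp_all add: second_centre_br)
    ultimately show ?thesis by blast
  qed
  ultimately show ?thesis
    unfolding rank_one_values_def using x by (auto simp: first_centre_br)
qed

end

section \<open>The Torelli property\<close>

lemma params_dual:
  assumes "t \<in> params - special"
  shows "- 12 / t \<in> params"
proof -
  have t: "t \<noteq> 0" "t \<noteq> 6" "t \<noteq> -6" using assms by (auto simp: special_def)
  have "- 12 / t \<noteq> 2" "- 12 / t \<noteq> - 2" using t by (auto simp: field_simps)
  then show ?thesis by (simp add: params_iff)
qed

text \<open>
  The linear map is the restriction of the isomorphism to the first centre.
\<close>

lemma Yau_model_linear_map:
  assumes t: "t \<in> params - special" and s: "s \<in> params - special"
    and iso: "lie_isomorphic (Yau_model t) (Yau_model s)"
  obtains a b c d where "a * d - b * c \<noteq> 0"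
    "\<And>x y. x \<noteq> 0 \<or> y \<noteq> 0 \<Longrightarrow> t * (x ^ 4 + y ^ 4) - 12 * x\<^sup>2 * y\<^sup>2 = 0 \<Longrightarrow>
      s * ((a * x + b * y) ^ 4 + (c * x + d * y) ^ 4) - 12 * (a * x + b * y)\<^sup>2 * (c * x + d * y)\<^sup>2 = 0"
proof -
  have t': "t \<in> params" "t \<notin> special" and s': "s \<in> params" "s \<notin> special" using t s by auto
  obtain F where bij: "bij F" and add: "\<And>x y. F (cvf_add x y) = cvf_add (F x) (F y)"
    and hom: "\<And>x y. F (br t x y) = br s (F x) (F y)"
    and smult: "\<And>c x. F (cvf_smult c x) = cvf_smult c (F x)"
    using iso unfolding lie_isomorphic_def Yau_model_def by auto
  have z: "cvf_smult 0 x = cvf_zero" for x by (cases x) (simp add: cvf_zero_def)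
  have zero: "F cvf_zero = cvf_zero" using smult[of 0 cvf_zero] by (simp add: z)
  note inv = invariants_image[of F "br t" "br s", OF bij hom zero smult]
  have top: "\<exists>p q. F (top_vec x y) = top_vec p q" for x y
  proof -
    have "F (top_vec x y) \<in> first_centre (br s)"
      using inv(1)[of "top_vec x y"] by (simp add: first_centre_br[OF t'])
    then show ?thesis by (cases "F (top_vec x y)") (auto simp: first_centre_br[OF s'])
  qed
  obtain a c where ac: "F (top_vec 1 0) = top_vec a c" using top by blast
  obtain b d where bd: "F (top_vec 0 1) = top_vec b d" using top by blast
  have F: "F (top_vec x y) = top_vec (a * x + b * y) (c * x + d * y)" for x y
  proof -
    have "top_vec x y = cvf_add (cvf_smult x (top_vec 1 0)) (cvf_smult y (top_vec 0 1))" by simp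
    then have "F (top_vec x y) = cvf_add (cvf_smult x (top_vec a c)) (cvf_smult y (top_vec b d))"
      by (simp only: add smult ac bd)
    then show ?thesis by (simp add: mult.commute)
  qed
  have kernel: "x = 0 \<and> y = 0" if "a * x + b * y = 0" "c * x + d * y = 0" for x y
  proof -
    have "F (top_vec x y) = F cvf_zero" unfolding F that zero by (simp add: cvf_zero_def)
    then have "top_vec x y = cvf_zero" using bij_is_inj[OF bij] by (simp add: inj_eq)
    then show ?thesis by (simp add: cvf_zero_def)
  qed
  have "a * d - b * c \<noteq> 0"
  proof
    assume "a * d - b * c = 0"
    then have "a * d + b * - c = 0" "c * d + d * - c = 0" "a * - b + b * a = 0" "c * - b + d * a = 0"
      by (simp_all add: algebra_simps)
    then have "d = 0" "c = 0" "b = 0" "a = 0" using kernel[of d "- c"] kernel[of "- b" a] by simp_all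
    then show False using kernel[of 1 0] by simp
  qed
  moreover have "s * ((a * x + b * y) ^ 4 + (c * x + d * y) ^ 4) - 12 * (a * x + b * y)\<^sup>2 * (c * x + d * y)\<^sup>2 = 0"
    if "x \<noteq> 0 \<or> y \<noteq> 0" "t * (x ^ 4 + y ^ 4) - 12 * x\<^sup>2 * y\<^sup>2 = 0" for x y
  proof -
    have "top_vec x y \<in> rank_one_values (br t)" by (rule rank_one_values_brI[OF t' that])
    then have "F (top_vec x y) \<in> rank_one_values (br s)" by (rule inv(2))
    then show ?thesis unfolding F by (rule rank_one_values_brD[OF s'])
  qed
  ultimately show thesis using that by blast
qed

text \<open>
  The roots of a normalized quartic are $\pm p$ and $\pm 1/p$; they are distinct as the
  discriminant is not zero.
\<close>

lemma quartic_root: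
  fixes \<tau> :: complex
  assumes "\<tau> \<in> params"
  obtains p where "p \<noteq> 0" "p ^ 4 + \<tau> * p\<^sup>2 + 1 = 0" "p ^ 4 \<noteq> 1"
proof -
  define y where "y = (- \<tau> + csqrt (\<tau>\<^sup>2 - 4)) / 2"
  have "(2 * y + \<tau>)\<^sup>2 = \<tau>\<^sup>2 - 4" by (simp add: y_def)
  then have "4 * (y\<^sup>2 + \<tau> * y + 1) = 0" by Groebner_Basis.algebra
  then have y: "y\<^sup>2 + \<tau> * y + 1 = 0" by (simp only: mult_eq_0_iff) simp
  define p where "p = csqrt y"
  have py2: "p\<^sup>2 = y" by (simp add: p_def)
  have "p ^ 4 = (p\<^sup>2)\<^sup>2" by (simp flip: power_mult)
  then have py: "p\<^sup>2 = y" "p ^ 4 = y\<^sup>2" using py2 by simp_all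
  have "y\<^sup>2 \<noteq> 1"
  proof
    assume "y\<^sup>2 = 1"
    then have "y = 1 \<or> y = - 1" by (simp add: power2_eq_1_iff)
    then have "\<tau> = 2 \<or> \<tau> = - 2" using y by (auto simp: add_eq_0_iff2 minus_equation_iff[of \<tau>])
    then show False using assms by (auto simp: params_iff)
  qed
  moreover have "p \<noteq> 0" using y py by auto
  ultimately show thesis using that[of p] y unfolding py by simp
qed

text \<open>
  A quartic vanishing at the four distinct roots of a normalized one is proportional to it. So the
  linear map is proportional to one of the matrices of the normal form.
\<close>

lemma roots_determine_parameter:
  fixes a b c d \<tau> \<sigma> :: complex
  assumes \<tau>: "\<tau> \<in> params" and \<sigma>: "\<sigma> \<in> params" and det: "a * d - b * c \<noteq> 0"
    and roots: "\<And>x y. x \<noteq> 0 \<or> y \<noteq> 0 \<Longrightarrow> x ^ 4 + y ^ 4 + \<tau> * x\<^sup>2 * y\<^sup>2 = 0 \<Longrightarrow>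
      (a * x + b * y) ^ 4 + (c * x + d * y) ^ 4 + \<sigma> * (a * x + b * y)\<^sup>2 * (c * x + d * y)\<^sup>2 = 0"
  obtains \<alpha> \<beta> where "index_pair \<alpha> \<beta>" "\<tau> = frac_lin \<alpha> \<beta> \<sigma>"
proof -
  obtain p where p: "p \<noteq> 0" "p ^ 4 + \<tau> * p\<^sup>2 + 1 = 0" "p ^ 4 \<noteq> 1" by (rule quartic_root[OF \<tau>])
  define q0 where "q0 = qx4 \<sigma> a c"
  define q1 where "q1 = qx3y \<sigma> a b c d"
  define q2 where "q2 = qx2y2 \<sigma> a b c d"
  define q3 where "q3 = qxy3 \<sigma> a b c d"
  define q4 where "q4 = qx4 \<sigma> b d"
  have Q: "q0 * x ^ 4 + q1 * (x ^ 3 * y) + q2 * (x\<^sup>2 * y\<^sup>2) + q3 * (x * y ^ 3) + q4 * y ^ 4 = 0"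
    if "x \<noteq> 0 \<or> y \<noteq> 0" "x ^ 4 + y ^ 4 + \<tau> * x\<^sup>2 * y\<^sup>2 = 0" for x y
    using roots[OF that] unfolding binary_quartic_expand q0_def q1_def q2_def q3_def q4_def .
  have r: "p ^ 4 + 1 ^ 4 + \<tau> * p\<^sup>2 * 1\<^sup>2 = 0" "p ^ 4 + (- 1) ^ 4 + \<tau> * p\<^sup>2 * (- 1)\<^sup>2 = 0"
    "1 ^ 4 + p ^ 4 + \<tau> * 1\<^sup>2 * p\<^sup>2 = 0" "(- 1) ^ 4 + p ^ 4 + \<tau> * (- 1)\<^sup>2 * p\<^sup>2 = 0"
    using p(2) by (simp_all add: algebra_simps)
  have e: "q0 * p ^ 4 + q1 * p ^ 3 + q2 * p\<^sup>2 + q3 * p + q4 = 0"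
    "q0 * p ^ 4 - q1 * p ^ 3 + q2 * p\<^sup>2 - q3 * p + q4 = 0"
    "q0 + q1 * p + q2 * p\<^sup>2 + q3 * p ^ 3 + q4 * p ^ 4 = 0"
    "q0 - q1 * p + q2 * p\<^sup>2 - q3 * p ^ 3 + q4 * p ^ 4 = 0"
    using Q[OF _ r(1)] Q[OF _ r(2)] Q[OF _ r(3)] Q[OF _ r(4)] p(1) by simp_all
  \<comment> \<open>Roots of opposite sign separate the even from the odd coefficients.\<close>
  have "2 * p * (q1 * p\<^sup>2 + q3) = 0" "2 * p * (q1 + q3 * p\<^sup>2) = 0"
    using e by Groebner_Basis.algebra+
  then have o: "q1 * p\<^sup>2 + q3 = 0" "q1 + q3 * p\<^sup>2 = 0" using p(1) by simp_all
  have "q1 * (p ^ 4 - 1) = 0" "q3 * (p ^ 4 - 1) = 0" using o by Groebner_Basis.algebra+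
  then have q13: "q1 = 0" "q3 = 0" using p(3) by simp_all
  have ev: "q0 * p ^ 4 + q2 * p\<^sup>2 + q4 = 0" "q0 + q2 * p\<^sup>2 + q4 * p ^ 4 = 0"
    using e(1,3) unfolding q13 by simp_all
  then have "(q0 - q4) * (p ^ 4 - 1) = 0" by Groebner_Basis.algebra
  then have q04: "q0 = q4" using p(3) by simp
  have "p\<^sup>2 * q2 = p\<^sup>2 * (\<tau> * q0)" using ev(1) p(2) unfolding q04 by Groebner_Basis.algebra
  then have q2: "q2 = \<tau> * q0" using p(1) by simp
  obtain \<alpha> \<beta> r where B: "index_pair \<alpha> \<beta>" "r \<noteq> 0" "q0 = r ^ 4 * cB \<alpha> \<beta> \<sigma>"
    "q2 = r ^ 4 * cB \<alpha> \<beta> \<sigma> * frac_lin \<alpha> \<beta> \<sigma>"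
    using normal_form_matrix[OF \<sigma> det q13[unfolded q1_def q3_def] q04[unfolded q0_def q4_def]]
    unfolding q0_def q2_def by metis
  have "(r ^ 4 * cB \<alpha> \<beta> \<sigma>) * \<tau> = (r ^ 4 * cB \<alpha> \<beta> \<sigma>) * frac_lin \<alpha> \<beta> \<sigma>"
    using q2 unfolding B(3,4) by (simp only: mult.commute)
  then have "\<tau> = frac_lin \<alpha> \<beta> \<sigma>" using B(2) cB_nonzero[OF \<sigma> B(1)] by simp
  then show thesis using that B(1) by blast
qed

text \<open>
  The involution $t \mapsto -12/t$, which passes from a quartic of the family to the one apolar to
  its partial derivatives, commutes with the fractional linear maps, because the squares of fourth
  roots of unity are their own inverses.
\<close>

lemma frac_lin_dual:
  assumes t: "t \<noteq> 0" and s: "s \<in> params - special" and i: "index_pair \<alpha> \<beta>"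
    and e: "- 12 / t = frac_lin \<alpha> \<beta> (- 12 / s)"
  shows "t = frac_lin \<alpha> \<beta> s"
proof -
  have s0: "s \<noteq> 0" "s \<noteq> 6" "s \<noteq> -6" and s1: "s \<in> params" using s by (auto simp: special_def)
  from i show ?thesis
  proof (cases rule: index_pair_cases)
    case 1
    then show ?thesis using e t s0 mu4_square[OF 1(2)] mu4_iff[of \<alpha>] 1 by (auto simp: frac_lin_def field_simps)
  next
    case 2
    then show ?thesis using e t s0 mu4_square[OF 2(2)] mu4_iff[of \<beta>] 2 by (auto simp: frac_lin_def field_simps)
  next
    case 3
    then have nz: "\<alpha> \<noteq> 0" "\<beta> \<noteq> 0" by (auto dest: mu4_nonzero)
    define A where "A = \<alpha>\<^sup>2"
    define B where "B = \<beta>\<^sup>2"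
    have AB: "A * A = 1" "B * B = 1"
      using mu4_iff[of \<alpha>] mu4_iff[of \<beta>] 3 by (simp_all add: A_def B_def flip: power_add)
    have d1: "2 + A * s \<noteq> 0" using params_denom[OF s1 3(1)] by (simp add: A_def)
    define D where "D = 2 + (- 12 / s) * A"
    define N where "N = 12 - 2 * A * (- 12 / s)"
    have D0: "D \<noteq> 0"
      using params_denom[OF params_dual[OF s] 3(1)] by (simp add: A_def D_def mult.commute)
    have sDN: "s * D = 2 * s - 12 * A" "s * N = 12 * s + 24 * A"
      using s0(1) by (simp_all add: D_def N_def distrib_left right_diff_distrib)
    have "- 12 / t = B * N / D"
      using e nz by (simp add: frac_lin_def A_def B_def D_def N_def)
    then have "- 12 * D = (B * N) * t" unfolding frac_eq_eq[OF t D0] .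
    then have "- 12 * (s * D) = t * (B * (s * N))" by Groebner_Basis.algebra
    then have "- 12 * (2 * s - 12 * A) = t * (B * (12 * s + 24 * A))" unfolding sDN .
    then have "12 * (t * (2 + A * s)) = 12 * (B * (12 - 2 * A * s))" using AB by Groebner_Basis.algebra
    then have "t * (2 + A * s) = B * (12 - 2 * A * s)" by simp
    then have "t = B * (12 - 2 * A * s) / (2 + A * s)" using d1 by (simp add: field_simps)
    then show ?thesis using nz by (simp add: frac_lin_def A_def B_def mult.commute)
  qed
qed

text \<open>
  The scale of $z$ is chosen such that $z^2$ acquires the same factor as the binary quartic.
\<close>

lemma contact_equivalent_frac_lin:
  assumes s: "s \<in> params" and i: "index_pair \<alpha> \<beta>"
  shows "contact_equivalent (fam (frac_lin \<alpha> \<beta> s)) (fam s)"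
proof -
  define \<gamma> where "\<gamma> = csqrt (cB \<alpha> \<beta> s)"
  have sq: "\<gamma>\<^sup>2 = cB \<alpha> \<beta> s" by (simp add: \<gamma>_def)
  have nz: "cB \<alpha> \<beta> s \<noteq> 0" by (rule cB_nonzero[OF s i])
  define \<phi> where "\<phi> = lin_subst (Btilde \<alpha> \<beta> \<gamma>)"
  have h: "\<phi> \<in> homog_auts" unfolding \<phi>_def using sq nz by (intro Btilde_homog i) auto
  have f: "\<phi> (fam s) = cst (cB \<alpha> \<beta> s) * fam (frac_lin \<alpha> \<beta> s)"
    unfolding \<phi>_def by (rule Btilde_fam_contact[OF s i sq])
  let ?\<psi> = "inv_into UNIV \<phi>"
  have \<psi>: "?\<psi> \<in> alg_auts" using alg_auts_inv[of \<phi>] h by (simp add: homog_auts_def)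
  then have hom: "alg_hom ?\<psi>" by (simp add: alg_auts_iff)
  have "fam s = ?\<psi> (\<phi> (fam s))" using homog_autsD(4)[OF h] by (simp add: inv_f_f)
  also have "\<dots> = cst (cB \<alpha> \<beta> s) * ?\<psi> (fam (frac_lin \<alpha> \<beta> s))"
    unfolding f by (simp add: alg_hom_simps[OF hom])
  finally have "cst (1 / cB \<alpha> \<beta> s) * fam s = ?\<psi> (fam (frac_lin \<alpha> \<beta> s))"
    using nz by (simp add: mult.assoc[symmetric] cst_mult[symmetric])
  moreover have "cst (1 / cB \<alpha> \<beta> s) \<in> Units \<O>"
    unfolding Units_def using nz
    by (auto intro!: exI[of _ "cst (cB \<alpha> \<beta> s)"] simp: cst_mult[symmetric])
  ultimately show ?thesis
    unfolding contact_equivalent_def using \<psi> by (metis (no_types))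
qed

theorem Torelli:
  assumes t: "t \<in> params - special" and s: "s \<in> params - special"
    and iso: "lie_isomorphic (Yau_algebra 1 t) (Yau_algebra 1 s)"
  shows "contact_equivalent (fam t) (fam s)"
proof -
  have t0: "t \<noteq> 0" and s0: "s \<noteq> 0" using t s by (auto simp: special_def)
  have model: "lie_isomorphic (Yau_model r) (Yau_algebra 1 r)" if "r \<in> params - special" for r
    using Yau_model_isomorphic that by blast
  have "lie_isomorphic (Yau_algebra 1 s) (Yau_model s)"
    by (rule lie_isomorphic_sym[OF model[OF s]]) (simp add: Yau_model_def)
  then have "lie_isomorphic (Yau_model t) (Yau_model s)"
    using lie_isomorphic_trans[OF lie_isomorphic_trans[OF model[OF t] iso]] by blast
  then obtain a b c d where det: "a * d - b * c \<noteq> 0"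
    and roots: "\<And>x y. x \<noteq> 0 \<or> y \<noteq> 0 \<Longrightarrow> t * (x ^ 4 + y ^ 4) - 12 * x\<^sup>2 * y\<^sup>2 = 0 \<Longrightarrow>
      s * ((a * x + b * y) ^ 4 + (c * x + d * y) ^ 4) - 12 * (a * x + b * y)\<^sup>2 * (c * x + d * y)\<^sup>2 = 0"
    by (rule Yau_model_linear_map[OF t s]) blast
  have norm: "r * (u ^ 4 + v ^ 4) - 12 * u\<^sup>2 * v\<^sup>2 = r * (u ^ 4 + v ^ 4 + (- 12 / r) * u\<^sup>2 * v\<^sup>2)"
    if "r \<noteq> 0" for r u v :: complex using that by (simp add: field_simps)
  have roots': "(a * x + b * y) ^ 4 + (c * x + d * y) ^ 4 + (- 12 / s) * (a * x + b * y)\<^sup>2 * (c * x + d * y)\<^sup>2 = 0"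
    if xy: "x \<noteq> 0 \<or> y \<noteq> 0" and z: "x ^ 4 + y ^ 4 + (- 12 / t) * x\<^sup>2 * y\<^sup>2 = 0" for x y
  proof -
    have "t * (x ^ 4 + y ^ 4) - 12 * x\<^sup>2 * y\<^sup>2 = 0" unfolding norm[OF t0] z by simp
    from roots[OF xy this] show ?thesis unfolding norm[OF s0] using s0 by (simp only: mult_eq_0_iff) simp
  qed
  obtain \<alpha> \<beta> where i: "index_pair \<alpha> \<beta>" and e: "- 12 / t = frac_lin \<alpha> \<beta> (- 12 / s)"
    using roots_determine_parameter[OF params_dual[OF t] params_dual[OF s] det roots'] by metis
  have "t = frac_lin \<alpha> \<beta> s" by (rule frac_lin_dual[OF t0 s i e])
  then show ?thesis using contact_equivalent_frac_lin[of s \<alpha> \<beta>] i s by simp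
qed

theorem theoremB:
  shows
    "(\<forall>k \<in> {0, 1 :: enat}.
        group_action Btilde_group (params - special) Btilde_action \<and>
        restrict_groupoid (Grp k) (params - special) =
          action_groupoid Btilde_group (params - special) Btilde_action) \<and>
     (\<forall>k \<ge> (2 :: enat). \<forall>t \<in> params. \<forall>s \<in> params.
        Mor (Grp k) t s =
          {g. s = t \<and>
              g \<in> {scalar_class id, Btilde_class (-1) 0 1, Btilde_class 0 1 1,
                   Btilde_class 0 (-1) 1,
                   Btilde_class 1 0 (-1), Btilde_class (-1) 0 (-1), Btilde_class 0 1 (-1),
                   Btilde_class 0 (-1) (-1)}} \<union>
          {g. \<exists>\<alpha> \<in> mu4. s = \<alpha>\<^sup>2 * t \<and>
              g \<in> {Btilde_class \<alpha> 0 1, Btilde_class 0 \<alpha> 1,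
                   Btilde_class \<alpha> 0 (-1), Btilde_class 0 \<alpha> (-1)}} \<union>
          {g. \<exists>\<alpha> \<in> mu4. \<exists>\<beta> \<in> mu4. s = \<beta>\<^sup>2 * (12 - 2 * \<alpha>\<^sup>2 * t) / (2 + \<alpha>\<^sup>2 * t) \<and>
              g \<in> {Btilde_class \<alpha> \<beta> (csqrt (2 + \<alpha>\<^sup>2 * t)),
                   Btilde_class \<alpha> \<beta> (- csqrt (2 + \<alpha>\<^sup>2 * t))}}) \<and>
     (\<forall>t \<in> params - special. \<forall>s \<in> params - special.
        lie_isomorphic (Yau_algebra 1 t) (Yau_algebra 1 s) \<longrightarrow>
          contact_equivalent (fam t) (fam s))"
proof -
  have k: "\<forall>k \<in> {0, 1 :: enat}.
        group_action Btilde_group (params - special) Btilde_action \<and>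
        restrict_groupoid (Grp k) (params - special) =
          action_groupoid Btilde_group (params - special) Btilde_action"
    using group_action_Btilde restrict_Grp_low[of 0] restrict_Grp_low[of 1]
    by (simp add: zero_enat_def one_enat_def)
  show ?thesis
    by (rule conjI[OF k], rule conjI,
        (intro allI impI ballI, rule Mor_high_explicit, assumption+)[1],
        intro ballI impI, rule Torelli)
qed

end
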